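(* Let $t>0$, $T=[-t,t]^2$, and let $X$ be a real-valued random field on $\mathbb{R}^2$ satisfying Assumptions A, B and C (stated in the context). Let $(m_n)_{n\ge1}$ be a non-decreasing sequence in $\mathbb{N}^+$ tending to $\infty$ as $n\to\infty$. Let $(\epsilon_n)_{n\ge1}$ be a sequence of positive reals such that $m_n\epsilon_n\to0$ as $n\to\infty$ and such that the vertices of $T$ are contained in $\mathcal{G}^{(T,\epsilon_n)}$ for all $n\in\mathbb{N}^+$. Then, for any fixed $u\in\mathbb{R}$, $$\big|\hat P_X^{(2)}(\epsilon_n,m_n;T,u)-P_X^T(u)\big|\longrightarrow 0\quad\text{in } L^1(\Omega)\text{ as } n\to\infty.$$
   Context: Assumption A: $X=\{X(s):s\in\mathbb{R}^2\}$ is a real-valued random field on a probability space $(\Omega,\mathcal{F},\mathbb{P})$ with $C^2$ sample paths. Let $X_1,X_2$ be the partial derivatives of $X$ in the two Cartesian directions and $X_{11},X_{22}$ the corresponding second-order partial derivatives. Assumption B (for $T$): for any $u\in\mathbb{R}$, the following hold almost surely: (1) $X$ has no critical points in $T$ at the level $u$; (2) the restriction of $X$ to each face of the square boundary $\partial(T)$ has no local extrema at the level $u$; (3) for $k\in\{1,2\}$ there is no $s\in T$ with $X(s)-u=X_k(s)=X_{kk}(s)=0$. Excursion set and perimeter: $E_X(u)=\{s\in\mathbb{R}^2:X(s)\ge u\}$; $E_X^\partial(T,u)=T\cap\partial(E_X(u))$, where $\partial$ denotes topological boundary; $P_X^T(u)=\mathcal{H}^1(E_X^\partial(T,u))$,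 with $\mathcal{H}^1$ the one-dimensional Hausdorff measure. $\Gamma_X^T(u)$ is the set of maximally connected subsets (connected components) of $E_X^\partial(T,u)$, and $\#$ denotes cardinality. Assumption C (for $T$): the random variables $P_X^T(u)$ and $\#(\Gamma_X^T(u))$ are in $L^1(\Omega)$ for all $u\in\mathbb{R}$. Grid: for $\epsilon>0$ put $s_{i,j}=(-t+i\epsilon,-t+j\epsilon)$ for $i,j\in\mathbb{N}_0=\{0,1,2,\dots\}$, and $\mathcal{G}^{(T,\epsilon)}=\{s_{i,j}:i,j\in\mathbb{N}_0\}\cap T$. Let $M$ be the number of rows (equivalently, columns) of $\mathcal{G}^{(T,\epsilon)}$, $I^{(T,\epsilon)}=\{0,\dots,M-1\}$, and for $m\in\mathbb{N}^+$ let $I^{(T,\epsilon,m)}=\{i\in I^{(T,\epsilon)}: i\equiv 0 \pmod m\}$. For $i,j\in I^{(T,\epsilon)}$ let $\zeta_{i,j}=1$ if $X(s_{i,j})\ge u$ and $\zeta_{i,j}=0$ otherwise. Estimator: for $a,b\in I^{(T,\epsilon,m)}$ let $$N_h(a,b)=\sum_{i=a}^{\min(a+m-1,M-1)}\ \sum_{j=b}^{\min(b+m-1,M-2)}|\zeta_{i,j}-\zeta_{i,j+1}|,\qquad N_v(a,b)=\sum_{i=a}^{\min(a+m-1,M-2)}\ \sum_{j=b}^{\min(b+m-1,M-1)}|\zeta_{i,j}-\zeta_{i+1,j}|,$$ and $$\hat P_X^{(2)}(\epsilon,m;T,u)=\epsilon\sum_{a\in I^{(T,\epsilon,m)}}\sum_{b\in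 I^{(T,\epsilon,m)}}\big\|(N_h(a,b),N_v(a,b))\big\|_2,$$ with $\|\cdot\|_2$ the Euclidean norm. (Empty sums are $0$.) *)

theory Defs
  imports "HOL-Probability.Probability"
begin

definition partial_deriv :: "2 \<Rightarrow> (real^2 \<Rightarrow> real) \<Rightarrow> real^2 \<Rightarrow> real" where
  "partial_deriv k f s = deriv (\<lambda>h. f (s + h *\<^sub>R axis k 1)) 0"

text \<open>
  The differentiability clause is needed because \<^const>\<open>deriv\<close> is a total function with an
  unspecified value where no derivative exists.
\<close>
definition C1_field :: "(real^2 \<Rightarrow> real) \<Rightarrow> bool" where
  "C1_field f \<longleftrightarrow>
    (\<forall>k. (\<forall>s. (\<lambda>h. f (s + h *\<^sub>R axis k 1)) field_differentiable (at 0)) \<and>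
         continuous_on UNIV (partial_deriv k f))"

definition C2_field :: "(real^2 \<Rightarrow> real) \<Rightarrow> bool" where
  "C2_field f \<longleftrightarrow> C1_field f \<and> (\<forall>k. C1_field (partial_deriv k f))"

text \<open>
  One-dimensional Hausdorff (outer) measure. The usual normalising constant equals 1 in
  dimension one. Boundedness of the covering sets is required because \<^const>\<open>diameter\<close> is not
  meaningful on unbounded sets.
\<close>
definition hausdorff1_delta :: "real \<Rightarrow> 'a::metric_space set \<Rightarrow> ennreal" where
  "hausdorff1_delta \<delta> S =
    (INF A \<in> {A :: nat \<Rightarrow> 'a set. S \<subseteq> (\<Union>i. A i) \<and> (\<forall>i. bounded (A i) \<and> diameter (A i) \<le> \<delta>)}.
       \<Sum>i. ennreal (diameter (A i)))"

definition hausdorff1 :: "'a::metric_space set \<Rightarrow> ennreal" where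
  "hausdorff1 S = (SUP \<delta> \<in> {0<..}. hausdorff1_delta \<delta> S)"

definition square :: "real \<Rightarrow> (real^2) set" where
  "square t = {s. \<forall>k. s $ k \<in> {-t..t}}"

definition square_vertices :: "real \<Rightarrow> (real^2) set" where
  "square_vertices t = {s. \<forall>k. s $ k \<in> {-t, t}}"

text \<open>
  The four closed sides; local extrema of the restriction to a side may occur at its end points.
\<close>
definition square_faces :: "real \<Rightarrow> (real^2) set set" where
  "square_faces t = {{s \<in> square t. s $ k = c} | k c. c \<in> {-t, t}}"

definition excursion_set :: "(real^2 \<Rightarrow> real) \<Rightarrow> real \<Rightarrow> (real^2) set" where
  "excursion_set f u = {s. f s \<ge> u}"

definition excursion_boundary :: "(real^2) set \<Rightarrow> (real^2 \<Rightarrow> real) \<Rightarrow> real \<Rightarrow> (real^2) set" where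
  "excursion_boundary T f u = T \<inter> frontier (excursion_set f u)"

definition perimeter :: "(real^2) set \<Rightarrow> (real^2 \<Rightarrow> real) \<Rightarrow> real \<Rightarrow> ennreal" where
  "perimeter T f u = hausdorff1 (excursion_boundary T f u)"

text \<open>
  The cardinality is taken as a counting measure, so that it is \<open>\<infinity>\<close> (rather than 0) when there
  are infinitely many components.
\<close>
definition num_boundary_components :: "(real^2) set \<Rightarrow> (real^2 \<Rightarrow> real) \<Rightarrow> real \<Rightarrow> ennreal" where
  "num_boundary_components T f u =
     emeasure (count_space UNIV) (components (excursion_boundary T f u))"

definition critical_point :: "(real^2 \<Rightarrow> real) \<Rightarrow> real^2 \<Rightarrow> bool" where
  "critical_point f s \<longleftrightarrow> (\<forall>k. partial_deriv k f s = 0)"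

definition local_extremum_on :: "(real^2) set \<Rightarrow> (real^2 \<Rightarrow> real) \<Rightarrow> real^2 \<Rightarrow> bool" where
  "local_extremum_on F f p \<longleftrightarrow> p \<in> F \<and>
     ((\<forall>\<^sub>F s in at p within F. f s \<le> f p) \<or> (\<forall>\<^sub>F s in at p within F. f s \<ge> f p))"

definition smooth_random_field :: "'w measure \<Rightarrow> (real^2 \<Rightarrow> 'w \<Rightarrow> real) \<Rightarrow> bool" where
  "smooth_random_field M X \<longleftrightarrow> prob_space M \<and> (\<forall>s. X s \<in> borel_measurable M) \<and>
     (\<forall>\<omega>\<in>space M. C2_field (\<lambda>s. X s \<omega>))"

definition regular_at_level :: "real \<Rightarrow> (real^2 \<Rightarrow> real) \<Rightarrow> real \<Rightarrow> bool" where
  "regular_at_level t f u \<longleftrightarrow>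
     \<not> (\<exists>s\<in>square t. critical_point f s \<and> f s = u) \<and>
     (\<forall>F\<in>square_faces t. \<not> (\<exists>p. local_extremum_on F f p \<and> f p = u)) \<and>
     (\<forall>k. \<not> (\<exists>s\<in>square t. f s - u = 0 \<and> partial_deriv k f s = 0 \<and>
                partial_deriv k (partial_deriv k f) s = 0))"

definition almost_surely_regular :: "'w measure \<Rightarrow> (real^2 \<Rightarrow> 'w \<Rightarrow> real) \<Rightarrow> real \<Rightarrow> bool" where
  "almost_surely_regular M X t \<longleftrightarrow> (\<forall>u. AE \<omega> in M. regular_at_level t (\<lambda>s. X s \<omega>) u)"

definition in_L1 :: "'w measure \<Rightarrow> ('w \<Rightarrow> ennreal) \<Rightarrow> bool" where
  "in_L1 M Y \<longleftrightarrow> Y \<in> borel_measurable M \<and> (\<integral>\<^sup>+\<omega>. Y \<omega> \<partial>M) < \<infinity>"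

definition integrable_boundary :: "'w measure \<Rightarrow> (real^2 \<Rightarrow> 'w \<Rightarrow> real) \<Rightarrow> real \<Rightarrow> bool" where
  "integrable_boundary M X t \<longleftrightarrow>
     (\<forall>u. in_L1 M (\<lambda>\<omega>. perimeter (square t) (\<lambda>s. X s \<omega>) u) \<and>
          in_L1 M (\<lambda>\<omega>. num_boundary_components (square t) (\<lambda>s. X s \<omega>) u))"

definition grid_point :: "real \<Rightarrow> real \<Rightarrow> nat \<Rightarrow> nat \<Rightarrow> real^2" where
  "grid_point t \<epsilon> i j = vector [- t + real i * \<epsilon>, - t + real j * \<epsilon>]"

definition grid :: "real \<Rightarrow> real \<Rightarrow> (real^2) set" where
  "grid t \<epsilon> = {grid_point t \<epsilon> i j | i j. True} \<inter> square t"

definition grid_rows :: "real \<Rightarrow> real \<Rightarrow> nat" where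
  "grid_rows t \<epsilon> = card ((\<lambda>s. s $ 2) ` grid t \<epsilon>)"

definition block_indices :: "real \<Rightarrow> real \<Rightarrow> nat \<Rightarrow> nat set" where
  "block_indices t \<epsilon> m = {i \<in> {..<grid_rows t \<epsilon>}. m dvd i}"

definition pixel :: "real \<Rightarrow> real \<Rightarrow> (real^2 \<Rightarrow> real) \<Rightarrow> real \<Rightarrow> nat \<Rightarrow> nat \<Rightarrow> real" where
  "pixel t \<epsilon> f u i j = (if f (grid_point t \<epsilon> i j) \<ge> u then 1 else 0)"

text \<open>
  Half-open ranges: for integers, \<open>i \<le> min (a + m - 1) (M - 2)\<close> is \<open>i < min (a + m) (M - 1)\<close>;
  this form remains correct under truncated subtraction.
\<close>
definition N_h :: "real \<Rightarrow> real \<Rightarrow> nat \<Rightarrow> (real^2 \<Rightarrow> real) \<Rightarrow> real \<Rightarrow> nat \<Rightarrow> nat \<Rightarrow> real" where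
  "N_h t \<epsilon> m f u a b =
     (\<Sum>i\<in>{a..<min (a + m) (grid_rows t \<epsilon>)}. \<Sum>j\<in>{b..<min (b + m) (grid_rows t \<epsilon> - 1)}.
        \<bar>pixel t \<epsilon> f u i j - pixel t \<epsilon> f u i (j + 1)\<bar>)"

definition N_v :: "real \<Rightarrow> real \<Rightarrow> nat \<Rightarrow> (real^2 \<Rightarrow> real) \<Rightarrow> real \<Rightarrow> nat \<Rightarrow> nat \<Rightarrow> real" where
  "N_v t \<epsilon> m f u a b =
     (\<Sum>i\<in>{a..<min (a + m) (grid_rows t \<epsilon> - 1)}. \<Sum>j\<in>{b..<min (b + m) (grid_rows t \<epsilon>)}.
        \<bar>pixel t \<epsilon> f u i j - pixel t \<epsilon> f u (i + 1) j\<bar>)"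

text \<open>
  The norm on \<open>real \<times> real\<close> is the Euclidean one.
\<close>
definition perimeter_estimator :: "real \<Rightarrow> nat \<Rightarrow> real \<Rightarrow> (real^2 \<Rightarrow> real) \<Rightarrow> real \<Rightarrow> real" where
  "perimeter_estimator \<epsilon> m t f u =
     \<epsilon> * (\<Sum>a\<in>block_indices t \<epsilon> m. \<Sum>b\<in>block_indices t \<epsilon> m.
            norm (N_h t \<epsilon> m f u a b, N_v t \<epsilon> m f u a b))"

end

theory Submission
  imports Defs
begin

text \<open>
  Write \<open>Z\<close> for the boundary of the excursion set inside the square, \<open>\<delta> = m \<epsilon>\<close> for the side of a
  block of pixels. For a field that is regular at level \<open>u\<close> the gradient does not vanish on \<open>Z\<close>, so
  \<open>Z\<close> is the level set \<open>{f = u}\<close> (\<open>regular_excursion_boundary\<close>). The proof has a pathwise part and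
  a domination part, joined by dominated convergence.

  Pathwise. As \<open>\<delta> \<rightarrow> 0\<close> the gradient is nearly constant on every block, so in a block \<open>Z\<close> is the graph
  of a function of one coordinate (\<open>zero_set_is_graph\<close>) whose chords are almost parallel. If the
  block is away from the points of \<open>Z\<close> at which a partial derivative vanishes, the graph is strictly
  monotone (\<open>graph_strictly_monotone\<close>). A monotone arc crosses each grid line once, so
  \<open>\<epsilon> N\<^sub>h\<close> and \<open>\<epsilon> N\<^sub>v\<close> are its extents in the two directions up to a bounded multiple of \<open>\<epsilon>\<close>, and
  \<open>\<epsilon> \<parallel>(N\<^sub>h, N\<^sub>v)\<parallel>\<close> is its diameter up to \<open>O(\<epsilon>)\<close> (\<open>spread_le\<close>, \<open>long_inner_arc\<close>,
  \<open>block_dichotomy\<close>). An almost straight set is hardly longer than its diameter (\<open>block_length\<close>),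
  while a connected arc is at least as long as the distance between any two of its points
  (\<open>hausdorff1_delta_ge_radial\<close>). Summing over the blocks uses subadditivity of the
  Hausdorff measure for the upper bound, and superadditivity on separated sets for the lower one,
  applied to compact arcs in the open blocks.

  Only \<open>O(1/\<delta>)\<close> blocks meet \<open>Z\<close>, so the errors \<open>O(\<epsilon>)\<close> sum up to \<open>O(1/m)\<close>; this is why
  \<open>m \<rightarrow> \<infinity>\<close> is required. The points of \<open>Z\<close> at which a partial derivative vanishes
  are isolated because the second derivative in the same direction does not vanish there
  (\<open>tangencies_finite\<close>). So a bounded number of blocks is exceptional, each contributes \<open>O(\<delta>)\<close>, and
  their total tends to \<open>0\<close> with \<open>m \<epsilon>\<close>. This yields the explicit two-sided estimate
  \<open>estimator_bounds\<close>.

  Domination. Each flipped pixel edge contains a point of \<open>Z\<close>, so the estimator is at most \<open>2 \<epsilon>\<close>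
  times the number of lattice cells of side \<open>\<epsilon>\<close> that meet \<open>Z\<close>. A component of \<open>Z\<close> that leaves
  the ball of radius \<open>\<epsilon>\<close> around its point in a cell has length at least \<open>\<epsilon>\<close> in that ball, and a
  component that stays in it meets a bounded number of such cells; hence the number of cells is at most
  \<open>16 P / \<epsilon> + 9 #\<Gamma>\<close>, with \<open>P\<close> the length of \<open>Z\<close> and \<open>#\<Gamma>\<close> its number of components
  (\<open>count_cells_meeting\<close>). So the estimator is bounded by a fixed integrable combination of the
  two (\<open>estimator_dominated\<close>). The same count with cells of side \<open>\<delta>\<close> is the \<open>O(1/\<delta>)\<close> bound above.
\<close>

section \<open>One-dimensional Hausdorff measure: upper and lower bounds\<close>

lemma hausdorff1_delta_mono: "S \<subseteq> S' \<Longrightarrow> hausdorff1_delta \<delta> S \<le> hausdorff1_delta \<delta> S'"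
  unfolding hausdorff1_delta_def by (rule INF_superset_mono) auto

lemma hausdorff1_mono: "S \<subseteq> S' \<Longrightarrow> hausdorff1 S \<le> hausdorff1 S'"
  unfolding hausdorff1_def by (rule SUP_mono) (use hausdorff1_delta_mono in blast)

lemma hausdorff1_delta_le_hausdorff1: "\<delta> > 0 \<Longrightarrow> hausdorff1_delta \<delta> S \<le> hausdorff1 S"
  unfolding hausdorff1_def by (rule SUP_upper) auto

lemma hausdorff1_delta_le_cover:
  assumes "S \<subseteq> (\<Union>i. A i)" "\<And>i. bounded (A i)" "\<And>i. diameter (A i) \<le> \<delta>"
  shows "hausdorff1_delta \<delta> S \<le> (\<Sum>i. ennreal (diameter (A i)))"
  unfolding hausdorff1_delta_def by (rule INF_lower) (use assms in auto)

lemma hausdorff1_delta_approx_cover: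
  assumes "hausdorff1_delta \<delta> S < \<infinity>" and e: "e > 0"
  obtains A where "S \<subseteq> (\<Union>i. A i)" "\<And>i::nat. bounded (A i)" "\<And>i. diameter (A i) \<le> \<delta>"
    "(\<Sum>i. ennreal (diameter (A i))) < hausdorff1_delta \<delta> S + ennreal e"
proof -
  have "hausdorff1_delta \<delta> S < hausdorff1_delta \<delta> S + ennreal e"
    using assms by (simp add: ennreal_zero_less_divide less_top)
  then show thesis using that
    unfolding hausdorff1_delta_def by (subst (asm) INF_less_iff) blast
qed

text \<open>
  Interleaving a cover of each set gives a cover of the union.
\<close>
lemma hausdorff1_delta_Un:
  "hausdorff1_delta \<delta> (S \<union> S') \<le> hausdorff1_delta \<delta> S + hausdorff1_delta \<delta> S'"
proof (cases "hausdorff1_delta \<delta> S < \<infinity> \<and> hausdorff1_delta \<delta> S' < \<infinity>")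
  case True
  show ?thesis
  proof (rule ennreal_le_epsilon)
    fix e :: real assume e: "0 < e"
    obtain A where A: "S \<subseteq> (\<Union>i::nat. A i)" "\<And>i. bounded (A i)" "\<And>i. diameter (A i) \<le> \<delta>"
      "(\<Sum>i. ennreal (diameter (A i))) < hausdorff1_delta \<delta> S + ennreal (e/2)"
      using hausdorff1_delta_approx_cover[of \<delta> S "e/2"] True e by auto
    obtain B where B: "S' \<subseteq> (\<Union>i::nat. B i)" "\<And>i. bounded (B i)" "\<And>i. diameter (B i) \<le> \<delta>"
      "(\<Sum>i. ennreal (diameter (B i))) < hausdorff1_delta \<delta> S' + ennreal (e/2)"
      using hausdorff1_delta_approx_cover[of \<delta> S' "e/2"] True e by auto
    define C where "C i = (if even i then A (i div 2) else B (i div 2))" for i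
    have "S \<union> S' \<subseteq> (\<Union>i. C i)"
    proof
      fix x assume "x \<in> S \<union> S'"
      then obtain i where "x \<in> A i \<or> x \<in> B i" using A(1) B(1) by blast
      then have "x \<in> C (2*i) \<or> x \<in> C (2*i+1)" by (auto simp: C_def)
      then show "x \<in> (\<Union>i. C i)" by blast
    qed
    then have "hausdorff1_delta \<delta> (S \<union> S') \<le> (\<Sum>i. ennreal (diameter (C i)))"
      by (rule hausdorff1_delta_le_cover) (use A B in \<open>auto simp: C_def\<close>)
    also have "\<dots> = (\<Sum>i. ennreal (diameter (A i))) + (\<Sum>i. ennreal (diameter (B i)))"
    proof -
      have eq: "(\<Sum>i. \<Sum>k<2. ennreal (diameter (C (i * 2 + k)))) = (\<Sum>i. ennreal (diameter (C i)))"
      proof -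
        have "(\<lambda>n. \<Sum>i=n*2..<n*2+2. ennreal (diameter (C i))) sums (\<Sum>i. ennreal (diameter (C i)))"
          by (rule sums_group) (auto simp: summable_sums)
        moreover have "(\<Sum>i=n*2..<n*2+2. ennreal (diameter (C i))) = (\<Sum>k<2. ennreal (diameter (C (n * 2 + k))))" for n
          by (simp add: numeral_2_eq_2)
        ultimately show ?thesis using sums_unique by fastforce
      qed
      have "(\<Sum>k<2. ennreal (diameter (C (i * 2 + k)))) = ennreal (diameter (A i)) + ennreal (diameter (B i))" for i
      proof -
        have "{..<2::nat} = {0, 1}" by auto
        then show ?thesis by (simp add: C_def)
      qed
      with eq show ?thesis by (simp add: suminf_add)
    qed
    also have "\<dots> \<le> (hausdorff1_delta \<delta> S + ennreal (e/2)) + (hausdorff1_delta \<delta> S' + ennreal (e/2))"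
      using A(4) B(4) by (intro add_mono) auto
    also have "\<dots> = hausdorff1_delta \<delta> S + hausdorff1_delta \<delta> S' + ennreal e"
    proof -
      have "ennreal e = ennreal (e/2) + ennreal (e/2)" using e by (subst ennreal_plus[symmetric]) auto
      then show ?thesis by (simp add: algebra_simps)
    qed
    finally show "hausdorff1_delta \<delta> (S \<union> S') \<le> hausdorff1_delta \<delta> S + hausdorff1_delta \<delta> S' + ennreal e" .
  qed
next
  case False
  then have "hausdorff1_delta \<delta> S + hausdorff1_delta \<delta> S' = \<infinity>" by (auto simp: less_top[symmetric])
  then show ?thesis by (metis infinity_ennreal_def top_greatest)
qed

lemma hausdorff1_Un: "hausdorff1 (S \<union> S') \<le> hausdorff1 S + hausdorff1 S'"
  unfolding hausdorff1_def[of "S \<union> S'"]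
  by (rule SUP_least)
    (metis hausdorff1_delta_Un hausdorff1_delta_le_hausdorff1 add_mono greaterThan_iff order_trans)

text \<open>
  Cut the parameter interval into many equal pieces; the preimages of the pieces cover \<open>S\<close> and their
  diameters add up to at most \<open>L (\<beta> - \<alpha>)\<close>.
\<close>
lemma hausdorff1_lipschitz_arc:
  fixes h :: "'a::metric_space \<Rightarrow> real"
  assumes L: "L \<ge> 0" and ab: "\<alpha> \<le> \<beta>"
    and lip: "\<And>p q. p \<in> S \<Longrightarrow> q \<in> S \<Longrightarrow> dist p q \<le> L * \<bar>h p - h q\<bar>"
    and range: "\<And>p. p \<in> S \<Longrightarrow> h p \<in> {\<alpha>..\<beta>}"
  shows "hausdorff1 S \<le> ennreal (L * (\<beta> - \<alpha>))"
  unfolding hausdorff1_def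
proof (rule SUP_least)
  fix \<delta> :: real assume "\<delta> \<in> {0<..}"
  then have d: "\<delta> > 0" by simp
  define W where "W = L * (\<beta> - \<alpha>)"
  have W: "W \<ge> 0" using L ab by (simp add: W_def)
  obtain n where "W / \<delta> < real n" using reals_Archimedean2 by blast
  then have n: "W \<le> \<delta> * real n" "n > 0"
  proof -
    show "W \<le> \<delta> * real n" using \<open>W / \<delta> < real n\<close> d by (simp add: field_simps)
    have "0 \<le> W / \<delta>" using W d by simp
    then show "n > 0" using \<open>W / \<delta> < real n\<close> by (cases n) auto
  qed
  define w where "w = (\<beta> - \<alpha>) / real n"
  define A where "A i = (if i < n then {p \<in> S. \<alpha> + real i * w \<le> h p \<and> h p \<le> \<alpha> + real (Suc i) * w} else {})" for i
  have w: "w \<ge> 0" "L * w \<le> \<delta>" "real n * w = \<beta> - \<alpha>"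
    using ab n d by (auto simp: w_def field_simps W_def)
  have distA: "dist p q \<le> L * w" if "p \<in> A i" "q \<in> A i" for p q i
  proof -
    have "p \<in> S" "q \<in> S" "\<bar>h p - h q\<bar> \<le> w" using that w(1)
      by (auto simp: A_def algebra_simps split: if_splits)
    then show ?thesis using lip[of p q] L mult_left_mono order_trans by blast
  qed
  have bdd: "bounded (A i)" for i
  proof (cases "A i = {}")
    case False
    then obtain p where "p \<in> A i" by blast
    then show ?thesis unfolding bounded_def using distA by blast
  qed simp
  have diam: "diameter (A i) \<le> L * w" for i

  proof (cases "A i = {}")
    case False
    then show ?thesis using distA unfolding diameter_def by (auto intro!: cSUP_least)
  qed (use L w(1) in simp)
  have cover: "S \<subseteq> (\<Union>i. A i)"
  proof
    fix p assume p: "p \<in> S"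
    show "p \<in> (\<Union>i. A i)"
    proof (cases "h p = \<beta> \<or> w = 0")
      case True
      then have "p \<in> A (n - 1)" using p range[OF p] n w
        by (auto simp: A_def of_nat_diff algebra_simps)
      then show ?thesis by blast
    next
      case False
      then have wp: "w > 0" using w by simp
      define i where "i = nat \<lfloor>(h p - \<alpha>) / w\<rfloor>"
      have q: "0 \<le> (h p - \<alpha>) / w" using range[OF p] wp by simp
      then have "real i \<le> (h p - \<alpha>) / w" "(h p - \<alpha>) / w < real i + 1"
        unfolding i_def by linarith+
      then have i: "real i * w \<le> h p - \<alpha>" "h p - \<alpha> < (real i + 1) * w"
        using wp by (auto simp: field_simps)
      have "real i * w < real n * w" using i(1) w(3) False range[OF p] by auto
      then have "i < n" using wp by simp
      then have "p \<in> A i" using i p by (auto simp: A_def algebra_simps)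
      then show ?thesis by blast
    qed
  qed
  have "hausdorff1_delta \<delta> S \<le> (\<Sum>i. ennreal (diameter (A i)))"
    by (rule hausdorff1_delta_le_cover[OF cover bdd]) (use diam w in \<open>meson order_trans\<close>)
  also have "\<dots> = (\<Sum>i<n. ennreal (diameter (A i)))"
    by (rule suminf_finite) (auto simp: A_def)
  also have "\<dots> \<le> (\<Sum>i<n. ennreal (L * w))"
    by (rule sum_mono) (use diam ennreal_leI in blast)
  also have "\<dots> = ennreal (real n * (L * w))"
    using L w by (simp add: ennreal_of_nat_eq_real_of_nat ennreal_mult)
  also have "real n * (L * w) = L * (\<beta> - \<alpha>)" using w(3) by (metis mult.left_commute)
  finally show "hausdorff1_delta \<delta> S \<le> ennreal (L * (\<beta> - \<alpha>))" .
qed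

text \<open>
  The distance to \<open>p\<close> is 1-Lipschitz, so a cover of \<open>S\<close> induces a cover of \<open>[0, d)\<close> by intervals of
  lengths at most the diameters, and Lebesgue measure is countably subadditive.
\<close>
lemma hausdorff1_delta_ge_radial:
  fixes S :: "'a::metric_space set"
  assumes "{0..<d} \<subseteq> dist p ` S"
  shows "ennreal d \<le> hausdorff1_delta \<delta> S"
proof (cases "d > 0")
  case True
  show ?thesis
  unfolding hausdorff1_delta_def
  proof (rule INF_greatest)
    fix A :: "nat \<Rightarrow> 'a set"
    assume "A \<in> {A. S \<subseteq> (\<Union>i. A i) \<and> (\<forall>i. bounded (A i) \<and> diameter (A i) \<le> \<delta>)}"
    then have cov: "S \<subseteq> (\<Union>i. A i)" and bdd: "\<And>i. bounded (A i)" by auto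
    define J where "J i = (if A i = {} then {} else {Inf (dist p ` A i) .. Inf (dist p ` A i) + diameter (A i)})" for i
    have sub: "dist p ` A i \<subseteq> J i" for i
    proof
      fix v assume v: "v \<in> dist p ` A i"
      then obtain a where a: "a \<in> A i" "v = dist p a" by blast
      have bb: "bdd_below (dist p ` A i)" by (intro bdd_belowI[of _ 0]) auto
      have "v - diameter (A i) \<le> Inf (dist p ` A i)"
      proof (rule cInf_greatest)
        show "dist p ` A i \<noteq> {}" using a by auto
        fix w assume "w \<in> dist p ` A i"
        then obtain b where b: "b \<in> A i" "w = dist p b" by blast
        have "dist a b \<le> diameter (A i)" using diameter_bounded_bound bdd a b by blast
        then show "v - diameter (A i) \<le> w" using a b dist_triangle[of p a b]
          by (simp add: dist_commute)
      qed
      moreover have "Inf (dist p ` A i) \<le> v" using bb v by (rule cInf_lower[rotated])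
      ultimately show "v \<in> J i" using a by (auto simp: J_def)
    qed
    have "ennreal d = emeasure lborel {0..<d}" using True by simp
    also have "\<dots> \<le> emeasure lborel (\<Union>i. J i)"
    proof (rule emeasure_mono)
      show "{0..<d} \<subseteq> (\<Union>i. J i)"
      proof
        fix v assume "v \<in> {0..<d}"
        then obtain x where "x \<in> S" "v = dist p x" using assms by blast
        moreover then obtain i where "x \<in> A i" using cov by blast
        ultimately have "v \<in> J i" using sub[of i] by blast
        then show "v \<in> (\<Union>i. J i)" by blast
      qed
    qed (auto simp: J_def)
    also have "\<dots> \<le> (\<Sum>i. emeasure lborel (J i))"
      by (rule emeasure_subadditive_countably) (auto simp: J_def)
    also have "\<dots> \<le> (\<Sum>i. ennreal (diameter (A i)))"
      by (rule suminf_le) (auto simp: J_def diameter_ge_0 bdd)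
    finally show "ennreal d \<le> (\<Sum>i. ennreal (diameter (A i)))" .
  qed
qed (simp add: ennreal_neg)

text \<open>
  Distances to \<open>p\<close> take all intermediate values on a connected set. Together with
  \<open>hausdorff1_delta_ge_radial\<close> this bounds the length of a connected set from below near each of its
  points.
\<close>
lemma connected_radial_image:
  fixes C :: "'a::metric_space set"
  assumes "connected C" "p \<in> C" "q \<in> C" "d \<le> dist p q"
  shows "{0..<d} \<subseteq> dist p ` (C \<inter> ball p d)"
proof
  fix v assume v: "v \<in> {0..<d}"
  have "connected (dist p ` C)"
    using assms(1) by (intro connected_continuous_image continuous_intros)
  moreover have "0 \<in> dist p ` C" using assms(2) by force
  moreover have "dist p q \<in> dist p ` C" using assms(3) by blast
  ultimately have "v \<in> dist p ` C"
    by (rule connectedD_interval) (use v assms(4) in auto)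
  then show "v \<in> dist p ` (C \<inter> ball p d)" using v by auto
qed

text \<open>
  A covering set of diameter at most \<open>\<delta>\<close> meets at most one of the sets, so a cover of the union
  splits into disjoint covers of the parts. This replaces additivity on measurable sets.
\<close>
lemma hausdorff1_delta_separated:
  fixes S :: "'i \<Rightarrow> 'a::metric_space set"
  assumes "finite I"
    and sep: "\<And>i j x y. i \<in> I \<Longrightarrow> j \<in> I \<Longrightarrow> i \<noteq> j \<Longrightarrow> x \<in> S i \<Longrightarrow> y \<in> S j \<Longrightarrow> \<delta> < dist x y"
  shows "(\<Sum>i\<in>I. hausdorff1_delta \<delta> (S i)) \<le> hausdorff1_delta \<delta> (\<Union>i\<in>I. S i)"
  unfolding hausdorff1_delta_def[of \<delta> "\<Union>i\<in>I. S i"]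
proof (rule INF_greatest)
  fix A :: "nat \<Rightarrow> 'a set"
  assume "A \<in> {A. (\<Union>i\<in>I. S i) \<subseteq> (\<Union>k. A k) \<and> (\<forall>k. bounded (A k) \<and> diameter (A k) \<le> \<delta>)}"
  then have cov: "(\<Union>i\<in>I. S i) \<subseteq> (\<Union>k. A k)" and bdd: "\<And>k. bounded (A k)" and diam: "\<And>k. diameter (A k) \<le> \<delta>" by auto
  define B where "B i k = (if A k \<inter> S i = {} then {} else A k)" for i k
  have "(\<Sum>i\<in>I. hausdorff1_delta \<delta> (S i)) \<le> (\<Sum>i\<in>I. \<Sum>k. ennreal (diameter (B i k)))"
  proof (rule sum_mono)
    fix i assume i: "i \<in> I"
    have "0 \<le> \<delta>" using diam[of 0] diameter_ge_0[OF bdd[of 0]] by linarith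
    show "hausdorff1_delta \<delta> (S i) \<le> (\<Sum>k. ennreal (diameter (B i k)))"
    proof (rule hausdorff1_delta_le_cover)
      show "S i \<subseteq> (\<Union>k. B i k)"
      proof
        fix x assume x: "x \<in> S i"
        then obtain k where "x \<in> A k" using cov i by blast
        with x have "x \<in> B i k" by (auto simp: B_def)
        then show "x \<in> (\<Union>k. B i k)" by blast
      qed
    qed (use bdd diam \<open>0 \<le> \<delta>\<close> in \<open>auto simp: B_def\<close>)
  qed
  also have "\<dots> = (\<Sum>k. \<Sum>i\<in>I. ennreal (diameter (B i k)))"
    by (rule suminf_sum[symmetric]) auto
  also have "\<dots> \<le> (\<Sum>k. ennreal (diameter (A k)))"
  proof (rule suminf_le)
    fix k
    have uniq: "i = j" if ij: "i \<in> I" "j \<in> I" "A k \<inter> S i \<noteq> {}" "A k \<inter> S j \<noteq> {}" for i j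
    proof (rule ccontr)
      assume "i \<noteq> j"
      obtain x y where "x \<in> A k" "x \<in> S i" "y \<in> A k" "y \<in> S j" using ij by blast
      then have "\<delta> < dist x y" "dist x y \<le> diameter (A k)"
        using sep ij \<open>i \<noteq> j\<close> diameter_bounded_bound bdd by blast+
      then show False using diam[of k] by linarith
    qed
    show "(\<Sum>i\<in>I. ennreal (diameter (B i k))) \<le> ennreal (diameter (A k))"
    proof (cases "\<exists>i\<in>I. A k \<inter> S i \<noteq> {}")
      case True
      then obtain i where i: "i \<in> I" "A k \<inter> S i \<noteq> {}" by blast
      have "(\<Sum>j\<in>I. ennreal (diameter (B j k))) = (\<Sum>j\<in>{i}. ennreal (diameter (B j k)))"
        by (rule sum.mono_neutral_right) (use assms(1) i uniq in \<open>auto simp: B_def\<close>)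
      then show ?thesis by (simp add: B_def)
    next
      case False
      then show ?thesis by (simp add: B_def)
    qed
  qed auto
  finally show "(\<Sum>i\<in>I. hausdorff1_delta \<delta> (S i)) \<le> (\<Sum>k. ennreal (diameter (A k)))" .
qed

lemma hausdorff1_ge_separated:
  fixes S :: "'i \<Rightarrow> 'a::metric_space set"
  assumes fin: "finite I" and g: "g > 0"
    and sep: "\<And>i j x y. i \<in> I \<Longrightarrow> j \<in> I \<Longrightarrow> i \<noteq> j \<Longrightarrow> x \<in> S i \<Longrightarrow> y \<in> S j \<Longrightarrow> g \<le> dist x y"
    and sub: "\<And>i. i \<in> I \<Longrightarrow> S i \<subseteq> Z"
    and rad: "\<And>i. i \<in> I \<Longrightarrow> {0..<d i} \<subseteq> dist (p i) ` S i"
  shows "(\<Sum>i\<in>I. ennreal (d i)) \<le> hausdorff1 Z"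
proof -
  have "(\<Sum>i\<in>I. ennreal (d i)) \<le> (\<Sum>i\<in>I. hausdorff1_delta (g/2) (S i))"
    by (rule sum_mono) (use rad hausdorff1_delta_ge_radial in blast)
  also have "\<dots> \<le> hausdorff1_delta (g/2) (\<Union>i\<in>I. S i)"
    by (rule hausdorff1_delta_separated[OF fin]) (use sep g in force)
  also have "\<dots> \<le> hausdorff1_delta (g/2) Z" by (rule hausdorff1_delta_mono) (use sub in blast)
  also have "\<dots> \<le> hausdorff1 Z" using g by (intro hausdorff1_delta_le_hausdorff1) auto
  finally show ?thesis .
qed

lemma hausdorff1_UN:
  fixes S :: "'i \<Rightarrow> 'a::metric_space set"
  assumes "finite I"
  shows "hausdorff1 (\<Union>i\<in>I. S i) \<le> (\<Sum>i\<in>I. hausdorff1 (S i))"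
  using assms
proof (induction I)
  case empty
  have "hausdorff1 ({} :: 'a set) \<le> ennreal (0 * (0 - 0))"
    by (rule hausdorff1_lipschitz_arc) auto
  then show ?case by simp
next
  case (insert i I)
  have "hausdorff1 (\<Union>j\<in>insert i I. S j) \<le> hausdorff1 (S i) + hausdorff1 (\<Union>j\<in>I. S j)"
    using hausdorff1_Un[of "S i" "\<Union>j\<in>I. S j"] by simp
  also have "\<dots> \<le> hausdorff1 (S i) + (\<Sum>j\<in>I. hausdorff1 (S j))" using insert by (intro add_left_mono)
  finally show ?case using insert by simp
qed

lemma hausdorff1_le_spread:
  fixes h :: "'a::metric_space \<Rightarrow> real"
  assumes L: "L \<ge> 0" and D: "D \<ge> 0"
    and lip: "\<And>p q. p \<in> S \<Longrightarrow> q \<in> S \<Longrightarrow> dist p q \<le> L * \<bar>h p - h q\<bar>"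
    and ub: "\<And>p q. p \<in> S \<Longrightarrow> q \<in> S \<Longrightarrow> \<bar>h p - h q\<bar> \<le> D"
  shows "hausdorff1 S \<le> ennreal (L * D)"
proof -
  define \<alpha> where "\<alpha> = Inf (h ` S)"
  have "hausdorff1 S \<le> ennreal (L * ((\<alpha> + D) - \<alpha>))"
  proof (rule hausdorff1_lipschitz_arc[OF L _ lip])
    fix p assume p: "p \<in> S"
    have bb: "bdd_below (h ` S)"
    proof (rule bdd_belowI)
      fix y assume "y \<in> h ` S"
      then obtain q where "q \<in> S" "y = h q" by blast
      then show "h p - D \<le> y" using ub[OF p] by fastforce
    qed
    have "h p - D \<le> \<alpha>" unfolding \<alpha>_def
    proof (rule cInf_greatest)
      fix y assume "y \<in> h ` S"
      then obtain q where "q \<in> S" "y = h q" by blast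
      then show "h p - D \<le> y" using ub[OF p] by fastforce
    qed (use p in auto)
    moreover have "\<alpha> \<le> h p" unfolding \<alpha>_def using p bb by (intro cInf_lower) auto
    ultimately show "h p \<in> {\<alpha>..\<alpha> + D}" by simp
  qed (use D in auto)
  then show ?thesis by simp
qed

lemma compact_family_gap:
  fixes C :: "'i \<Rightarrow> 'a::heine_borel set"
  assumes fin: "finite I" and comp: "\<And>i. i \<in> I \<Longrightarrow> compact (C i)"
    and disj: "\<And>i j. i \<in> I \<Longrightarrow> j \<in> I \<Longrightarrow> i \<noteq> j \<Longrightarrow> C i \<inter> C j = {}"
  shows "\<exists>g>0. \<forall>i\<in>I. \<forall>j\<in>I. i \<noteq> j \<longrightarrow> (\<forall>x\<in>C i. \<forall>y\<in>C j. g \<le> dist x y)"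
proof -
  define T where "T = {(i, j) \<in> I \<times> I. i \<noteq> j}"
  have "\<exists>d>0. \<forall>x\<in>C i. \<forall>y\<in>C j. d \<le> dist x y" if "(i, j) \<in> T" for i j
    by (intro separate_compact_closed comp disj compact_imp_closed) (use that in \<open>auto simp: T_def\<close>)
  then have "\<forall>ij\<in>T. \<exists>d>0. \<forall>x\<in>C (fst ij). \<forall>y\<in>C (snd ij). d \<le> dist x y" by auto
  then obtain d where d: "\<And>ij. ij \<in> T \<Longrightarrow> d ij > 0 \<and> (\<forall>x\<in>C (fst ij). \<forall>y\<in>C (snd ij). d ij \<le> dist x y)"
    by metis
  have finT: "finite T" using fin by (auto simp: T_def intro: finite_subset[of _ "I \<times> I"])
  define g where "g = Min (insert 1 (d ` T))"
  have "g > 0" using finT d by (auto simp: g_def)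
  moreover have "g \<le> dist x y" if "i \<in> I" "j \<in> I" "i \<noteq> j" "x \<in> C i" "y \<in> C j" for i j x y
  proof -
    have ij: "(i, j) \<in> T" using that by (simp add: T_def)
    have "g \<le> d (i, j)" using finT ij by (auto simp: g_def intro: Min_le)
    also have "\<dots> \<le> dist x y" using d[OF ij] that by auto
    finally show ?thesis .
  qed
  ultimately show ?thesis by blast
qed

section \<open>Counting lattice cells that meet a set of finite length\<close>

lemma abs_diff_component_le_dist: "\<bar>x $ k - y $ k\<bar> \<le> dist x (y :: real^2)"
  by (metis component_le_norm_cart dist_norm vector_minus_component)

text \<open>
  Consider the point of \<open>Z\<close> given in a cell. If its component leaves the ball of radius \<open>s\<close> around it, it
  has length at least \<open>s\<close> in that ball. Distinct cells with equal coordinates modulo 4 have balls at distance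
  at least \<open>s\<close>, so each of the 16 residue classes has at most \<open>P / s\<close> such cells. Otherwise the whole
  component lies within distance \<open>s\<close>, and the cells charged to that component lie in a
  \<open>3 \<times> 3\<close> array.
\<close>
lemma count_cells_meeting:
  fixes Z :: "(real^2) set" and z :: "nat \<times> nat \<Rightarrow> real^2"
  assumes fin: "finite K" and s: "s > 0"
    and zZ: "\<And>k l. (k, l) \<in> K \<Longrightarrow> z (k, l) \<in> Z"
    and cell1: "\<And>k l. (k, l) \<in> K \<Longrightarrow> z (k, l) $ 1 \<in> {c + real k * s .. c + (real k + 1) * s}"
    and cell2: "\<And>k l. (k, l) \<in> K \<Longrightarrow> z (k, l) $ 2 \<in> {c + real l * s .. c + (real l + 1) * s}"
    and len: "hausdorff1 Z < \<infinity>" and comps: "finite (components Z)"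
  shows "real (card K) \<le> 16 * enn2real (hausdorff1 Z) / s + 9 * real (card (components Z))"
proof -
  define P where "P = enn2real (hausdorff1 Z)"
  have P: "hausdorff1 Z = ennreal P" "P \<ge> 0" using len by (auto simp: P_def less_top)
  define comp where "comp \<kappa> = connected_component_set Z (z \<kappa>)" for \<kappa>
  define Big where "Big = {\<kappa> \<in> K. \<exists>w \<in> comp \<kappa>. s \<le> dist (z \<kappa>) w}"
  define Small where "Small = K - Big"
  have finB: "finite Big" "finite Small" using fin by (auto simp: Big_def Small_def)
  \<comment> \<open>Two cells of one colour differ by at least 4 in some coordinate, so their chosen points are at
    distance at least \<open>3 s\<close>.\<close>
  define colour where "colour r = {\<kappa> \<in> Big. (fst \<kappa> mod 4, snd \<kappa> mod 4) = r}" for r :: "nat \<times> nat"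
  have self: "z \<kappa> \<in> comp \<kappa>" if "\<kappa> \<in> K" for \<kappa>
    using zZ[of "fst \<kappa>" "snd \<kappa>"] that by (simp add: comp_def)
  have far: "3 * s \<le> \<bar>a - b\<bar>" if "k mod 4 = k' mod 4" "k \<noteq> k'"
    "a \<in> {c + real k * s .. c + (real k + 1) * s}" "b \<in> {c + real k' * s .. c + (real k' + 1) * s}"
    for k k' :: nat and a b
  proof -
    have aux: "3 * s \<le> \<bar>a - b\<bar>" if "k + 4 \<le> k'"
      "a \<in> {c + real k * s .. c + (real k + 1) * s}" "b \<in> {c + real k' * s .. c + (real k' + 1) * s}"
      for k k' :: nat and a b
    proof -
      have "(real k + 4) * s \<le> real k' * s" using that(1) s by (intro mult_right_mono) auto
      then show ?thesis using that s by (auto simp: algebra_simps)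
    qed
    have "k + 4 \<le> k' \<or> k' + 4 \<le> k"
    proof -
      have "4 dvd (k' - k)" "4 dvd (k - k')"
        using that(1) by (metis dvd_0_right diff_is_0_eq mod_eq_dvd_iff_nat nat_le_linear)+
      then show ?thesis using that(2) by (auto dest!: dvd_imp_le)
    qed
    then show ?thesis
      using aux[OF _ that(3) that(4)] aux[OF _ that(4) that(3)] abs_minus_commute[of a b] by metis
  qed
  have colour_bound: "real (card (colour r)) \<le> P / s" for r
  proof -
    have "(\<Sum>\<kappa>\<in>colour r. ennreal s) \<le> hausdorff1 Z"
    proof (rule hausdorff1_ge_separated[where g = s and p = z and S = "\<lambda>\<kappa>. comp \<kappa> \<inter> ball (z \<kappa>) s"])
      show "finite (colour r)" using finB by (simp add: colour_def)
      fix \<kappa> assume \<kappa>: "\<kappa> \<in> colour r"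
      then have \<kappa>K: "\<kappa> \<in> K" by (simp add: colour_def Big_def)
      show "comp \<kappa> \<inter> ball (z \<kappa>) s \<subseteq> Z"
        using connected_component_subset by (auto simp: comp_def)
      obtain w where "w \<in> comp \<kappa>" "s \<le> dist (z \<kappa>) w" using \<kappa> by (auto simp: colour_def Big_def)
      then show "{0..<s} \<subseteq> dist (z \<kappa>) ` (comp \<kappa> \<inter> ball (z \<kappa>) s)"
        by (intro connected_radial_image self \<kappa>K) (auto simp: comp_def)
    next
      fix \<kappa> \<kappa>' x y
      assume *: "\<kappa> \<in> colour r" "\<kappa>' \<in> colour r" "\<kappa> \<noteq> \<kappa>'" "x \<in> comp \<kappa> \<inter> ball (z \<kappa>) s" "y \<in> comp \<kappa>' \<inter> ball (z \<kappa>') s"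
      obtain k l k' l' where kl: "\<kappa> = (k, l)" "\<kappa>' = (k', l')" by (meson surj_pair)
      have mem: "(k, l) \<in> K" "(k', l') \<in> K" "k mod 4 = k' mod 4" "l mod 4 = l' mod 4" "k \<noteq> k' \<or> l \<noteq> l'"
        using * by (auto simp: kl colour_def Big_def)
      have "3 * s \<le> \<bar>z (k,l) $ 1 - z (k',l') $ 1\<bar> \<or> 3 * s \<le> \<bar>z (k,l) $ 2 - z (k',l') $ 2\<bar>"
        using mem far[OF mem(3) _ cell1[OF mem(1)] cell1[OF mem(2)]]
          far[OF mem(4) _ cell2[OF mem(1)] cell2[OF mem(2)]] by blast
      then have "3 * s \<le> dist (z \<kappa>) (z \<kappa>')"
        unfolding kl using abs_diff_component_le_dist[of "z (k,l)" _ "z (k',l')"] order_trans by blast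
      moreover have "dist (z \<kappa>) (z \<kappa>') \<le> dist (z \<kappa>) x + dist x y + dist (z \<kappa>') y"
        by (smt (verit) dist_commute dist_triangle)
      moreover have "dist (z \<kappa>) x < s" "dist (z \<kappa>') y < s" using * by auto
      ultimately show "s \<le> dist x y" by linarith
    qed (use s in auto)
    then have "real (card (colour r)) * s \<le> P"
      using P s by (simp add: ennreal_of_nat_eq_real_of_nat ennreal_mult[symmetric])
    then show ?thesis using s by (simp add: field_simps)
  qed
  have "Big = (\<Union>r\<in>{..<4} \<times> {..<4}. colour r)" by (auto simp: colour_def)
  then have "card Big \<le> (\<Sum>r\<in>{..<4::nat} \<times> {..<4::nat}. card (colour r))"
    by (simp add: card_UN_le)
  then have "real (card Big) \<le> (\<Sum>r\<in>{..<4::nat} \<times> {..<4::nat}. real (card (colour r)))"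
    by (metis of_nat_mono of_nat_sum)
  also have "\<dots> \<le> (\<Sum>r\<in>{..<4::nat} \<times> {..<4::nat}. P / s)" by (rule sum_mono) (rule colour_bound)
  finally have big: "real (card Big) \<le> 16 * P / s" by simp
  have small: "card {\<kappa> \<in> Small. z \<kappa> \<in> C} \<le> 9" if C: "C \<in> components Z" for C
  proof (cases "{\<kappa> \<in> Small. z \<kappa> \<in> C} = {}")
    case False
    then obtain k0 l0 where 0: "(k0, l0) \<in> Small" "z (k0, l0) \<in> C" by auto
    then have K0: "(k0, l0) \<in> K" by (simp add: Small_def)
    have near: "k \<in> {k0 - 1..k0 + 1}" if "a \<in> {c + real k * s .. c + (real k + 1) * s}"
      "b \<in> {c + real k0 * s .. c + (real k0 + 1) * s}" "\<bar>b - a\<bar> < s" for k k0 :: nat and a b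
    proof -
      have "real k * s < (real k0 + 2) * s" "real k0 * s < (real k + 2) * s"
        using that by (auto simp: algebra_simps)
      then have "real k < real k0 + 2" "real k0 < real k + 2" using s by (auto simp: mult_less_cancel_right)
      then show ?thesis by auto
    qed
    have "{\<kappa> \<in> Small. z \<kappa> \<in> C} \<subseteq> {k0 - 1..k0 + 1} \<times> {l0 - 1..l0 + 1}"
    proof safe
      fix k l assume kl: "(k, l) \<in> Small" "z (k, l) \<in> C"
      have KK: "(k, l) \<in> K" using kl by (simp add: Small_def)
      have "comp (k0, l0) = C" using C 0 unfolding comp_def
        by (metis components_iff connected_component_eq)
      then have d: "dist (z (k0, l0)) (z (k, l)) < s"
        using 0 kl K0 by (auto simp: Small_def Big_def)
      have d1: "\<bar>z (k0, l0) $ 1 - z (k, l) $ 1\<bar> < s" "\<bar>z (k0, l0) $ 2 - z (k, l) $ 2\<bar> < s"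
        using d abs_diff_component_le_dist[of "z (k0, l0)" _ "z (k, l)"] order_le_less_trans by blast+
      show "k \<in> {k0 - 1..k0 + 1}" by (rule near[OF cell1[OF KK] cell1[OF K0] d1(1)])
      show "l \<in> {l0 - 1..l0 + 1}" by (rule near[OF cell2[OF KK] cell2[OF K0] d1(2)])
    qed
    then have "card {\<kappa> \<in> Small. z \<kappa> \<in> C} \<le> card ({k0 - 1..k0 + 1} \<times> {l0 - 1..l0 + 1})"
      by (intro card_mono) auto
    also have "\<dots> \<le> 3 * 3" unfolding card_cartesian_product by (intro mult_mono) auto
    finally show ?thesis by simp
  next
    case True
    then show ?thesis unfolding True by simp
  qed
  have split: "Small = (\<Union>C\<in>components Z. {\<kappa> \<in> Small. z \<kappa> \<in> C})"

  proof (intro equalityI subsetI)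
    fix \<kappa> assume \<kappa>: "\<kappa> \<in> Small"
    then have "z \<kappa> \<in> Z" using zZ[of "fst \<kappa>" "snd \<kappa>"] by (simp add: Small_def)
    then obtain C where "C \<in> components Z" "z \<kappa> \<in> C" using Union_components[of Z] by blast
    with \<kappa> show "\<kappa> \<in> (\<Union>C\<in>components Z. {\<kappa> \<in> Small. z \<kappa> \<in> C})" by blast
  qed blast
  have "card Small \<le> (\<Sum>C\<in>components Z. card {\<kappa> \<in> Small. z \<kappa> \<in> C})"
    by (rule ord_eq_le_trans[OF arg_cong[where f = card, OF split] card_UN_le[OF comps]])
  also have "\<dots> \<le> (\<Sum>C\<in>components Z. 9)" by (rule sum_mono) (rule small)
  finally have small': "card Small \<le> 9 * card (components Z)" by simp
  have "card K = card Big + card Small"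

  proof -
    have "K = Big \<union> Small" "Big \<inter> Small = {}" by (auto simp: Big_def Small_def)
    then show ?thesis using card_Un_disjoint[OF finB] by metis
  qed
  then show ?thesis using big small' by (simp add: P_def)
qed

section \<open>A zero set with a steep partial derivative is a monotone graph\<close>

lemma mvt_segment:
  fixes \<phi> :: "real \<Rightarrow> real"
  assumes "\<And>x. (\<phi> has_real_derivative \<phi>' x) (at x)"
  shows "\<exists>\<xi>\<in>closed_segment a b. \<phi> b - \<phi> a = \<phi>' \<xi> * (b - a)"
proof (cases a b rule: linorder_cases)
  case less
  obtain \<xi> where "a < \<xi>" "\<xi> < b" "\<phi> b - \<phi> a = (b - a) * \<phi>' \<xi>"
    using MVT2[OF less, of \<phi> \<phi>'] assms by blast
  then show ?thesis using less by (intro bexI[of _ \<xi>]) (auto simp: closed_segment_eq_real_ivl)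
next
  case greater
  obtain \<xi> where "b < \<xi>" "\<xi> < a" "\<phi> a - \<phi> b = (a - b) * \<phi>' \<xi>"
    using MVT2[OF greater, of \<phi> \<phi>'] assms by blast
  then show ?thesis using greater
    by (intro bexI[of _ \<xi>]) (auto simp: closed_segment_eq_real_ivl algebra_simps)
qed auto

text \<open>
  The graph over a block of side \<open>d\<close> stays in this enlargement of its vertical range.
\<close>
abbreviation thick :: "real \<Rightarrow> real \<Rightarrow> real \<Rightarrow> real set" where
  "thick l h d \<equiv> {l - 3*d..h + 3*d}"

text \<open>
  Increments are taken along axis-parallel paths, which reduces all estimates to one-dimensional mean
  value theorems for the partial derivatives.
\<close>
locale planar_C1 =
  fixes g gx gy :: "real \<Rightarrow> real \<Rightarrow> real"
  assumes deriv_x: "\<And>x y. ((\<lambda>x. g x y) has_real_derivative gx x y) (at x)"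
    and deriv_y: "\<And>x y. ((\<lambda>y. g x y) has_real_derivative gy x y) (at y)"
begin

lemma increment:
  "\<exists>\<xi>\<in>closed_segment x x'. \<exists>\<zeta>\<in>closed_segment y y'.
     g x' y' - g x y = gx \<xi> y * (x' - x) + gy x' \<zeta> * (y' - y)"
proof -
  obtain \<xi> where "\<xi>\<in>closed_segment x x'" "g x' y - g x y = gx \<xi> y * (x' - x)"
    using mvt_segment[of "\<lambda>x. g x y" "\<lambda>x. gx x y"] deriv_x by blast
  moreover obtain \<zeta> where "\<zeta>\<in>closed_segment y y'" "g x' y' - g x' y = gy x' \<zeta> * (y' - y)"
    using mvt_segment[of "\<lambda>y. g x' y" "\<lambda>y. gy x' y"] deriv_y by blast
  ultimately show ?thesis by (intro bexI[of _ \<xi>] bexI[of _ \<zeta>]) auto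
qed

text \<open>
  Starting from the zero \<open>(px, py)\<close>, the slope bound 2 keeps the zero set within height \<open>2 \<delta>\<close> of
  \<open>py\<close> over the whole base, which is why the hypotheses are made on a box that is taller by \<open>3 \<delta>\<close>:
  the graph cannot leave it, although it may leave the block itself.
\<close>
lemma zero_set_is_graph:
  assumes ord: "X0 \<le> X1" "Y0 \<le> Y1" "X1 - X0 \<le> \<delta>" "\<delta> > 0"
    and pos: "\<And>x y. x \<in> {X0..X1} \<Longrightarrow> y \<in> thick Y0 Y1 \<delta> \<Longrightarrow> gy x y > 0"
    and ratio: "\<And>x y x' y'. x \<in> {X0..X1} \<Longrightarrow> x' \<in> {X0..X1} \<Longrightarrow>
       y \<in> thick Y0 Y1 \<delta> \<Longrightarrow> y' \<in> thick Y0 Y1 \<delta> \<Longrightarrow> \<bar>gx x y\<bar> \<le> 2 * gy x' y'"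
    and zero: "px \<in> {X0..X1}" "py \<in> {Y0..Y1}" "g px py = 0"
  obtains \<phi> where "\<And>x. x \<in> {X0..X1} \<Longrightarrow> \<phi> x \<in> {Y0 - 2*\<delta>..Y1 + 2*\<delta>}"
    "\<And>x y. x \<in> {X0..X1} \<Longrightarrow> y \<in> thick Y0 Y1 \<delta> \<Longrightarrow> \<phi> x < y \<Longrightarrow> g x y > 0"
    "\<And>x y. x \<in> {X0..X1} \<Longrightarrow> y \<in> thick Y0 Y1 \<delta> \<Longrightarrow> y < \<phi> x \<Longrightarrow> g x y < 0"
    "\<And>x. x \<in> {X0..X1} \<Longrightarrow> g x (\<phi> x) = 0"
    "\<And>x x'. x \<in> {X0..X1} \<Longrightarrow> x' \<in> {X0..X1} \<Longrightarrow> \<bar>\<phi> x - \<phi> x'\<bar> \<le> 2 * \<bar>x - x'\<bar>"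
proof -
  let ?J = "thick Y0 Y1 \<delta>"
  have seg: "closed_segment a b \<subseteq> {u..v}" if "a \<in> {u..v}" "b \<in> {u..v}" for a b u v :: real
    using that by (auto simp: closed_segment_eq_real_ivl)
  have mono: "g x y < g x y'" if "x \<in> {X0..X1}" "y \<in> ?J" "y' \<in> ?J" "y < y'" for x y y'
  proof (rule DERIV_pos_imp_increasing[OF that(4)])
    fix z assume "y \<le> z" "z \<le> y'"
    then show "\<exists>v. ((\<lambda>y. g x y) has_real_derivative v) (at z) \<and> 0 < v"
      using that deriv_y pos[of x z] by fastforce
  qed
  have ex: "\<exists>y\<in>{Y0 - 2*\<delta>..Y1 + 2*\<delta>}. g x y = 0" if x: "x \<in> {X0..X1}" for x
  proof -
    have dx: "\<bar>x - px\<bar> \<le> \<delta>" using x zero ord by auto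
    have step: "\<exists>r v. \<bar>r\<bar> \<le> 2 * v * \<delta> \<and> g x (py + e) = r + v * e" if e: "\<bar>e\<bar> = 2 * \<delta>" for e
    proof -
      obtain \<xi> \<zeta> where *: "\<xi>\<in>closed_segment px x" "\<zeta>\<in>closed_segment py (py + e)"
        "g x (py + e) - g px py = gx \<xi> py * (x - px) + gy x \<zeta> * (py + e - py)"
        using increment by blast
      have "py \<in> ?J" "py + e \<in> ?J" using zero ord e by auto
      then have "\<xi> \<in> {X0..X1}" "\<zeta> \<in> ?J" "py \<in> ?J" using * seg x zero by blast+
      then have "\<bar>gx \<xi> py\<bar> \<le> 2 * gy x \<zeta>" using ratio x by blast
      then have "\<bar>gx \<xi> py * (x - px)\<bar> \<le> 2 * gy x \<zeta> * \<delta>"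
        unfolding abs_mult using dx by (intro mult_mono) auto
      then show ?thesis using * zero by auto
    qed
    have up: "0 \<le> g x (py + 2 * \<delta>)" and down: "g x (py - 2 * \<delta>) \<le> 0"
      using step[of "2 * \<delta>"] step[of "- (2 * \<delta>)"] ord(4) by (auto simp: algebra_simps)
    have "continuous_on {py - 2*\<delta>..py + 2*\<delta>} (g x)"
      using deriv_y DERIV_isCont by (intro continuous_at_imp_continuous_on) blast
    then obtain y where "py - 2*\<delta> \<le> y" "y \<le> py + 2*\<delta>" "g x y = 0"
      using IVT'[of "g x" "py - 2*\<delta>" 0 "py + 2*\<delta>"] up down ord by auto
    then show ?thesis using zero by (intro bexI[of _ y]) auto
  qed
  define \<phi> where "\<phi> x = (SOME y. y\<in>{Y0 - 2*\<delta>..Y1 + 2*\<delta>} \<and> g x y = 0)" for x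
  have \<phi>: "\<phi> x \<in> {Y0 - 2*\<delta>..Y1 + 2*\<delta>}" "g x (\<phi> x) = 0" if "x \<in> {X0..X1}" for x
    using someI_ex[OF ex[OF that, unfolded Bex_def]] unfolding \<phi>_def by blast+
  have \<phi>J: "\<phi> x \<in> ?J" if "x \<in> {X0..X1}" for x using \<phi>(1)[OF that] ord by auto
  show thesis
  proof (rule that)
    show "\<bar>\<phi> x - \<phi> x'\<bar> \<le> 2 * \<bar>x - x'\<bar>" if x: "x \<in> {X0..X1}" "x' \<in> {X0..X1}" for x x'
    proof -
      obtain \<xi> \<zeta> where *: "\<xi>\<in>closed_segment x x'" "\<zeta>\<in>closed_segment (\<phi> x) (\<phi> x')"
        "g x' (\<phi> x') - g x (\<phi> x) = gx \<xi> (\<phi> x) * (x' - x) + gy x' \<zeta> * (\<phi> x' - \<phi> x)"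
        using increment by blast
      have \<zeta>: "\<xi> \<in> {X0..X1}" "\<zeta> \<in> ?J"
        using * seg[of x X0 X1 x'] seg[of "\<phi> x" "Y0 - 3*\<delta>" "Y1 + 3*\<delta>" "\<phi> x'"] x \<phi>J by blast+
      have gp: "gy x' \<zeta> > 0" using pos x \<zeta> by blast
      have "gy x' \<zeta> * \<bar>\<phi> x - \<phi> x'\<bar> = \<bar>gy x' \<zeta> * (\<phi> x' - \<phi> x)\<bar>"
        using gp by (simp add: abs_mult abs_minus_commute)
      also have "\<dots> = \<bar>gx \<xi> (\<phi> x) * (x' - x)\<bar>" using * \<phi> x by simp
      also have "\<dots> \<le> 2 * gy x' \<zeta> * \<bar>x' - x\<bar>"
        unfolding abs_mult using ratio[OF \<zeta>(1) x(2) \<phi>J[OF x(1)] \<zeta>(2)] by (intro mult_right_mono) auto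
      finally show ?thesis using gp by (simp add: abs_minus_commute mult.left_commute)
    qed
  next
    fix x y assume "x \<in> {X0..X1}" "y \<in> ?J" "\<phi> x < y"
    then show "g x y > 0" using mono[of x "\<phi> x" y] \<phi>(2)[of x] \<phi>J[of x] by simp
  next
    fix x y assume "x \<in> {X0..X1}" "y \<in> ?J" "y < \<phi> x"
    then show "g x y < 0" using mono[of x y "\<phi> x"] \<phi>(2)[of x] \<phi>J[of x] by simp
  qed (use \<phi> in auto)
qed

end

text \<open>
  If \<open>\<phi>\<close> were not injective, it would have an interior local extremum at some \<open>c\<close>. Since the sign
  of \<open>g\<close> records on which side of the graph a point lies, \<open>g (\<cdot>, \<phi> c)\<close> would then have a local
  extremum at \<open>c\<close>, and its derivative would vanish there.
\<close>
lemma graph_strictly_monotone: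
  fixes \<phi> :: "real \<Rightarrow> real"
  assumes cont: "continuous_on {X0..X1} \<phi>"
    and deriv_x: "\<And>x y. ((\<lambda>x. g x y) has_real_derivative gx x y) (at x)"
    and above: "\<And>x y. x \<in> {X0..X1} \<Longrightarrow> y \<in> \<phi> ` {X0..X1} \<Longrightarrow> \<phi> x < y \<Longrightarrow> g x y > 0"
    and below: "\<And>x y. x \<in> {X0..X1} \<Longrightarrow> y \<in> \<phi> ` {X0..X1} \<Longrightarrow> y < \<phi> x \<Longrightarrow> g x y < 0"
    and on: "\<And>x. x \<in> {X0..X1} \<Longrightarrow> g x (\<phi> x) = 0"
    and tang: "\<And>x. x \<in> {X0..X1} \<Longrightarrow> gx x (\<phi> x) \<noteq> 0"
  shows "strict_mono_on {X0..X1} \<phi> \<or> strict_antimono_on {X0..X1} \<phi>"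
proof -
  have "inj_on \<phi> {X0..X1}"
  proof (rule linorder_inj_onI)
    fix a b assume ab: "a < b" "a \<in> {X0..X1}" "b \<in> {X0..X1}"
    show "\<phi> a \<noteq> \<phi> b"
    proof
      assume eq: "\<phi> a = \<phi> b"
      have sub: "{a..b} \<subseteq> {X0..X1}" using ab by auto
      have cab: "continuous_on {a..b} \<phi>" using cont sub continuous_on_subset by blast
      obtain M where M: "M \<in> {a..b}" "\<And>x. x \<in> {a..b} \<Longrightarrow> \<phi> x \<le> \<phi> M"
        using continuous_attains_sup[OF _ _ cab] ab by auto
      obtain N where N: "N \<in> {a..b}" "\<And>x. x \<in> {a..b} \<Longrightarrow> \<phi> N \<le> \<phi> x"
        using continuous_attains_inf[OF _ _ cab] ab by auto
      have flat: False if c: "c \<in> {a<..<b}" and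
        ext: "(\<forall>x\<in>{a..b}. \<phi> x \<le> \<phi> c) \<or> (\<forall>x\<in>{a..b}. \<phi> c \<le> \<phi> x)" for c
      proof -
        define d where "d = min (c - a) (b - c)"
        have d: "d > 0" using c by (auto simp: d_def)
        have near: "x \<in> {a..b}" if "\<bar>c - x\<bar> < d" for x using that by (auto simp: d_def)
        have cX: "c \<in> {X0..X1}" using c sub by auto
        have side: "(\<phi> x \<le> \<phi> c \<longrightarrow> 0 \<le> g x (\<phi> c)) \<and> (\<phi> c \<le> \<phi> x \<longrightarrow> g x (\<phi> c) \<le> 0)"
          if "x \<in> {a..b}" for x
        proof -
          have x: "x \<in> {X0..X1}" using that sub by blast
          show ?thesis using above[OF x, of "\<phi> c"] below[OF x, of "\<phi> c"] on[OF x] cX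
            by (cases "\<phi> x" "\<phi> c" rule: linorder_cases) force+
        qed
        have "gx c (\<phi> c) = 0"
          using ext
        proof
          assume *: "\<forall>x\<in>{a..b}. \<phi> x \<le> \<phi> c"
          have "g c (\<phi> c) \<le> g x (\<phi> c)" if "\<bar>c - x\<bar> < d" for x
            using side[OF near[OF that]] * near[OF that] on[OF cX] by simp
          then show ?thesis using DERIV_local_min[OF deriv_x d] by blast
        next
          assume *: "\<forall>x\<in>{a..b}. \<phi> c \<le> \<phi> x"
          have "g x (\<phi> c) \<le> g c (\<phi> c)" if "\<bar>c - x\<bar> < d" for x
            using side[OF near[OF that]] * near[OF that] on[OF cX] by simp
          then show ?thesis using DERIV_local_max[OF deriv_x d] by blast
        qed
        then show False using tang cX by blast
      qed
      have Mab: "M = a \<or> M = b" using flat[of M] M by (metis atLeastAtMost_iff greaterThanLessThan_iff order_le_less)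
      have Nab: "N = a \<or> N = b" using flat[of N] N by (metis atLeastAtMost_iff greaterThanLessThan_iff order_le_less)
      define c where "c = (a + b) / 2"
      have c: "c \<in> {a<..<b}" using ab by (auto simp: c_def)
      have "\<forall>x\<in>{a..b}. \<phi> x \<le> \<phi> c"
      proof
        fix x assume "x \<in> {a..b}"
        then have "\<phi> x \<le> \<phi> M" using M by blast
        also have "\<phi> M = \<phi> N" using Mab Nab eq by auto
        also have "\<phi> N \<le> \<phi> c" using N c by auto
        finally show "\<phi> x \<le> \<phi> c" .
      qed
      then show False using flat c by blast
    qed
  qed auto
  then show ?thesis using injective_eq_monotone_map[of "{X0..X1}" \<phi>] cont by (simp add: is_interval_cc)
qed

section \<open>Pixel flips along a graph\<close>

lemma card_lattice_le:
  fixes K :: "nat set" and \<epsilon> :: real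
  assumes e: "\<epsilon> > 0" and LR: "L \<le> R" and K: "\<And>k. k \<in> K \<Longrightarrow> org + real k * \<epsilon> \<in> {L..R}"
  shows "finite K" "real (card K) \<le> (R - L) / \<epsilon> + 1"
proof -
  have bound: "real k \<le> real l + (R - L) / \<epsilon>" if "k \<in> K" "l \<in> K" for k l
  proof -
    have "real k * \<epsilon> \<le> real l * \<epsilon> + (R - L)" using K[OF that(1)] K[OF that(2)] by auto
    then show ?thesis using e by (simp add: field_simps)
  qed
  show fin: "finite K"
  proof (cases "K = {}")
    case False
    then obtain l where l: "l \<in> K" by blast
    have "K \<subseteq> {..nat \<lceil>real l + (R - L) / \<epsilon>\<rceil>}"
    proof
      fix k assume "k \<in> K"
      with bound[OF this l] show "k \<in> {..nat \<lceil>real l + (R - L) / \<epsilon>\<rceil>}" by simp linarith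
    qed
    then show ?thesis using finite_subset by blast
  qed simp
  show "real (card K) \<le> (R - L) / \<epsilon> + 1"
  proof (cases "K = {}")
    case False
    have "card K \<le> card {Min K..Max K}" using fin by (intro card_mono) auto
    then have "card K \<le> Max K + 1 - Min K" by simp
    moreover have "Min K \<le> Max K" using fin False by simp
    ultimately have "real (card K) \<le> real (Max K) - real (Min K) + 1" by linarith
    then show ?thesis using bound[of "Max K" "Min K"] fin False by simp
  next
    case True
    then show ?thesis using e LR by simp
  qed
qed

lemma card_lattice_ge:
  fixes K :: "nat set" and \<epsilon> :: real
  assumes e: "\<epsilon> > 0" and L: "org \<le> L" and fin: "finite K"
    and K: "\<And>k. org + real k * \<epsilon> \<in> {L<..<R} \<Longrightarrow> k \<in> K"
  shows "(R - L) / \<epsilon> - 1 \<le> real (card K)"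
proof -
  define p q where "p = nat (\<lfloor>(L - org) / \<epsilon>\<rfloor> + 1)" and "q = nat \<lceil>(R - org) / \<epsilon>\<rceil>"
  have Lp: "0 \<le> (L - org) / \<epsilon>" using e L by simp
  have "{p..<q} \<subseteq> K"
  proof
    fix k assume "k \<in> {p..<q}"
    then have "(L - org) / \<epsilon> < real k" "real k < (R - org) / \<epsilon>" unfolding p_def q_def using Lp by auto linarith+
    then have "L - org < real k * \<epsilon>" "real k * \<epsilon> < R - org" using e by (auto simp: field_simps)
    then show "k \<in> K" by (intro K) auto
  qed
  then have "card {p..<q} \<le> card K" using fin card_mono by blast
  then have "real q - real p \<le> real (card K)" by simp
  moreover have "real p \<le> (L - org) / \<epsilon> + 1" using Lp unfolding p_def by linarith
  moreover have "(R - org) / \<epsilon> \<le> real q" unfolding q_def by linarith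
  moreover have "(R - L) / \<epsilon> = (R - org) / \<epsilon> - (L - org) / \<epsilon>" by (simp add: diff_divide_distrib)
  ultimately show ?thesis by linarith
qed

abbreviation flip :: "bool \<Rightarrow> bool \<Rightarrow> real" where
  "flip p q \<equiv> \<bar>of_bool p - of_bool q\<bar>"

lemma sum_flip_monotone:
  assumes "b \<le> (b'::nat)"
    and "(\<forall>j\<in>{b..<b'}. Q j \<longrightarrow> Q (j + 1)) \<or> (\<forall>j\<in>{b..<b'}. Q (j + 1) \<longrightarrow> Q j)"
  shows "(\<Sum>j\<in>{b..<b'}. flip (Q j) (Q (j + 1))) = flip (Q b) (Q b')"
  using assms(2)
proof
  assume up: "\<forall>j\<in>{b..<b'}. Q j \<longrightarrow> Q (j + 1)"
  have "(\<Sum>j\<in>{b..<b'}. flip (Q j) (Q (j + 1))) = (\<Sum>j\<in>{b..<b'}. of_bool (Q (Suc j)) - of_bool (Q j))"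
    using up by (intro sum.cong) auto
  also have "\<dots> = of_bool (Q b') - of_bool (Q b)" by (rule sum_Suc_diff') fact
  moreover have "0 \<le> (\<Sum>j\<in>{b..<b'}. flip (Q j) (Q (j + 1)))" by (intro sum_nonneg) auto
  ultimately show ?thesis by auto
next
  assume down: "\<forall>j\<in>{b..<b'}. Q (j + 1) \<longrightarrow> Q j"
  have "(\<Sum>j\<in>{b..<b'}. flip (Q j) (Q (j + 1))) = (\<Sum>j\<in>{b..<b'}. of_bool (\<not> Q (Suc j)) - of_bool (\<not> Q j))"
    using down by (intro sum.cong) auto
  also have "\<dots> = of_bool (\<not> Q b') - of_bool (\<not> Q b)" by (rule sum_Suc_diff') fact
  moreover have "0 \<le> (\<Sum>j\<in>{b..<b'}. flip (Q j) (Q (j + 1)))" by (intro sum_nonneg) auto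
  ultimately show ?thesis by auto
qed

lemma card_le_1I:
  assumes "\<And>i j. i \<in> A \<Longrightarrow> j \<in> A \<Longrightarrow> i = j"
  shows "card A \<le> 1"
proof (cases "A = {}")
  case False
  then obtain i where "A = {i}" using assms by blast
  then show ?thesis by simp
qed simp

definition hflips :: "(nat \<Rightarrow> nat \<Rightarrow> bool) \<Rightarrow> nat set \<Rightarrow> nat set \<Rightarrow> real" where
  "hflips P I J = (\<Sum>i\<in>I. \<Sum>j\<in>J. flip (P i j) (P i (j + 1)))"

definition vflips :: "(nat \<Rightarrow> nat \<Rightarrow> bool) \<Rightarrow> nat set \<Rightarrow> nat set \<Rightarrow> real" where
  "vflips P I J = (\<Sum>i\<in>I. \<Sum>j\<in>J. flip (P i j) (P (i + 1) j))"

lemma hflips_nonneg: "hflips P I J \<ge> 0" and vflips_nonneg: "vflips P I J \<ge> 0"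
  unfolding hflips_def vflips_def by (intro sum_nonneg; simp)+

lemma hflips_transpose: "hflips (\<lambda>j i. P i j) J I = vflips P I J"
  and vflips_transpose: "vflips (\<lambda>j i. P i j) J I = hflips P I J"
  unfolding hflips_def vflips_def by (rule sum.swap)+

lemma flips_le_card: "hflips P I J \<le> real (card I * card J)" "vflips P I J \<le> real (card I * card J)"
proof -
  have "(\<Sum>i\<in>I. \<Sum>j\<in>J. F i j) \<le> real (card I * card J)" if "\<And>i j. F i j \<le> 1" for F :: "nat \<Rightarrow> nat \<Rightarrow> real"
  proof -
    have "(\<Sum>i\<in>I. \<Sum>j\<in>J. F i j) \<le> (\<Sum>i\<in>I. \<Sum>j\<in>J. 1)" by (intro sum_mono that)
    then show ?thesis by simp
  qed
  then show "hflips P I J \<le> real (card I * card J)" "vflips P I J \<le> real (card I * card J)"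
    unfolding hflips_def vflips_def by simp_all
qed

text \<open>
  A block of pixels with indices from \<open>a\<close> to \<open>a'\<close> and from \<open>b\<close> to \<open>b'\<close>, and the pixel values \<open>P\<close> given by
  the side of the graph of \<open>\<phi>\<close>. The value of \<open>P\<close> on the graph is left open, which makes the setting
  symmetric under negation of the function. The bounds \<open>a''\<close> and \<open>b''\<close> describe the half-open ranges
  of the sums: they are \<open>a'\<close> and \<open>b'\<close> in general, but \<open>a' + 1\<close> and \<open>b' + 1\<close> for the last block, which
  also owns the last column or row.
\<close>
locale graph_over_block =
  fixes X Y :: "nat \<Rightarrow> real" and x0 y0 \<epsilon> :: real and a a' a'' b b' b'' :: nat
    and \<phi> :: "real \<Rightarrow> real" and P :: "nat \<Rightarrow> nat \<Rightarrow> bool"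
  assumes eps: "\<epsilon> > 0"
    and X: "\<And>i. X i = x0 + real i * \<epsilon>" and Y: "\<And>j. Y j = y0 + real j * \<epsilon>"
    and a: "a \<le> a'" "a' \<le> a''" "a'' \<le> a' + 1" and b: "b \<le> b'" "b' \<le> b''" "b'' \<le> b' + 1"
    and above: "\<And>i j. i \<in> {a..a'} \<Longrightarrow> j \<in> {b..b'} \<Longrightarrow> \<phi> (X i) < Y j \<Longrightarrow> P i j"
    and below: "\<And>i j. i \<in> {a..a'} \<Longrightarrow> j \<in> {b..b'} \<Longrightarrow> Y j < \<phi> (X i) \<Longrightarrow> \<not> P i j"
begin

abbreviation "Nh \<equiv> hflips P {a..<a''} {b..<b'}"
abbreviation "Nv \<equiv> vflips P {a..<a'} {b..<b''}"

lemma X_less_iff [simp]: "X i < X j \<longleftrightarrow> i < j" and Y_less_iff [simp]: "Y i < Y j \<longleftrightarrow> i < j"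
  and X_le_iff [simp]: "X i \<le> X j \<longleftrightarrow> i \<le> j" and Y_le_iff [simp]: "Y i \<le> Y j \<longleftrightarrow> i \<le> j"
  and X_eq_iff [simp]: "X i = X j \<longleftrightarrow> i = j" and Y_eq_iff [simp]: "Y i = Y j \<longleftrightarrow> i = j"
  using eps by (auto simp: X Y)

text \<open>
  The pixels of a column are off below the graph and on above it.
\<close>
lemma column_sum:
  assumes "i \<in> {a..<a''}"
  shows "(\<Sum>j\<in>{b..<b'}. flip (P i j) (P i (j + 1))) = flip (P i b) (P i b')"
proof (rule sum_flip_monotone[OF b(1)], intro disjI1 ballI impI)
  fix j assume j: "j \<in> {b..<b'}" "P i j"
  have "i \<in> {a..a'}" using assms a by auto
  moreover have "\<phi> (X i) \<le> Y j" using below[of i j] j calculation by fastforce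
  moreover have "Y j < Y (j + 1)" by simp
  ultimately have "\<phi> (X i) < Y (j + 1)" by linarith
  then show "P i (j + 1)" using above[OF \<open>i \<in> {a..a'}\<close>, of "j + 1"] j(1) by simp
qed

lemma Nh_eq: "Nh = (\<Sum>i\<in>{a..<a''}. flip (P i b) (P i b'))"
  unfolding hflips_def using column_sum by (intro sum.cong) auto

lemma Nh_le: "Nh \<le> real (a'' - a)"
proof -
  have "Nh \<le> (\<Sum>i\<in>{a..<a''}. 1)" unfolding Nh_eq by (intro sum_mono) auto
  then show ?thesis by simp
qed

text \<open>
  A step of one column moves the graph by at most \<open>2 \<epsilon>\<close>, hence over at most three rows. This
  crude bound serves for the exceptional blocks, where the graph may turn.
\<close>
lemma Nv_le:
  assumes lip: "\<And>x x'. x \<in> {X a..X a'} \<Longrightarrow> x' \<in> {X a..X a'} \<Longrightarrow> \<bar>\<phi> x - \<phi> x'\<bar> \<le> 2 * \<bar>x - x'\<bar>"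
  shows "Nv \<le> 3 * real (a' - a)"
proof -
  have "(\<Sum>j\<in>{b..<b''}. flip (P i j) (P (i + 1) j)) \<le> 3" if i: "i \<in> {a..<a'}" for i
  proof -
    define F where "F = {j \<in> {b..<b''}. P i j \<noteq> P (i + 1) j}"
    have "(\<Sum>j\<in>{b..<b''}. flip (P i j) (P (i + 1) j)) = (\<Sum>j\<in>F. 1)"
      unfolding F_def by (intro sum.mono_neutral_cong_right) auto
    also have "\<dots> = real (card F)" by simp
    also have "\<dots> \<le> (max (\<phi> (X i)) (\<phi> (X (i + 1))) - min (\<phi> (X i)) (\<phi> (X (i + 1)))) / \<epsilon> + 1"
    proof (rule card_lattice_le(2)[where org = y0])
      fix j assume j: "j \<in> F"
      then have "\<not> (\<phi> (X i) < Y j \<and> \<phi> (X (i + 1)) < Y j)" "\<not> (Y j < \<phi> (X i) \<and> Y j < \<phi> (X (i + 1)))"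
        using i b above[of i j] above[of "i + 1" j] below[of i j] below[of "i + 1" j]
        by (auto simp: F_def)
      then show "y0 + real j * \<epsilon> \<in> {min (\<phi> (X i)) (\<phi> (X (i + 1)))..max (\<phi> (X i)) (\<phi> (X (i + 1)))}"
        unfolding Y[symmetric] by auto
    qed (use eps in auto)
    also have "\<dots> \<le> 3"
    proof -
      have "\<bar>\<phi> (X i) - \<phi> (X (i + 1))\<bar> \<le> 2 * \<bar>X i - X (i + 1)\<bar>"
        by (rule lip) (use i in auto)
      also have "\<dots> = 2 * \<epsilon>" using eps by (simp add: X algebra_simps)
      finally have "max (\<phi> (X i)) (\<phi> (X (i + 1))) - min (\<phi> (X i)) (\<phi> (X (i + 1))) \<le> 2 * \<epsilon>" by auto
      then show ?thesis using eps by (simp add: field_simps)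
    qed
    finally show ?thesis .
  qed
  then have "Nv \<le> (\<Sum>i\<in>{a..<a'}. 3)" unfolding vflips_def by (intro sum_mono) auto
  then show ?thesis by simp
qed

end

locale monotone_graph_over_block = graph_over_block +
  assumes mono: "strict_mono_on {X a..X a'} \<phi> \<or> strict_antimono_on {X a..X a'} \<phi>"
    and cont: "continuous_on {X a..X a'} \<phi>"
begin

lemma between_strict:
  assumes "x \<in> {X a..X a'}" "z \<in> {X a..X a'}" "x < y" "y < z"
  shows "min (\<phi> x) (\<phi> z) < \<phi> y \<and> \<phi> y < max (\<phi> x) (\<phi> z)"
proof -
  have y: "y \<in> {X a..X a'}" using assms by auto
  show ?thesis
    using mono
  proof
    assume m: "strict_mono_on {X a..X a'} \<phi>"
    have "\<phi> x < \<phi> y" "\<phi> y < \<phi> z"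
      using monotone_onD[OF m assms(1) y assms(3)] monotone_onD[OF m y assms(2,4)] .
    then show ?thesis by auto
  next
    assume m: "strict_antimono_on {X a..X a'} \<phi>"
    have "\<phi> x > \<phi> y" "\<phi> y > \<phi> z"
      using monotone_onD[OF m assms(1) y assms(3)] monotone_onD[OF m y assms(2,4)] .
    then show ?thesis by auto
  qed
qed

lemma between:
  assumes "x \<in> {X a..X a'}" "z \<in> {X a..X a'}" "x \<le> y" "y \<le> z"
  shows "min (\<phi> x) (\<phi> z) \<le> \<phi> y \<and> \<phi> y \<le> max (\<phi> x) (\<phi> z)"
  using between_strict[OF assms(1,2), of y] assms by (cases "x = y"; cases "y = z") auto

lemma inj: "inj_on \<phi> {X a..X a'}"
proof (rule linorder_inj_onI)
  fix x y assume *: "x < y" "x \<in> {X a..X a'}" "y \<in> {X a..X a'}"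
  show "\<phi> x \<noteq> \<phi> y"
    using mono
  proof
    assume m: "strict_mono_on {X a..X a'} \<phi>"
    show ?thesis using monotone_onD[OF m *(2,3,1)] by simp
  next
    assume m: "strict_antimono_on {X a..X a'} \<phi>"
    show ?thesis using monotone_onD[OF m *(2,3,1)] by simp
  qed
qed auto

text \<open>
  As \<open>\<phi>\<close> is monotone, the graph passes from one side of a row to the other at most once, and the
  pixels of the row switch only there.
\<close>
lemma row_sum:
  assumes "j \<in> {b..<b''}"
  shows "(\<Sum>i\<in>{a..<a'}. flip (P i j) (P (i + 1) j)) = flip (P a j) (P a' j)"
proof (rule sum_flip_monotone[OF a(1)])
  have j: "j \<in> {b..b'}" using assms b by auto
  have mem: "X i \<in> {X a..X a'}" "X (i + 1) \<in> {X a..X a'}" "i \<in> {a..a'}" "i + 1 \<in> {a..a'}" "X i < X (i + 1)"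
    if "i \<in> {a..<a'}" for i using that by auto
  show "(\<forall>i\<in>{a..<a'}. P i j \<longrightarrow> P (i + 1) j) \<or> (\<forall>i\<in>{a..<a'}. P (i + 1) j \<longrightarrow> P i j)"
    using mono
  proof
    assume m: "strict_mono_on {X a..X a'} \<phi>"
    have "P i j" if "i \<in> {a..<a'}" "P (i + 1) j" for i
    proof -
      have "\<phi> (X i) < \<phi> (X (i + 1))"
        by (rule monotone_onD[OF m mem(1,2,5)]) (use that in auto)
      moreover have "\<phi> (X (i + 1)) \<le> Y j" using below[OF mem(4)[OF that(1)] j] that(2) by force
      ultimately show ?thesis using above[OF mem(3)[OF that(1)] j] by simp
    qed
    then show ?thesis by blast
  next
    assume m: "strict_antimono_on {X a..X a'} \<phi>"
    have "P (i + 1) j" if "i \<in> {a..<a'}" "P i j" for i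
    proof -
      have "\<phi> (X (i + 1)) < \<phi> (X i)"
        by (rule monotone_onD[OF m mem(1,2,5)]) (use that in auto)
      moreover have "\<phi> (X i) \<le> Y j" using below[OF mem(3)[OF that(1)] j] that(2) by force
      ultimately show ?thesis using above[OF mem(4)[OF that(1)] j] by simp
    qed
    then show ?thesis by blast
  qed
qed

lemma Nv_eq: "Nv = (\<Sum>j\<in>{b..<b''}. flip (P a j) (P a' j))"
  unfolding vflips_def by (subst sum.swap) (use row_sum in \<open>auto intro: sum.cong\<close>)

text \<open>
  Each column strictly between \<open>x1\<close> and \<open>x2\<close> is crossed by the graph strictly inside the block, hence
  contributes a flip; likewise each row strictly between the two heights. An open interval of length
  \<open>L\<close> contains at least \<open>L / \<epsilon> - 1\<close> lattice points.
\<close>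
lemma spread_le:
  assumes x: "x1 \<in> {X a..X a'}" "x2 \<in> {X a..X a'}" and y: "\<phi> x1 \<in> {Y b..Y b'}" "\<phi> x2 \<in> {Y b..Y b'}"
  shows "\<bar>x1 - x2\<bar> \<le> \<epsilon> * (Nh + 1)" "\<bar>\<phi> x1 - \<phi> x2\<bar> \<le> \<epsilon> * (Nv + 1)"
proof -
  note Nh0 = hflips_nonneg[of P "{a..<a''}" "{b..<b'}"] and Nv0 = vflips_nonneg[of P "{a..<a'}" "{b..<b''}"]
  have *: "x2 - x1 \<le> \<epsilon> * (Nh + 1) \<and> \<bar>\<phi> x1 - \<phi> x2\<bar> \<le> \<epsilon> * (Nv + 1)"
    if x: "x1 \<in> {X a..X a'}" "x2 \<in> {X a..X a'}" and y: "\<phi> x1 \<in> {Y b..Y b'}" "\<phi> x2 \<in> {Y b..Y b'}" and lt: "x1 < x2" for x1 x2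
  proof
    define S where "S = {i \<in> {a..<a''}. X i \<in> {x1<..<x2}}"
    have "(x2 - x1) / \<epsilon> - 1 \<le> real (card S)"
    proof (rule card_lattice_ge[OF eps, of x0])
      show "x0 \<le> x1" using x eps by (auto simp: X intro: order_trans[rotated])
      fix k assume k: "x0 + real k * \<epsilon> \<in> {x1<..<x2}"
      then have "X a < X k" "X k < X a'" using x unfolding X[symmetric] atLeastAtMost_iff greaterThanLessThan_iff by linarith+
      then have "k \<in> {a..<a''}" using a by simp
      then show "k \<in> S" using k by (simp add: S_def X)
    qed (simp add: S_def)
    also have "\<dots> = (\<Sum>i\<in>S. flip (P i b) (P i b'))"
    proof -
      have "flip (P i b) (P i b') = 1" if i: "i \<in> S" for i
      proof -
        have i': "x1 < X i" "X i < x2" "i \<in> {a..a'}" using i a by (auto simp: S_def)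
        have "Y b < \<phi> (X i)" "\<phi> (X i) < Y b'" using between_strict[OF x i'(1,2)] y by auto
        then show ?thesis using above[OF i'(3), of b'] below[OF i'(3), of b] b by simp
      qed
      then show ?thesis by simp
    qed
    also have "\<dots> \<le> Nh" unfolding Nh_eq by (intro sum_mono2) (auto simp: S_def)
    finally show "x2 - x1 \<le> \<epsilon> * (Nh + 1)" using eps by (simp add: field_simps)
  next
    define lo hi where "lo = min (\<phi> x1) (\<phi> x2)" and "hi = max (\<phi> x1) (\<phi> x2)"
    define S where "S = {j \<in> {b..<b''}. Y j \<in> {lo<..<hi}}"
    have "(hi - lo) / \<epsilon> - 1 \<le> real (card S)"
    proof (rule card_lattice_ge[OF eps, of y0])
      show "y0 \<le> lo" using y eps by (auto simp: Y lo_def intro: order_trans[rotated])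
      fix k assume k: "y0 + real k * \<epsilon> \<in> {lo<..<hi}"
      then have "Y b < Y k" "Y k < Y b'" using y
        unfolding Y[symmetric] atLeastAtMost_iff greaterThanLessThan_iff lo_def hi_def by linarith+
      then have "k \<in> {b..<b''}" using b by simp
      then show "k \<in> S" using k by (simp add: S_def Y)
    qed (simp add: S_def)
    also have "\<dots> = (\<Sum>j\<in>S. flip (P a j) (P a' j))"
    proof -
      have "flip (P a j) (P a' j) = 1" if j: "j \<in> S" for j
      proof -
        have j': "lo < Y j" "Y j < hi" "j \<in> {b..b'}" using j b by (auto simp: S_def)
        have ends: "X a \<in> {X a..X a'}" "X a' \<in> {X a..X a'}" using a by auto
        have "(\<phi> (X a) < Y j \<and> Y j < \<phi> (X a')) \<or> (\<phi> (X a') < Y j \<and> Y j < \<phi> (X a))"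
          using mono
        proof
          assume m: "strict_mono_on {X a..X a'} \<phi>"
          have inc: "\<phi> u < \<phi> v" if "u \<in> {X a..X a'}" "v \<in> {X a..X a'}" "u < v" for u v
            using monotone_onD[OF m that] .
          have "\<phi> (X a) \<le> \<phi> x1" using inc[OF ends(1) x(1)] x by (cases "x1 = X a") auto
          moreover have "\<phi> x2 \<le> \<phi> (X a')" using inc[OF x(2) ends(2)] x by (cases "x2 = X a'") auto
          moreover have "\<phi> x1 < \<phi> x2" using inc x lt by blast
          ultimately show ?thesis using j' by (auto simp: lo_def hi_def)
        next
          assume m: "strict_antimono_on {X a..X a'} \<phi>"
          have anti: "\<phi> v < \<phi> u" if "u \<in> {X a..X a'}" "v \<in> {X a..X a'}" "u < v" for u v
            using monotone_onD[OF m that] .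
          have "\<phi> x1 \<le> \<phi> (X a)" using anti[OF ends(1) x(1)] x by (cases "x1 = X a") auto
          moreover have "\<phi> (X a') \<le> \<phi> x2" using anti[OF x(2) ends(2)] x by (cases "x2 = X a'") auto
          moreover have "\<phi> x2 < \<phi> x1" using anti x lt by blast
          ultimately show ?thesis using j' by (auto simp: lo_def hi_def)
        qed
        then show ?thesis using above[OF _ j'(3), of a] above[OF _ j'(3), of a'] below[OF _ j'(3), of a]
            below[OF _ j'(3), of a'] a by auto
      qed
      then show ?thesis by simp
    qed
    also have "\<dots> \<le> Nv" unfolding Nv_eq by (intro sum_mono2) (auto simp: S_def)
    finally have "hi - lo \<le> \<epsilon> * (Nv + 1)" using eps by (simp add: field_simps)
    then show "\<bar>\<phi> x1 - \<phi> x2\<bar> \<le> \<epsilon> * (Nv + 1)" by (auto simp: lo_def hi_def)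
  qed
  have pos: "0 \<le> \<epsilon> * (Nh + 1)" "0 \<le> \<epsilon> * (Nv + 1)" using eps Nh0 Nv0 by auto
  have "\<bar>x1 - x2\<bar> \<le> \<epsilon> * (Nh + 1) \<and> \<bar>\<phi> x1 - \<phi> x2\<bar> \<le> \<epsilon> * (Nv + 1)"
  proof (cases x1 x2 rule: linorder_cases)
    case less
    then show ?thesis using *[OF x y less] by simp
  next
    case equal
    then show ?thesis using pos by simp
  next
    case greater
    then show ?thesis using *[OF x(2,1) y(2,1) greater]
      by (simp add: abs_minus_commute[of "\<phi> x1"])
  qed
  then show "\<bar>x1 - x2\<bar> \<le> \<epsilon> * (Nh + 1)" "\<bar>\<phi> x1 - \<phi> x2\<bar> \<le> \<epsilon> * (Nv + 1)" by auto
qed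

text \<open>
  Conversely, each flip comes from a crossing of a column or row in the closed block. By
  strict monotonicity only four columns and four rows can cross on the boundary of the block; the
  remaining crossings lie on the open arc, and the arc spanned by the outermost ones is long enough
  in both directions at once.
\<close>
lemma long_inner_arc:
  "(Nh \<le> 4 \<and> Nv \<le> 4) \<or>
   (\<exists>\<alpha> \<beta>. \<alpha> \<le> \<beta> \<and> {\<alpha>..\<beta>} \<subseteq> {X a<..<X a'} \<and> \<phi> ` {\<alpha>..\<beta>} \<subseteq> {Y b<..<Y b'} \<and>
      \<epsilon> * (Nh - 5) \<le> \<beta> - \<alpha> \<and> \<epsilon> * (Nv - 5) \<le> \<bar>\<phi> \<beta> - \<phi> \<alpha>\<bar>)"
proof -
  define G where "G = {i \<in> {a<..<a'}. \<phi> (X i) \<in> {Y b<..<Y b'}}"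
  define H where "H = {j \<in> {b<..<b'}. \<exists>x\<in>{X a<..<X a'}. \<phi> x = Y j}"
  have finG: "finite G" and finH: "finite H" by (auto simp: G_def H_def)
  have ends: "X a \<in> {X a..X a'}" "X a' \<in> {X a..X a'}" using a by auto
  have G: "Nh \<le> real (card G) + 4"
  proof -
    define F where "F = {i \<in> {a..<a''}. P i b \<noteq> P i b'}"
    define A1 A2 where "A1 = {i \<in> {a..a'}. \<phi> (X i) = Y b}" and "A2 = {i \<in> {a..a'}. \<phi> (X i) = Y b'}"
    have inj': "i = j" if "i \<in> {a..a'}" "j \<in> {a..a'}" "\<phi> (X i) = \<phi> (X j)" for i j
      using inj_onD[OF inj that(3)] that by simp
    have c: "card A1 \<le> 1" "card A2 \<le> 1"
      by (rule card_le_1I; use inj' in \<open>auto simp: A1_def A2_def\<close>)+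
    have cf: "finite A1" "finite A2" by (auto simp: A1_def A2_def)
    have "Nh = (\<Sum>i\<in>F. 1)"
      unfolding Nh_eq F_def by (intro sum.mono_neutral_cong_right) auto
    then have "Nh = real (card F)" by simp
    moreover have "card F \<le> card (G \<union> {a} \<union> {a'} \<union> A1 \<union> A2)"
    proof (rule card_mono)
      show "F \<subseteq> G \<union> {a} \<union> {a'} \<union> A1 \<union> A2"
      proof
        fix i assume i: "i \<in> F"
        then have ia: "i \<in> {a..a'}" using a by (auto simp: F_def)
        have "\<not> (\<phi> (X i) < Y b)"
        proof
          assume *: "\<phi> (X i) < Y b"
          also have "Y b \<le> Y b'" using b by simp
          finally show False using above[OF ia, of b] above[OF ia, of b'] * i b by (auto simp: F_def)
        qed
        moreover have "\<not> (Y b' < \<phi> (X i))"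
        proof
          assume *: "Y b' < \<phi> (X i)"
          have "Y b \<le> Y b'" using b by simp
          also note *
          finally show False using below[OF ia, of b] below[OF ia, of b'] * i b by (auto simp: F_def)
        qed
        ultimately show "i \<in> G \<union> {a} \<union> {a'} \<union> A1 \<union> A2" using ia by (auto simp: G_def A1_def A2_def)
      qed
    qed (use finG cf in auto)
    moreover have "card (G \<union> {a} \<union> {a'} \<union> A1 \<union> A2) \<le> card G + 1 + 1 + 1 + 1"
      using c by (intro order_trans[OF card_Un_le] add_mono) auto
    ultimately show ?thesis by linarith
  qed
  have H: "Nv \<le> real (card H) + 4"
  proof -
    define F where "F = {j \<in> {b..<b''}. P a j \<noteq> P a' j}"
    define A1 A2 where "A1 = {j \<in> {b..b'}. Y j = \<phi> (X a)}" and "A2 = {j \<in> {b..b'}. Y j = \<phi> (X a')}"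
    have c: "card A1 \<le> 1" "card A2 \<le> 1"
      by (rule card_le_1I; use Y_eq_iff in \<open>simp add: A1_def A2_def; metis\<close>)+
    have cf: "finite A1" "finite A2" by (auto simp: A1_def A2_def)
    have "Nv = (\<Sum>j\<in>F. 1)"
      unfolding Nv_eq F_def by (intro sum.mono_neutral_cong_right) auto
    then have "Nv = real (card F)" by simp
    moreover have "card F \<le> card (H \<union> {b} \<union> {b'} \<union> A1 \<union> A2)"
    proof (rule card_mono)
      show "F \<subseteq> H \<union> {b} \<union> {b'} \<union> A1 \<union> A2"
      proof
        fix j assume j: "j \<in> F"
        then have jb: "j \<in> {b..b'}" using b by (auto simp: F_def)
        have "\<not> (\<phi> (X a) < Y j \<and> \<phi> (X a') < Y j)" "\<not> (Y j < \<phi> (X a) \<and> Y j < \<phi> (X a'))"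
          using above[OF _ jb] below[OF _ jb] j a by (auto simp: F_def)
        then have "(\<phi> (X a) \<le> Y j \<and> Y j \<le> \<phi> (X a')) \<or> (\<phi> (X a') \<le> Y j \<and> Y j \<le> \<phi> (X a))" by linarith
        then obtain x where x: "X a \<le> x" "x \<le> X a'" "\<phi> x = Y j"
          using IVT'[of \<phi> "X a" "Y j" "X a'"] IVT2'[of \<phi> "X a'" "Y j" "X a"] cont a by auto
        then show "j \<in> H \<union> {b} \<union> {b'} \<union> A1 \<union> A2"
          using jb by (cases "x = X a"; cases "x = X a'") (auto simp: H_def A1_def A2_def)
      qed
    qed (use finH cf in auto)
    moreover have "card (H \<union> {b} \<union> {b'} \<union> A1 \<union> A2) \<le> card H + 1 + 1 + 1 + 1"
      using c by (intro order_trans[OF card_Un_le] add_mono) auto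
    ultimately show ?thesis by linarith
  qed
  define \<psi> where "\<psi> j = (SOME x. x \<in> {X a<..<X a'} \<and> \<phi> x = Y j)" for j
  have \<psi>: "\<psi> j \<in> {X a<..<X a'}" "\<phi> (\<psi> j) = Y j" if j: "j \<in> H" for j
  proof -
    have "\<exists>x. x \<in> {X a<..<X a'} \<and> \<phi> x = Y j" using j by (auto simp: H_def)
    from someI_ex[OF this] show "\<psi> j \<in> {X a<..<X a'}" "\<phi> (\<psi> j) = Y j" unfolding \<psi>_def by blast+
  qed
  define S where "S = X ` G \<union> \<psi> ` H"
  have finS: "finite S" using finG finH by (simp add: S_def)
  have SX: "x \<in> {X a<..<X a'}" and SY: "\<phi> x \<in> {Y b<..<Y b'}" if "x \<in> S" for x
  proof -
    have "x \<in> {X a<..<X a'} \<and> \<phi> x \<in> {Y b<..<Y b'}"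
      using that unfolding S_def
    proof
      assume "x \<in> \<psi> ` H"
      then obtain j where j: "j \<in> H" "x = \<psi> j" by blast
      then have "j \<in> {b<..<b'}" by (simp add: H_def)
      then show ?thesis using \<psi>[OF j(1)] j(2) by simp
    qed (auto simp: G_def)
    then show "x \<in> {X a<..<X a'}" "\<phi> x \<in> {Y b<..<Y b'}" by auto
  qed
  show ?thesis
  proof (cases "S = {}")
    case True
    then have "card G = 0" "card H = 0" by (auto simp: S_def)
    then show ?thesis using G H by simp
  next
    case False
    define \<alpha> \<beta> where "\<alpha> = Min S" and "\<beta> = Max S"
    have mem: "\<alpha> \<in> S" "\<beta> \<in> S" using False finS by (auto simp: \<alpha>_def \<beta>_def)
    have rng: "\<alpha> \<le> x" "x \<le> \<beta>" if "x \<in> S" for x using that finS by (auto simp: \<alpha>_def \<beta>_def)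
    have ab: "\<alpha> \<le> \<beta>" using rng mem by blast
    have cl: "\<alpha> \<in> {X a..X a'}" "\<beta> \<in> {X a..X a'}" using SX[OF mem(1)] SX[OF mem(2)] by auto
    have "real (card G) \<le> (\<beta> - \<alpha>) / \<epsilon> + 1"
      by (rule card_lattice_le(2)[OF eps ab, where org = x0]) (use rng in \<open>auto simp: S_def X\<close>)
    then have "\<epsilon> * (Nh - 5) \<le> \<beta> - \<alpha>" using G eps
      by (smt (verit, best) divide_le_eq divide_less_eq mult.commute)
    moreover have "real (card H) \<le> (max (\<phi> \<alpha>) (\<phi> \<beta>) - min (\<phi> \<alpha>) (\<phi> \<beta>)) / \<epsilon> + 1"
    proof (rule card_lattice_le(2)[OF eps, where org = y0])
      fix j assume j: "j \<in> H"
      have "\<psi> j \<in> S" using j by (simp add: S_def)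
      then have "min (\<phi> \<alpha>) (\<phi> \<beta>) \<le> \<phi> (\<psi> j) \<and> \<phi> (\<psi> j) \<le> max (\<phi> \<alpha>) (\<phi> \<beta>)"
        using rng by (intro between cl) auto
      then show "y0 + real j * \<epsilon> \<in> {min (\<phi> \<alpha>) (\<phi> \<beta>)..max (\<phi> \<alpha>) (\<phi> \<beta>)}"
        using \<psi>[OF j] by (auto simp: Y)
    qed auto
    then have "Nv - 5 \<le> (max (\<phi> \<alpha>) (\<phi> \<beta>) - min (\<phi> \<alpha>) (\<phi> \<beta>)) / \<epsilon>" using H by linarith
    then have "\<epsilon> * (Nv - 5) \<le> max (\<phi> \<alpha>) (\<phi> \<beta>) - min (\<phi> \<alpha>) (\<phi> \<beta>)" using eps by (simp add: field_simps)
    then have "\<epsilon> * (Nv - 5) \<le> \<bar>\<phi> \<beta> - \<phi> \<alpha>\<bar>" by auto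
    moreover have "{\<alpha>..\<beta>} \<subseteq> {X a<..<X a'}" using SX[OF mem(1)] SX[OF mem(2)] by auto
    moreover have "\<phi> ` {\<alpha>..\<beta>} \<subseteq> {Y b<..<Y b'}"
    proof
      fix y assume "y \<in> \<phi> ` {\<alpha>..\<beta>}"
      then obtain x where x: "\<alpha> \<le> x" "x \<le> \<beta>" "y = \<phi> x" by auto
      show "y \<in> {Y b<..<Y b'}" using between[OF cl x(1,2)] SY[OF mem(1)] SY[OF mem(2)] x by auto
    qed
    ultimately show ?thesis using ab by blast
  qed
qed

end

section \<open>Flips and geometry of the zero set in one block\<close>

text \<open>
  The flip counts \<open>nh\<close> and \<open>nv\<close> determine the extent of the set \<open>Z\<close> in the block \<open>I \<times> J\<close> up to an
  error of a few \<open>\<epsilon>\<close>: from above for all pairs of points, from below by a connected arc inside the open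
  block. The condition is invariant under exchanging the coordinates.
\<close>
definition block_resolved :: "(real \<times> real) set \<Rightarrow> real set \<Rightarrow> real set \<Rightarrow> real \<Rightarrow> real \<Rightarrow> real \<Rightarrow> bool" where
  "block_resolved Z I J \<epsilon> nh nv \<longleftrightarrow>
     (\<forall>p\<in>Z \<inter> I \<times> J. \<forall>q\<in>Z \<inter> I \<times> J. \<bar>fst p - fst q\<bar> \<le> \<epsilon> * (nh + 1) \<and> \<bar>snd p - snd q\<bar> \<le> \<epsilon> * (nv + 1)) \<and>
     ((nh \<le> 4 \<and> nv \<le> 4) \<or>
      (\<exists>C p q. C \<subseteq> Z \<inter> interior I \<times> interior J \<and> compact C \<and> connected C \<and> p \<in> C \<and> q \<in> C \<and>
         \<epsilon> * (nh - 5) \<le> \<bar>fst p - fst q\<bar> \<and> \<epsilon> * (nv - 5) \<le> \<bar>snd p - snd q\<bar>))"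

lemma block_resolved_swap:
  assumes "block_resolved (prod.swap ` Z) J I \<epsilon> nv nh"
  shows "block_resolved Z I J \<epsilon> nh nv"
  unfolding block_resolved_def
proof (intro conjI ballI)
  fix p q assume "p \<in> Z \<inter> I \<times> J" "q \<in> Z \<inter> I \<times> J"
  then have "prod.swap p \<in> prod.swap ` Z \<inter> J \<times> I" "prod.swap q \<in> prod.swap ` Z \<inter> J \<times> I" by auto
  then have "\<bar>fst (prod.swap p) - fst (prod.swap q)\<bar> \<le> \<epsilon> * (nv + 1) \<and>
      \<bar>snd (prod.swap p) - snd (prod.swap q)\<bar> \<le> \<epsilon> * (nh + 1)"
    by (rule assms[unfolded block_resolved_def, THEN conjunct1, rule_format])
  then show "\<bar>fst p - fst q\<bar> \<le> \<epsilon> * (nh + 1)" "\<bar>snd p - snd q\<bar> \<le> \<epsilon> * (nv + 1)" by auto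
next
  consider "nv \<le> 4 \<and> nh \<le> 4" | C p q where "C \<subseteq> prod.swap ` Z \<inter> interior J \<times> interior I" "compact C"
    "connected C" "p \<in> C" "q \<in> C" "\<epsilon> * (nv - 5) \<le> \<bar>fst p - fst q\<bar>" "\<epsilon> * (nh - 5) \<le> \<bar>snd p - snd q\<bar>"
    using assms unfolding block_resolved_def by blast
  then show "(nh \<le> 4 \<and> nv \<le> 4) \<or>
      (\<exists>C p q. C \<subseteq> Z \<inter> interior I \<times> interior J \<and> compact C \<and> connected C \<and> p \<in> C \<and> q \<in> C \<and>
         \<epsilon> * (nh - 5) \<le> \<bar>fst p - fst q\<bar> \<and> \<epsilon> * (nv - 5) \<le> \<bar>snd p - snd q\<bar>)"
  proof cases
    case 2
    have cont: "continuous_on C prod.swap" by (intro continuous_on_swap)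
    have "prod.swap ` C \<subseteq> Z \<inter> interior I \<times> interior J" using 2(1) by auto
    moreover have "compact (prod.swap ` C)" "connected (prod.swap ` C)"
      using compact_continuous_image[OF cont 2(2)] connected_continuous_image[OF cont 2(3)] .
    moreover have "prod.swap p \<in> prod.swap ` C" "prod.swap q \<in> prod.swap ` C" using 2 by auto
    moreover have "\<epsilon> * (nh - 5) \<le> \<bar>fst (prod.swap p) - fst (prod.swap q)\<bar>"
       "\<epsilon> * (nv - 5) \<le> \<bar>snd (prod.swap p) - snd (prod.swap q)\<bar>" using 2 by auto
    ultimately show ?thesis by blast
  qed auto
qed

context planar_C1 begin

lemma block_of_graph:
  assumes eps: "\<epsilon> > 0"
    and X: "\<And>i. X i = x0 + real i * \<epsilon>" and Y: "\<And>j. Y j = y0 + real j * \<epsilon>"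
    and a: "a \<le> a'" "a' \<le> a''" "a'' \<le> a' + 1" and b: "b \<le> b'" "b' \<le> b''" "b'' \<le> b' + 1"
    and \<delta>: "\<delta> > 0" "X a' - X a \<le> \<delta>"
    and zero: "px \<in> {X a..X a'}" "py \<in> {Y b..Y b'}" "g px py = 0"
    and \<eta>: "\<eta> > 0" "3 * \<eta> \<le> gy px py" "\<bar>gx px py\<bar> \<le> gy px py"
    and osc: "\<And>x y. x \<in> {X a..X a'} \<Longrightarrow> y \<in> thick (Y b) (Y b') \<delta> \<Longrightarrow>
       \<bar>gx x y - gx px py\<bar> \<le> \<eta> \<and> \<bar>gy x y - gy px py\<bar> \<le> \<eta>"
    and Ppos: "\<And>i j. i \<in> {a..a'} \<Longrightarrow> j \<in> {b..b'} \<Longrightarrow> g (X i) (Y j) > 0 \<Longrightarrow> P i j"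
    and Pneg: "\<And>i j. i \<in> {a..a'} \<Longrightarrow> j \<in> {b..b'} \<Longrightarrow> g (X i) (Y j) < 0 \<Longrightarrow> \<not> P i j"
  defines "nh \<equiv> hflips P {a..<a''} {b..<b'}" and "nv \<equiv> vflips P {a..<a'} {b..<b''}"
  shows "nh \<le> real (a'' - a) \<and> nv \<le> 3 * real (a' - a) \<and>
    ((\<forall>x y. x \<in> {X a..X a'} \<longrightarrow> y \<in> thick (Y b) (Y b') \<delta> \<longrightarrow> g x y = 0 \<longrightarrow> gx x y \<noteq> 0) \<longrightarrow>
      block_resolved {(x, y). g x y = 0} {X a..X a'} {Y b..Y b'} \<epsilon> nh nv)"
proof -
  let ?J = "thick (Y b) (Y b') \<delta>"
  have Xm: "X i \<le> X j" "Y i \<le> Y j" if "i \<le> j" for i j using that eps by (auto simp: X Y)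
  obtain \<phi> where \<phi>: "\<And>x. x \<in> {X a..X a'} \<Longrightarrow> \<phi> x \<in> {Y b - 2*\<delta>..Y b' + 2*\<delta>}"
    "\<And>x y. x \<in> {X a..X a'} \<Longrightarrow> y \<in> ?J \<Longrightarrow> \<phi> x < y \<Longrightarrow> g x y > 0"
    "\<And>x y. x \<in> {X a..X a'} \<Longrightarrow> y \<in> ?J \<Longrightarrow> y < \<phi> x \<Longrightarrow> g x y < 0"
    "\<And>x. x \<in> {X a..X a'} \<Longrightarrow> g x (\<phi> x) = 0"
    "\<And>x x'. x \<in> {X a..X a'} \<Longrightarrow> x' \<in> {X a..X a'} \<Longrightarrow> \<bar>\<phi> x - \<phi> x'\<bar> \<le> 2 * \<bar>x - x'\<bar>"
  proof (rule zero_set_is_graph[OF Xm(1)[OF a(1)] Xm(2)[OF b(1)] \<delta>(2,1) _ _ zero], goal_cases)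
    case (1 x y)
    then show ?case using osc[of x y] \<eta> by linarith
  next
    case (2 x y x' y')
    then show ?case using osc[of x y] osc[of x' y'] \<eta> by linarith
  next
    case (3 \<phi>)
    show ?case by (rule 3(1)) (fact 3)+
  qed
  have JY: "{Y b..Y b'} \<subseteq> ?J" using \<delta> by auto
  have \<phi>J: "\<phi> x \<in> ?J" if "x \<in> {X a..X a'}" for x using \<phi>(1)[OF that] \<delta> by auto
  have grid: "X i \<in> {X a..X a'}" "Y j \<in> ?J" if "i \<in> {a..a'}" "j \<in> {b..b'}" for i j
  proof -
    show "X i \<in> {X a..X a'}" using that Xm by auto
    have "Y j \<in> {Y b..Y b'}" using that Xm by auto
    then show "Y j \<in> ?J" using JY by blast
  qed
  interpret graph_over_block X Y x0 y0 \<epsilon> a a' a'' b b' b'' \<phi> P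
  proof
    fix i j assume ij: "i \<in> {a..a'}" "j \<in> {b..b'}"
    show "P i j" if "\<phi> (X i) < Y j" using Ppos[OF ij] \<phi>(2) grid[OF ij] that by blast
    show "\<not> P i j" if "Y j < \<phi> (X i)" using Pneg[OF ij] \<phi>(3) grid[OF ij] that by blast
  qed (fact eps X Y a b)+
  have "nh \<le> real (a'' - a)" "nv \<le> 3 * real (a' - a)"
    unfolding nh_def nv_def using Nh_le Nv_le \<phi>(5) by blast+
  moreover have "block_resolved {(x, y). g x y = 0} {X a..X a'} {Y b..Y b'} \<epsilon> nh nv"
    if tang: "\<And>x y. x \<in> {X a..X a'} \<Longrightarrow> y \<in> ?J \<Longrightarrow> g x y = 0 \<Longrightarrow> gx x y \<noteq> 0"
  proof -
    have cont: "continuous_on {X a..X a'} \<phi>"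
    proof (rule lipschitz_on_continuous_on[of 2])
      show "2-lipschitz_on {X a..X a'} \<phi>"
        by (rule lipschitz_onI) (use \<phi>(5) in \<open>auto simp: dist_real_def\<close>)
    qed
    interpret monotone_graph_over_block X Y x0 y0 \<epsilon> a a' a'' b b' b'' \<phi> P
    proof
      show "strict_mono_on {X a..X a'} \<phi> \<or> strict_antimono_on {X a..X a'} \<phi>"
      proof (rule graph_strictly_monotone[OF cont deriv_x])
        fix x y assume *: "x \<in> {X a..X a'}" "y \<in> \<phi> ` {X a..X a'}"
        then have "y \<in> ?J" using \<phi>J by blast
        then show "\<phi> x < y \<Longrightarrow> g x y > 0" "y < \<phi> x \<Longrightarrow> g x y < 0" using \<phi>(2,3) * by blast+
      qed (use \<phi>(4) \<phi>J tang in blast)+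
    qed (fact cont)
    have onG: "y = \<phi> x" if "g x y = 0" "x \<in> {X a..X a'}" "y \<in> {Y b..Y b'}" for x y
    proof -
      have "y \<in> ?J" using that JY by blast
      then show ?thesis using \<phi>(2)[OF that(2), of y] \<phi>(3)[OF that(2), of y] that(1)
        by (metis less_irrefl linorder_less_linear)
    qed
    show "block_resolved {(x, y). g x y = 0} {X a..X a'} {Y b..Y b'} \<epsilon> nh nv"
      unfolding block_resolved_def
    proof (intro conjI ballI)
      fix p q assume "p \<in> {(x, y). g x y = 0} \<inter> {X a..X a'} \<times> {Y b..Y b'}"
        "q \<in> {(x, y). g x y = 0} \<inter> {X a..X a'} \<times> {Y b..Y b'}"
      then obtain x1 x2 where *: "p = (x1, \<phi> x1)" "q = (x2, \<phi> x2)" "x1 \<in> {X a..X a'}" "x2 \<in> {X a..X a'}"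
        "\<phi> x1 \<in> {Y b..Y b'}" "\<phi> x2 \<in> {Y b..Y b'}"
        using onG by (cases p, cases q) auto
      show "\<bar>fst p - fst q\<bar> \<le> \<epsilon> * (nh + 1)" "\<bar>snd p - snd q\<bar> \<le> \<epsilon> * (nv + 1)"
        using spread_le[OF *(3-6)] by (simp_all add: * nh_def nv_def)
    next
      show "(nh \<le> 4 \<and> nv \<le> 4) \<or>
        (\<exists>C p q. C \<subseteq> {(x, y). g x y = 0} \<inter> interior {X a..X a'} \<times> interior {Y b..Y b'} \<and> compact C \<and> connected C \<and> p \<in> C \<and> q \<in> C \<and>
           \<epsilon> * (nh - 5) \<le> \<bar>fst p - fst q\<bar> \<and> \<epsilon> * (nv - 5) \<le> \<bar>snd p - snd q\<bar>)"
        using long_inner_arc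
      proof (elim disjE exE conjE)
        fix \<alpha> \<beta> assume *: "\<alpha> \<le> \<beta>" "{\<alpha>..\<beta>} \<subseteq> {X a<..<X a'}" "\<phi> ` {\<alpha>..\<beta>} \<subseteq> {Y b<..<Y b'}"
          "\<epsilon> * (Nh - 5) \<le> \<beta> - \<alpha>" "\<epsilon> * (Nv - 5) \<le> \<bar>\<phi> \<beta> - \<phi> \<alpha>\<bar>"
        define C where "C = (\<lambda>x. (x, \<phi> x)) ` {\<alpha>..\<beta>}"
        have sub: "{\<alpha>..\<beta>} \<subseteq> {X a..X a'}" using *(2) by force
        have c: "continuous_on {\<alpha>..\<beta>} (\<lambda>x. (x, \<phi> x))"
          using continuous_on_subset[OF cont sub] by (intro continuous_intros)
        have "compact C" "connected C" unfolding C_def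
          using compact_continuous_image[OF c] connected_continuous_image[OF c] by auto
        moreover have "C \<subseteq> {(x, y). g x y = 0} \<inter> interior {X a..X a'} \<times> interior {Y b..Y b'}"
          using * sub \<phi>(4) by (fastforce simp: C_def)
        moreover have "(\<alpha>, \<phi> \<alpha>) \<in> C" "(\<beta>, \<phi> \<beta>) \<in> C" using * by (auto simp: C_def)
        moreover have "\<epsilon> * (nh - 5) \<le> \<bar>fst (\<alpha>, \<phi> \<alpha>) - fst (\<beta>, \<phi> \<beta>)\<bar>"
          "\<epsilon> * (nv - 5) \<le> \<bar>snd (\<alpha>, \<phi> \<alpha>) - snd (\<beta>, \<phi> \<beta>)\<bar>"
          using * by (auto simp: nh_def nv_def)
        ultimately show ?thesis by blast
      qed (auto simp: nh_def nv_def)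
    qed
  qed
  ultimately show ?thesis by blast
qed

text \<open>
  The case of a negative derivative reduces to the positive one by negating the function and the
  pixels.
\<close>
lemma block_of_steep_graph:
  assumes eps: "\<epsilon> > 0"
    and X: "\<And>i. X i = x0 + real i * \<epsilon>" and Y: "\<And>j. Y j = y0 + real j * \<epsilon>"
    and a: "a \<le> a'" "a' \<le> a''" "a'' \<le> a' + 1" and b: "b \<le> b'" "b' \<le> b''" "b'' \<le> b' + 1"
    and \<delta>: "\<delta> > 0" "X a' - X a \<le> \<delta>"
    and zero: "px \<in> {X a..X a'}" "py \<in> {Y b..Y b'}" "g px py = 0"
    and \<eta>: "\<eta> > 0" "3 * \<eta> \<le> \<bar>gy px py\<bar>" "\<bar>gx px py\<bar> \<le> \<bar>gy px py\<bar>"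
    and osc: "\<And>x y. x \<in> {X a..X a'} \<Longrightarrow> y \<in> thick (Y b) (Y b') \<delta> \<Longrightarrow>
       \<bar>gx x y - gx px py\<bar> \<le> \<eta> \<and> \<bar>gy x y - gy px py\<bar> \<le> \<eta>"
    and Ppos: "\<And>i j. i \<in> {a..a'} \<Longrightarrow> j \<in> {b..b'} \<Longrightarrow> g (X i) (Y j) > 0 \<Longrightarrow> P i j"
    and Pneg: "\<And>i j. i \<in> {a..a'} \<Longrightarrow> j \<in> {b..b'} \<Longrightarrow> g (X i) (Y j) < 0 \<Longrightarrow> \<not> P i j"
  defines "nh \<equiv> hflips P {a..<a''} {b..<b'}" and "nv \<equiv> vflips P {a..<a'} {b..<b''}"
  shows "nh \<le> real (a'' - a) \<and> nv \<le> 3 * real (a' - a) \<and>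
    ((\<forall>x y. x \<in> {X a..X a'} \<longrightarrow> y \<in> thick (Y b) (Y b') \<delta> \<longrightarrow> g x y = 0 \<longrightarrow> gx x y \<noteq> 0) \<longrightarrow>
      block_resolved {(x, y). g x y = 0} {X a..X a'} {Y b..Y b'} \<epsilon> nh nv)"
proof (cases "gy px py > 0")
  case True
  show ?thesis
    unfolding nh_def nv_def
    by (rule block_of_graph[OF eps X Y a b \<delta> zero \<eta>(1) _ _ osc Ppos Pneg]) (use True \<eta> in auto)
next
  case False
  interpret neg: planar_C1 "\<lambda>x y. - g x y" "\<lambda>x y. - gx x y" "\<lambda>x y. - gy x y"
    by unfold_locales (intro derivative_intros deriv_x deriv_y)+
  have fl: "hflips (\<lambda>i j. \<not> P i j) I J = hflips P I J" "vflips (\<lambda>i j. \<not> P i j) I J = vflips P I J" for I J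
    unfolding hflips_def vflips_def by (intro sum.cong refl; simp)+
  have "nh \<le> real (a'' - a) \<and> nv \<le> 3 * real (a' - a) \<and>
    ((\<forall>x y. x \<in> {X a..X a'} \<longrightarrow> y \<in> thick (Y b) (Y b') \<delta> \<longrightarrow> - g x y = 0 \<longrightarrow> - gx x y \<noteq> 0) \<longrightarrow>
      block_resolved {(x, y). - g x y = 0} {X a..X a'} {Y b..Y b'} \<epsilon> nh nv)"
    unfolding nh_def nv_def
  proof (rule neg.block_of_graph[OF eps X Y a b \<delta> zero(1,2) _ \<eta>(1), where P = "\<lambda>i j. \<not> P i j", unfolded fl])
    fix x y assume "x \<in> {X a..X a'}" "y \<in> thick (Y b) (Y b') \<delta>"
    from osc[OF this] show "\<bar>- gx x y - - gx px py\<bar> \<le> \<eta> \<and> \<bar>- gy x y - - gy px py\<bar> \<le> \<eta>" by linarith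
  qed (use False \<eta> zero Ppos Pneg in auto)
  then show ?thesis by simp
qed

text \<open>
  One of the two partial derivatives dominates at the zero \<open>(px, py)\<close> and, as the gradient varies by at most
  \<open>\<eta>\<close>, on the whole enlarged block. If it is the second, the zero set is a graph over the first
  coordinate; otherwise exchange the coordinates. The crude flip bound always holds, the precise
  description of the zero set only in the absence of axis-parallel tangents.
\<close>
lemma block_dichotomy:
  assumes eps: "\<epsilon> > 0"
    and X: "\<And>i. X i = x0 + real i * \<epsilon>" and Y: "\<And>j. Y j = y0 + real j * \<epsilon>"
    and a: "a \<le> a'" "a' \<le> a''" "a'' \<le> a' + 1" "a'' - a \<le> m"
    and b: "b \<le> b'" "b' \<le> b''" "b'' \<le> b' + 1" "b'' - b \<le> m"
    and \<delta>: "\<delta> > 0" "X a' - X a \<le> \<delta>" "Y b' - Y b \<le> \<delta>"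
    and zero: "px \<in> {X a..X a'}" "py \<in> {Y b..Y b'}" "g px py = 0"
    and \<eta>: "\<eta> > 0" "3 * \<eta> \<le> max \<bar>gx px py\<bar> \<bar>gy px py\<bar>"
    and osc: "\<And>x y. x \<in> thick (X a) (X a') \<delta> \<Longrightarrow> y \<in> thick (Y b) (Y b') \<delta> \<Longrightarrow>
       \<bar>gx x y - gx px py\<bar> \<le> \<eta> \<and> \<bar>gy x y - gy px py\<bar> \<le> \<eta>"
    and Ppos: "\<And>i j. i \<in> {a..a'} \<Longrightarrow> j \<in> {b..b'} \<Longrightarrow> g (X i) (Y j) > 0 \<Longrightarrow> P i j"
    and Pneg: "\<And>i j. i \<in> {a..a'} \<Longrightarrow> j \<in> {b..b'} \<Longrightarrow> g (X i) (Y j) < 0 \<Longrightarrow> \<not> P i j"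
  defines "nh \<equiv> hflips P {a..<a''} {b..<b'}" and "nv \<equiv> vflips P {a..<a'} {b..<b''}"
  shows "nh \<le> 3 * real m \<and> nv \<le> 3 * real m \<and>
    ((\<forall>x y. x \<in> thick (X a) (X a') \<delta> \<longrightarrow> y \<in> thick (Y b) (Y b') \<delta> \<longrightarrow> g x y = 0 \<longrightarrow>
        gx x y \<noteq> 0 \<and> gy x y \<noteq> 0) \<longrightarrow>
      block_resolved {(x, y). g x y = 0} {X a..X a'} {Y b..Y b'} \<epsilon> nh nv)"
proof (cases "\<bar>gx px py\<bar> \<le> \<bar>gy px py\<bar>")
  case True
  have "nh \<le> real (a'' - a) \<and> nv \<le> 3 * real (a' - a) \<and>
    ((\<forall>x y. x \<in> {X a..X a'} \<longrightarrow> y \<in> thick (Y b) (Y b') \<delta> \<longrightarrow> g x y = 0 \<longrightarrow> gx x y \<noteq> 0) \<longrightarrow>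
      block_resolved {(x, y). g x y = 0} {X a..X a'} {Y b..Y b'} \<epsilon> nh nv)"
    unfolding nh_def nv_def
    by (rule block_of_steep_graph[OF eps X Y a(1-3) b(1-3) \<delta>(1,2) zero \<eta>(1) _ True _ Ppos Pneg])
      (use True \<eta> \<delta> osc in auto)
  moreover have "real (a'' - a) \<le> 3 * real m" "3 * real (a' - a) \<le> 3 * real m" using a by linarith+
  moreover have "{X a..X a'} \<subseteq> thick (X a) (X a') \<delta>" using \<delta> by auto
  ultimately show ?thesis by (auto intro: order_trans)
next
  case False
  interpret sw: planar_C1 "\<lambda>x y. g y x" "\<lambda>x y. gy y x" "\<lambda>x y. gx y x"
    by unfold_locales (intro deriv_x deriv_y)+
  have sub: "{Y b..Y b'} \<subseteq> thick (Y b) (Y b') \<delta>" using \<delta> by auto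
  have "nv \<le> real (b'' - b) \<and> nh \<le> 3 * real (b' - b) \<and>
    ((\<forall>x y. x \<in> {Y b..Y b'} \<longrightarrow> y \<in> thick (X a) (X a') \<delta> \<longrightarrow> g y x = 0 \<longrightarrow> gy y x \<noteq> 0) \<longrightarrow>
      block_resolved {(x, y). g y x = 0} {Y b..Y b'} {X a..X a'} \<epsilon> nv nh)"
    unfolding nh_def nv_def hflips_transpose[symmetric, of P] vflips_transpose[symmetric, of P]
  proof (rule sw.block_of_steep_graph[OF eps Y X b(1-3) a(1-3) \<delta>(1,3) zero(2,1,3) \<eta>(1)])
    show "\<bar>gy px py\<bar> \<le> \<bar>gx px py\<bar>" "3 * \<eta> \<le> \<bar>gx px py\<bar>" using False \<eta> by auto
    fix x y assume "x \<in> {Y b..Y b'}" "y \<in> thick (X a) (X a') \<delta>"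
    then show "\<bar>gy y x - gy px py\<bar> \<le> \<eta> \<and> \<bar>gx y x - gx px py\<bar> \<le> \<eta>" using osc sub by blast
  qed (use Ppos Pneg in auto)
  moreover have "real (b'' - b) \<le> 3 * real m" "3 * real (b' - b) \<le> 3 * real m" using b by linarith+
  moreover have "prod.swap ` {(x, y). g x y = 0} = {(x, y). g y x = 0}" by force
  ultimately show ?thesis using block_resolved_swap[of "{(x, y). g x y = 0}"] sub
    by (auto intro: order_trans)
qed

end

section \<open>Level sets of smooth fields on the plane\<close>

abbreviation pd :: "2 \<Rightarrow> (real^2 \<Rightarrow> real) \<Rightarrow> real^2 \<Rightarrow> real" where
  "pd \<equiv> partial_deriv"

abbreviation pt :: "real \<Rightarrow> real \<Rightarrow> real^2" where
  "pt x y \<equiv> vector [x, y]"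

lemma pt_nth: "pt x y $ 1 = x" "pt x y $ 2 = y"
  by (simp_all add: vector_2)

lemma pt_eta: "pt (s $ 1) (s $ 2) = s"
  by (simp add: vec_eq_iff forall_2 vector_2)

lemma norm_real2: "norm (s :: real^2) = norm (s $ 1, s $ 2)"
  by (simp add: norm_vec_def L2_set_def UNIV_2 norm_Pair)

lemma dist_pt: "dist (pt x y) (pt x' y') = norm (x - x', y - y')"
  by (simp add: dist_norm norm_real2 vector_2)

lemma continuous_on_pt: "continuous_on S (\<lambda>z. pt (fst z) (snd z))"
proof -
  have "(\<lambda>z. pt (fst z) (snd z)) = (\<lambda>z. fst z *\<^sub>R axis 1 1 + snd z *\<^sub>R axis 2 1)"
    by (auto simp: vec_eq_iff forall_2 vector_2 axis_def)
  then show ?thesis by (simp only:) (intro continuous_intros)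
qed

lemma C1_field_planar:
  assumes "C1_field f"
  shows "planar_C1 (\<lambda>x y. f (pt x y) - u) (\<lambda>x y. pd 1 f (pt x y)) (\<lambda>x y. pd 2 f (pt x y))"
proof
  have D: "((\<lambda>h. f (s + h *\<^sub>R axis k 1)) has_real_derivative pd k f s) (at 0)" for s k
    using assms unfolding C1_field_def partial_deriv_def by (simp add: DERIV_deriv_iff_field_differentiable)
  fix x y :: real
  have "((\<lambda>x'. f (pt x y + (x' - x) *\<^sub>R axis 1 1)) has_real_derivative pd 1 f (pt x y) * 1) (at x)"
    by (rule DERIV_chain2[where g = "\<lambda>x'. x' - x"]) (auto intro!: derivative_eq_intros D)
  moreover have "pt x y + (x' - x) *\<^sub>R axis 1 1 = pt x' y" for x'
    by (auto simp: vec_eq_iff forall_2 vector_2 axis_def)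
  ultimately show "((\<lambda>x. f (pt x y) - u) has_real_derivative pd 1 f (pt x y)) (at x)"
    by (auto intro!: derivative_eq_intros)
  have "((\<lambda>y'. f (pt x y + (y' - y) *\<^sub>R axis 2 1)) has_real_derivative pd 2 f (pt x y) * 1) (at y)"
    by (rule DERIV_chain2[where g = "\<lambda>y'. y' - y"]) (auto intro!: derivative_eq_intros D)
  moreover have "pt x y + (y' - y) *\<^sub>R axis 2 1 = pt x y'" for y'
    by (auto simp: vec_eq_iff forall_2 vector_2 axis_def)
  ultimately show "((\<lambda>y. f (pt x y) - u) has_real_derivative pd 2 f (pt x y)) (at y)"
    by (auto intro!: derivative_eq_intros)
qed

text \<open>
  Mean value theorem along the two-step axis-parallel path from \<open>p\<close> to \<open>q\<close>.
\<close>
lemma field_increment: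
  assumes "C1_field f"
  shows "\<exists>\<xi>. f q - f p = (\<Sum>k\<in>UNIV. pd k f (\<xi> k) * (q $ k - p $ k)) \<and>
    (\<forall>k l. \<xi> k $ l \<in> closed_segment (p $ l) (q $ l))"
proof -
  interpret planar_C1 "\<lambda>x y. f (pt x y) - 0" "\<lambda>x y. pd 1 f (pt x y)" "\<lambda>x y. pd 2 f (pt x y)"
    by (rule C1_field_planar) fact
  obtain a b where ab: "a \<in> closed_segment (p $ 1) (q $ 1)" "b \<in> closed_segment (p $ 2) (q $ 2)"
    "f q - f p = pd 1 f (pt a (p $ 2)) * (q $ 1 - p $ 1) + pd 2 f (pt (q $ 1) b) * (q $ 2 - p $ 2)"
    using increment[of "p $ 1" "q $ 1" "p $ 2" "q $ 2"] by (auto simp: pt_eta)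
  show ?thesis
  proof (intro exI[of _ "\<lambda>k. if k = 1 then pt a (p $ 2) else pt (q $ 1) b"] conjI allI)
    show "f q - f p = (\<Sum>k\<in>UNIV. pd k f (if k = 1 then pt a (p $ 2) else pt (q $ 1) b) * (q $ k - p $ k))"
      using ab by (simp add: UNIV_2)
    fix k l :: 2
    show "(if k = 1 then pt a (p $ 2) else pt (q $ 1) b) $ l \<in> closed_segment (p $ l) (q $ l)"
      using ab exhaust_2[of l] by (auto simp: vector_2)
  qed
qed

lemma dist_le_of_box:
  fixes p q \<xi> :: "real^'n"
  assumes "\<And>l. \<xi> $ l \<in> closed_segment (p $ l) (q $ l)"
  shows "dist p \<xi> \<le> dist p q"
  unfolding dist_norm
proof (rule norm_le_componentwise_cart)
  fix l
  show "norm ((p - \<xi>) $ l) \<le> norm ((p - q) $ l)"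
    using assms[of l] by (auto simp: closed_segment_eq_real_ivl split: if_splits)
qed

lemma C1_field_continuous:
  assumes f: "C1_field f"
  shows "continuous_on UNIV f"
proof (rule continuous_at_imp_continuous_on, intro ballI)
  fix p :: "real^2"
  have cont: "continuous_on UNIV (pd k f)" for k using f by (simp add: C1_field_def)
  have "\<exists>B. \<forall>s\<in>cball p 1. \<bar>pd k f s\<bar> \<le> B" for k
  proof -
    have "compact (pd k f ` cball p 1)"
      using continuous_on_subset[OF cont] by (intro compact_continuous_image) auto
    from compact_imp_bounded[OF this] show ?thesis unfolding bounded_iff by auto
  qed
  then obtain B where B: "\<And>k s. s \<in> cball p 1 \<Longrightarrow> \<bar>pd k f s\<bar> \<le> B k" by metis
  define A where "A = \<bar>B 1\<bar> + \<bar>B 2\<bar> + 1"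
  have A: "A > 0" "\<And>k. B k \<le> A"
  proof -
    show "A > 0" by (simp add: A_def)
    show "B k \<le> A" for k using exhaust_2[of k] by (auto simp: A_def)
  qed
  show "isCont f p"
    unfolding continuous_at_eps_delta
  proof (intro allI impI)
    fix e :: real assume e: "0 < e"
    show "\<exists>d>0. \<forall>q. dist q p < d \<longrightarrow> dist (f q) (f p) < e"
    proof (intro exI[of _ "min 1 (e / (2 * A))"] conjI allI impI)
      show "0 < min 1 (e / (2 * A))" using e A by simp
      fix q assume q: "dist q p < min 1 (e / (2 * A))"
      obtain \<xi> :: "2 \<Rightarrow> real^2" where \<xi>: "f q - f p = (\<Sum>k\<in>UNIV. pd k f (\<xi> k) * (q $ k - p $ k))"
        "\<And>k l. \<xi> k $ l \<in> closed_segment (p $ l) (q $ l)" using field_increment[OF f] by blast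
      have "\<xi> k \<in> cball p 1" for k
        using dist_le_of_box[of "\<xi> k" p q] \<xi>(2) q by (simp add: dist_commute)
      then have bd: "\<bar>pd k f (\<xi> k)\<bar> \<le> A" for k using B A(2) order_trans by blast
      have "\<bar>f q - f p\<bar> \<le> (\<Sum>k\<in>UNIV. \<bar>pd k f (\<xi> k) * (q $ k - p $ k)\<bar>)"
        unfolding \<xi>(1) by (rule sum_abs)
      also have "\<dots> \<le> (\<Sum>k\<in>(UNIV :: 2 set). A * dist q p)"
        unfolding abs_mult
        by (intro sum_mono mult_mono bd abs_diff_component_le_dist) (use A in auto)
      also have "\<dots> = 2 * A * dist q p" by simp
      also have "\<dots> < e" using q A by (simp add: field_simps)
      finally show "dist (f q) (f p) < e" by (simp add: dist_real_def)
    qed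
  qed
qed

lemma compact_square: "compact (square t)"
proof -
  have "square t = {(\<chi> i. - t)..(\<chi> i. t)}"
    by (auto simp: square_def less_eq_vec_def)
  also have "\<dots> = cbox (\<chi> i. - t) (\<chi> i. t)" by (simp add: interval_cbox_cart)
  finally show ?thesis by (simp add: compact_cbox)
qed

text \<open>
  A point of the level set that was interior to the excursion set would be a local minimum, hence
  critical.
\<close>
lemma regular_excursion_boundary:
  assumes f: "C1_field f" and reg: "regular_at_level t f u"
  shows "excursion_boundary (square t) f u = {s \<in> square t. f s = u}"
proof -
  have cont: "continuous_on UNIV f" by (rule C1_field_continuous) fact
  have cl: "closed (excursion_set f u)"
    unfolding excursion_set_def using cont closed_Collect_le[of "\<lambda>_. u" f] by (auto intro: continuous_intros)
  have op: "open {s. f s > u}" using cont open_Collect_less[of "\<lambda>_. u" f] by (auto intro: continuous_intros)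
  have "s \<in> frontier (excursion_set f u) \<longleftrightarrow> f s = u" if s: "s \<in> square t" for s
  proof
    assume fr: "s \<in> frontier (excursion_set f u)"
    then have "f s \<ge> u" using cl by (auto simp: frontier_def closure_closed excursion_set_def)
    moreover have "\<not> f s > u"
    proof
      assume "f s > u"
      then have "s \<in> interior (excursion_set f u)"
        using op by (intro interiorI[of "{s. f s > u}"]) (auto simp: excursion_set_def)
      then show False using fr by (simp add: frontier_def)
    qed
    ultimately show "f s = u" by simp
  next
    assume eq: "f s = u"
    have "s \<notin> interior (excursion_set f u)"
    proof
      assume "s \<in> interior (excursion_set f u)"
      then obtain e where e: "e > 0" "ball s e \<subseteq> excursion_set f u" by (meson mem_interior)
      have "pd k f s = 0" for k
      proof (rule DERIV_local_min[of "\<lambda>h. f (s + h *\<^sub>R axis k 1)" _ 0 e])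
        show "((\<lambda>h. f (s + h *\<^sub>R axis k 1)) has_real_derivative pd k f s) (at 0)"
          using f unfolding C1_field_def partial_deriv_def by (simp add: DERIV_deriv_iff_field_differentiable)
        have "f s \<le> f (s + h *\<^sub>R axis k 1)" if "\<bar>0 - h\<bar> < e" for h
        proof -
          have "s + h *\<^sub>R axis k 1 \<in> ball s e" using that by (simp add: dist_norm)
          then show ?thesis using e eq by (auto simp: excursion_set_def)
        qed
        then show "\<forall>h. \<bar>0 - h\<bar> < e \<longrightarrow> f (s + 0 *\<^sub>R axis k 1) \<le> f (s + h *\<^sub>R axis k 1)" by simp
      qed (fact e)
      then show False using reg s eq by (auto simp: regular_at_level_def critical_point_def)
    qed
    moreover have "s \<in> closure (excursion_set f u)"
      using eq closure_subset by (fastforce simp: excursion_set_def)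
    ultimately show "s \<in> frontier (excursion_set f u)" by (simp_all add: frontier_def)
  qed
  then show ?thesis by (auto simp: excursion_boundary_def)
qed

text \<open>
  Let \<open>q\<close> be another such point near \<open>p\<close>, with displacement \<open>(x, y)\<close> in directions \<open>k\<close> and \<open>k'\<close>.
  Since \<open>f\<close> takes equal values and its derivative in direction \<open>k\<close> is small near \<open>p\<close>, \<open>y\<close> is small
  compared with \<open>x\<close>. Since that derivative vanishes at both points while its own derivative in
  direction \<open>k\<close> is bounded away from \<open>0\<close>, \<open>x\<close> is at most a multiple of \<open>y\<close>. Both are possible only
  for \<open>x = y = 0\<close>.
\<close>
lemma tangency_isolated:
  assumes f: "C2_field f" and kk: "k \<noteq> k'" and p: "f p = u" "pd k f p = 0"
    and nz: "pd k' f p \<noteq> 0" "pd k (pd k f) p \<noteq> 0"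
  shows "\<not> p islimpt {s. f s = u \<and> pd k f s = 0}"
proof -
  have f1: "C1_field f" and f2: "C1_field (pd k f)" using f by (auto simp: C2_field_def)
  have U: "(UNIV :: 2 set) = {k, k'}" using kk exhaust_2[of k] exhaust_2[of k'] UNIV_2 by auto
  define A H L where "A = \<bar>pd k' f p\<bar>" and "H = \<bar>pd k (pd k f) p\<bar>"
    and "L = \<bar>pd k' (pd k f) p\<bar> + 1"
  have pos: "A > 0" "H > 0" "L > 0" using nz by (auto simp: A_def H_def L_def)
  \<comment> \<open>Chosen so that the two estimates combine to \<open>H / 2 * \<bar>x\<bar> \<le> H / 4 * \<bar>x\<bar>\<close>.\<close>
  define \<sigma> where "\<sigma> = A * H / (8 * L)"
  have \<sigma>: "\<sigma> > 0" using pos by (simp add: \<sigma>_def)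
  have near: "\<forall>\<^sub>F s in nhds p. \<bar>h s - h p\<bar> < e" if "continuous_on UNIV h" "e > 0" for h :: "real^2 \<Rightarrow> real" and e
  proof -
    have "isCont h p" using that by (simp add: continuous_on_eq_continuous_at)
    then have "(h \<longlongrightarrow> h p) (nhds p)" by (simp add: continuous_at tendsto_nhds_iff)
    from tendstoD[OF this that(2)] show ?thesis by (simp add: dist_real_def)
  qed
  define good where "good s \<longleftrightarrow> \<bar>pd k f s - pd k f p\<bar> < \<sigma> \<and> \<bar>pd k' f s - pd k' f p\<bar> < A / 2 \<and>
    \<bar>pd k (pd k f) s - pd k (pd k f) p\<bar> < H / 2 \<and> \<bar>pd k' (pd k f) s - pd k' (pd k f) p\<bar> < 1" for s
  have "\<forall>\<^sub>F s in nhds p. good s"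
    unfolding good_def by (intro eventually_conj near) (use f1 f2 pos \<sigma> in \<open>auto simp: C1_field_def\<close>)
  then obtain d where "d > 0" "\<And>s. dist s p < d \<Longrightarrow> good s"
    unfolding eventually_nhds_metric by blast
  note d = this[unfolded good_def]
  have "q = p" if q: "f q = u" "pd k f q = 0" "dist q p < d" for q
  proof -
    define x y where "x = q $ k - p $ k" and "y = q $ k' - p $ k'"
    obtain \<xi> :: "2 \<Rightarrow> real^2" where \<xi>: "f q - f p = (\<Sum>l\<in>UNIV. pd l f (\<xi> l) * (q $ l - p $ l))"
      "\<And>l i. \<xi> l $ i \<in> closed_segment (p $ i) (q $ i)" using field_increment[OF f1] by blast
    obtain \<zeta> :: "2 \<Rightarrow> real^2" where \<zeta>: "pd k f q - pd k f p =
        (\<Sum>l\<in>UNIV. pd l (pd k f) (\<zeta> l) * (q $ l - p $ l))"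
      "\<And>l i. \<zeta> l $ i \<in> closed_segment (p $ i) (q $ i)" using field_increment[OF f2] by blast
    have nr: "dist (\<xi> l) p < d" "dist (\<zeta> l) p < d" for l
      using dist_le_of_box[of "\<xi> l" p q] dist_le_of_box[of "\<zeta> l" p q] \<xi>(2) \<zeta>(2) q(3) by (simp_all add: dist_commute)
    have e1: "pd k f (\<xi> k) * x + pd k' f (\<xi> k') * y = 0"
      using \<xi>(1) q p kk by (simp add: U x_def y_def)
    have e2: "pd k (pd k f) (\<zeta> k) * x + pd k' (pd k f) (\<zeta> k') * y = 0"
      using \<zeta>(1) q p kk by (simp add: U x_def y_def)
    have b1: "\<bar>pd k f (\<xi> k)\<bar> \<le> \<sigma>" using d(2)[OF nr(1)[of k]] p(2) by linarith
    have b2: "A / 2 \<le> \<bar>pd k' f (\<xi> k')\<bar>" using d(2)[OF nr(1)[of k']] unfolding A_def by linarith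
    have b3: "H / 2 \<le> \<bar>pd k (pd k f) (\<zeta> k)\<bar>" using d(2)[OF nr(2)[of k]] unfolding H_def by linarith
    have b4: "\<bar>pd k' (pd k f) (\<zeta> k')\<bar> \<le> L" using d(2)[OF nr(2)[of k']] unfolding L_def by linarith
    note b = b1 b2 b3 b4
    have "A / 2 * \<bar>y\<bar> \<le> \<bar>pd k' f (\<xi> k') * y\<bar>" unfolding abs_mult using b by (intro mult_right_mono) auto
    also have "\<dots> = \<bar>pd k f (\<xi> k) * x\<bar>" using e1 by linarith
    also have "\<dots> \<le> \<sigma> * \<bar>x\<bar>" unfolding abs_mult using b by (intro mult_right_mono) auto
    finally have y: "\<bar>y\<bar> \<le> 2 * \<sigma> / A * \<bar>x\<bar>" using pos by (simp add: field_simps)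
    have "H / 2 * \<bar>x\<bar> \<le> \<bar>pd k (pd k f) (\<zeta> k) * x\<bar>" unfolding abs_mult using b by (intro mult_right_mono) auto
    also have "\<dots> = \<bar>pd k' (pd k f) (\<zeta> k') * y\<bar>" using e2 by linarith
    also have "\<dots> \<le> L * \<bar>y\<bar>" unfolding abs_mult using b by (intro mult_right_mono) auto
    also have "\<dots> \<le> L * (2 * \<sigma> / A * \<bar>x\<bar>)" using y pos by (intro mult_left_mono) auto
    also have "\<dots> = H / 4 * \<bar>x\<bar>" using pos by (simp add: \<sigma>_def field_simps)
    finally have "x = 0" using pos by (auto simp: field_simps)
    then have "y = 0" using y by simp
    with \<open>x = 0\<close> show "q = p" using U by (auto simp: vec_eq_iff x_def y_def)
  qed
  then show ?thesis unfolding islimpt_approachable using d(1) by (auto simp: dist_commute)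
qed

text \<open>
  The points where isolation fails form a closed set disjoint from the square, hence at positive
  distance from it. The enlargement by \<open>r\<close> is needed because the graph over a block at the edge of
  the square may leave the square.
\<close>
lemma tangencies_finite:
  assumes f: "C2_field f" and reg: "regular_at_level t f u" and t: "t > 0"
  obtains r where "r > 0" "finite {s \<in> square (t + r). f s = u \<and> (\<exists>k. pd k f s = 0)}"
proof -
  have f1: "C1_field f" and f2: "\<And>k. C1_field (pd k f)" using f by (auto simp: C2_field_def)
  note cont = C1_field_continuous[OF f1] C1_field_continuous[OF f2]
  have cont2: "continuous_on UNIV (pd k (pd k f))" for k
    using f2 by (simp add: C1_field_def)
  have cl: "closed {s. h s = c}" if "continuous_on UNIV h" for h :: "real^2 \<Rightarrow> real" and c
    using that by (auto intro!: closed_Collect_eq continuous_intros)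
  define Bad where "Bad = ({s. f s = u} \<inter> {s. pd 1 f s = 0} \<inter> {s. pd 2 f s = 0}) \<union>
    ({s. f s = u} \<inter> {s. pd 1 f s = 0} \<inter> {s. pd 1 (pd 1 f) s = 0}) \<union>
    ({s. f s = u} \<inter> {s. pd 2 f s = 0} \<inter> {s. pd 2 (pd 2 f) s = 0})"
  have "closed Bad" unfolding Bad_def by (intro closed_Un closed_Int cl cont cont2)
  moreover have "square t \<inter> Bad = {}"
    using reg by (auto simp: regular_at_level_def critical_point_def forall_2 Bad_def)
  ultimately obtain d where d: "d > 0" "\<And>x y. x \<in> square t \<Longrightarrow> y \<in> Bad \<Longrightarrow> d \<le> dist x y"
    using separate_compact_closed[OF compact_square] by metis
  define r where "r = d / 3"
  have r: "r > 0" using d by (simp add: r_def)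
  have noBad: "s \<notin> Bad" if s: "s \<in> square (t + r)" for s
  proof
    assume "s \<in> Bad"
    define c :: "real^2" where "c = (\<chi> i. max (- t) (min t (s $ i)))"
    have "c \<in> square t" using t by (auto simp: c_def square_def)
    have "\<bar>c $ i - s $ i\<bar> \<le> r" for i
    proof -
      have "- (t + r) \<le> s $ i" "s $ i \<le> t + r" using s by (auto simp: square_def)
      then show ?thesis unfolding c_def using r t by simp
    qed
    then have "dist c s \<le> (\<Sum>i\<in>UNIV. \<bar>c $ i - s $ i\<bar>)" "(\<Sum>i\<in>UNIV. \<bar>c $ i - s $ i\<bar>) \<le> 2 * r"
      using norm_le_l1_cart[of "c - s"] sum_mono[of UNIV "\<lambda>i. \<bar>c $ i - s $ i\<bar>" "\<lambda>_. r"] by (auto simp: dist_norm)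
    then have "dist c s < d" using d(1) by (simp add: r_def)
    then show False using d(2)[OF \<open>c \<in> square t\<close> \<open>s \<in> Bad\<close>] by simp
  qed
  have fin: "finite (square (t + r) \<inter> ({s. f s = u} \<inter> {s. pd k f s = 0}))" (is "finite ?E") for k
  proof (rule ccontr)
    assume "infinite ?E"
    have "compact ?E" by (intro compact_Int_closed compact_square closed_Int cl cont)
    then obtain p where p: "p \<in> ?E" "p islimpt ?E"
      using \<open>infinite ?E\<close> unfolding compact_eq_Bolzano_Weierstrass by blast
    obtain k' where k': "k \<noteq> k'" "k = 1 \<and> k' = 2 \<or> k = 2 \<and> k' = 1"
      using exhaust_2[of k] that[of 1] that[of 2] by auto
    have "p \<notin> Bad" using noBad p by blast
    then have "\<not> p islimpt {s. f s = u \<and> pd k f s = 0}"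
      using p(1) k' by (intro tangency_isolated[OF f k'(1)]) (auto simp: Bad_def)
    then show False using islimpt_subset[OF p(2), of "{s. f s = u \<and> pd k f s = 0}"] by blast
  qed
  have "{s \<in> square (t + r). f s = u \<and> (\<exists>k. pd k f s = 0)} =
     (\<Union>k\<in>UNIV. square (t + r) \<inter> ({s. f s = u} \<inter> {s. pd k f s = 0}))" by auto
  moreover have "finite (\<Union>k\<in>UNIV. square (t + r) \<inter> ({s. f s = u} \<inter> {s. pd k f s = 0}))"
    by (rule finite_UN_I) (use fin in auto)
  ultimately have "finite {s \<in> square (t + r). f s = u \<and> (\<exists>k. pd k f s = 0)}"
    by simp
  with r show thesis by (rule that)
qed

text \<open>
  Of a displacement \<open>d\<close> that is almost orthogonal to the gradient \<open>v\<close>, the component along the tangent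
  direction carries almost the whole length.
\<close>
lemma chord_projection:
  fixes v1 v2 d1 d2 :: real
  defines "w \<equiv> norm (v1, v2)" and "r \<equiv> norm (d1, d2)"
  assumes c: "c > 0" "c \<le> w" and \<sigma>: "\<sigma> > 0" and steep: "\<bar>v1 * d1 + v2 * d2\<bar> \<le> \<sigma> / (1 + \<sigma>) * c * r"
  shows "r \<le> (1 + \<sigma>) * \<bar>(v1 * d2 - v2 * d1) / w\<bar>" "\<bar>(v1 * d2 - v2 * d1) / w\<bar> \<le> r"
proof -
  define \<tau> where "\<tau> = \<sigma> / (1 + \<sigma>)"
  have \<tau>: "0 \<le> \<tau>" "\<tau> \<le> 1" "1 - \<tau> = 1 / (1 + \<sigma>)" using \<sigma> by (auto simp: \<tau>_def field_simps)
  have w: "w > 0" "w\<^sup>2 = v1\<^sup>2 + v2\<^sup>2"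
  proof -
    show "w > 0" using c by linarith
    show "w\<^sup>2 = v1\<^sup>2 + v2\<^sup>2" by (simp add: w_def norm_Pair)
  qed
  have r: "r \<ge> 0" "r\<^sup>2 = d1\<^sup>2 + d2\<^sup>2"
    by (auto simp: r_def norm_Pair)
  define x where "x = v1 * d2 - v2 * d1"
  define y where "y = v1 * d1 + v2 * d2"
  have id: "x\<^sup>2 + y\<^sup>2 = (w * r)\<^sup>2" unfolding power_mult_distrib w r x_def y_def by (simp add: power2_eq_square algebra_simps)
  have "x\<^sup>2 \<le> (w * r)\<^sup>2" using id by (smt (verit) zero_le_power2)
  then have "\<bar>x\<bar> \<le> w * r" using w r by (simp add: abs_le_square_iff[symmetric] abs_mult)
  then show "\<bar>(v1 * d2 - v2 * d1) / w\<bar> \<le> r" using w unfolding x_def[symmetric] by (simp add: field_simps)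
  have "\<bar>y\<bar> \<le> \<tau> * (w * r)"
  proof -
    have "\<bar>y\<bar> \<le> \<tau> * c * r" using steep by (simp add: y_def \<tau>_def)
    also have "\<dots> \<le> \<tau> * w * r" using c \<tau> r by (intro mult_right_mono mult_left_mono) auto
    finally show ?thesis by (simp add: mult.assoc)
  qed
  then have "y\<^sup>2 \<le> \<tau>\<^sup>2 * (w * r)\<^sup>2" using power_mono[of "\<bar>y\<bar>" "\<tau> * (w * r)" 2] by (simp add: power_mult_distrib)
  also have "\<dots> \<le> \<tau> * (w * r)\<^sup>2" using \<tau> by (intro mult_right_mono) (auto simp: power2_eq_square mult_left_le)
  finally have "(1 - \<tau>) * (w * r)\<^sup>2 \<le> x\<^sup>2" using id by (simp add: algebra_simps)
  then have "(w * r)\<^sup>2 \<le> (1 + \<sigma>) * x\<^sup>2" unfolding \<tau>(3) using \<sigma> by (simp add: field_simps)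
  also have "\<dots> \<le> ((1 + \<sigma>) * x)\<^sup>2"
  proof -
    have "(1 + \<sigma>) * 1 \<le> (1 + \<sigma>) * (1 + \<sigma>)" using \<sigma> by (intro mult_left_mono) auto
    then have "(1 + \<sigma>) * x\<^sup>2 \<le> (1 + \<sigma>)\<^sup>2 * x\<^sup>2" by (intro mult_right_mono) (auto simp: power2_eq_square)
    then show ?thesis by (simp add: power_mult_distrib)
  qed
  finally have "w * r \<le> (1 + \<sigma>) * \<bar>x\<bar>" using \<sigma> w r by (simp add: abs_le_square_iff[symmetric] abs_mult)
  then show "r \<le> (1 + \<sigma>) * \<bar>(v1 * d2 - v2 * d1) / w\<bar>" using w unfolding x_def[symmetric] by (simp add: field_simps)
qed

section \<open>The grid and its blocks\<close>

lemma grid_rows_eq: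
  assumes "\<epsilon> > 0" "t > 0" "square_vertices t \<subseteq> grid t \<epsilon>"
  obtains N where "real N * \<epsilon> = 2 * t" "grid_rows t \<epsilon> = N + 1"
proof -
  have "pt t t \<in> square_vertices t" by (simp add: square_vertices_def forall_2 vector_2)
  then have "pt t t \<in> grid t \<epsilon>" using assms by blast
  then obtain N j where "pt t t = grid_point t \<epsilon> N j" by (auto simp: grid_def)
  then have "pt t t $ 1 = grid_point t \<epsilon> N j $ 1" by simp
  then have N: "real N * \<epsilon> = 2 * t" by (simp add: grid_point_def vector_2)
  have le: "real j * \<epsilon> \<le> 2 * t \<longleftrightarrow> j \<le> N" for j unfolding N[symmetric] using assms by simp
  have "(\<lambda>s. s $ 2) ` grid t \<epsilon> = (\<lambda>j. - t + real j * \<epsilon>) ` {..N}"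
  proof (intro equalityI subsetI)
    fix y assume "y \<in> (\<lambda>s. s $ 2) ` grid t \<epsilon>"
    then obtain s where s: "s \<in> grid t \<epsilon>" "y = s $ 2" by blast
    then obtain i j where "s = grid_point t \<epsilon> i j" "s \<in> square t" by (auto simp: grid_def)
    then have "y = - t + real j * \<epsilon>" "y \<le> t"
      using s(2) by (simp_all add: grid_point_def square_def forall_2 vector_2)
    then show "y \<in> (\<lambda>j. - t + real j * \<epsilon>) ` {..N}" using le[of j] by auto
  next
    fix y assume "y \<in> (\<lambda>j. - t + real j * \<epsilon>) ` {..N}"
    then obtain j where j: "j \<le> N" "y = - t + real j * \<epsilon>" by auto
    have "grid_point t \<epsilon> 0 j \<in> square t"
      using le[of j] j(1) assms(1,2) by (simp add: grid_point_def square_def forall_2 vector_2)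
    then have "grid_point t \<epsilon> 0 j \<in> grid t \<epsilon>" by (auto simp: grid_def)
    moreover have "grid_point t \<epsilon> 0 j $ 2 = y" by (simp add: grid_point_def vector_2 j)
    ultimately show "y \<in> (\<lambda>s. s $ 2) ` grid t \<epsilon>" by force
  qed
  moreover have "inj_on (\<lambda>j. - t + real j * \<epsilon>) {..N}" using assms by (auto simp: inj_on_def)
  ultimately have "grid_rows t \<epsilon> = N + 1" by (simp add: grid_rows_def card_image)
  with N show thesis by (rule that)
qed

text \<open>
  The grid has \<open>N + 1\<close> rows, since the opposite vertices of the square belong to it.
\<close>
locale regular_grid =
  fixes t \<epsilon> :: real and N m :: nat
  assumes t: "t > 0" and eps: "\<epsilon> > 0" and m: "m \<ge> 1" and N: "real N * \<epsilon> = 2 * t"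
    and rows: "grid_rows t \<epsilon> = N + 1"
begin

definition X :: "nat \<Rightarrow> real" where "X i = - t + real i * \<epsilon>"
definition \<delta> :: real where "\<delta> = real m * \<epsilon>"
abbreviation B :: "nat set" where "B \<equiv> block_indices t \<epsilon> m"
text \<open>
  Last index of the block that starts at \<open>a\<close>, and the exclusive bound of its own columns. They differ
  only for the last block.
\<close>
definition hi :: "nat \<Rightarrow> nat" where "hi a = min (a + m) N"
definition hi' :: "nat \<Rightarrow> nat" where "hi' a = min (a + m) (N + 1)"
definition Q :: "nat \<Rightarrow> nat \<Rightarrow> (real^2) set" where
  "Q a b = {s. s $ 1 \<in> {X a..X (hi a)} \<and> s $ 2 \<in> {X b..X (hi b)}}"

lemma delta_pos: "\<delta> > 0" and eps_le_delta: "\<epsilon> \<le> \<delta>"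
  using m eps by (auto simp: \<delta>_def)

lemma B_eq: "B = {a. a \<le> N \<and> m dvd a}" by (auto simp: block_indices_def rows)
lemma finite_B: "finite B" by (simp add: block_indices_def)

lemma X_le: "X i \<le> X j \<longleftrightarrow> i \<le> j" using eps by (simp add: X_def)
lemma X_N: "X N = t" using N by (simp add: X_def)
lemma X_0: "X 0 = - t" by (simp add: X_def)

lemma hi: "a \<in> B \<Longrightarrow> a \<le> hi a" "a \<in> B \<Longrightarrow> hi a \<le> hi' a" "hi' a \<le> hi a + 1" "hi' a - a \<le> m" "hi a \<le> N"
  by (auto simp: B_eq hi_def hi'_def)

lemma X_hi: "X (hi a) \<le> X a + \<delta>"
proof -
  have "X (hi a) \<le> X (a + m)" by (simp add: X_le hi_def)
  then show ?thesis by (simp add: X_def \<delta>_def algebra_simps)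
qed

lemma div_block: "i < m * (i div m) + m"
  using m dividend_less_times_div[of m i] by (simp add: add.commute)

lemma interval_cover:
  assumes "x \<in> {- t..t}"
  obtains a where "a \<in> B" "x \<in> {X a..X (hi a)}"
proof -
  have N0: "N > 0" using N t by (cases N) auto
  define i where "i = min (nat \<lfloor>(x + t) / \<epsilon>\<rfloor>) (N - 1)"
  have q: "0 \<le> (x + t) / \<epsilon>" "(x + t) / \<epsilon> \<le> real N" using assms eps N by (auto simp: field_simps)
  have "real i \<le> (x + t) / \<epsilon>" "(x + t) / \<epsilon> \<le> real i + 1"
    unfolding i_def using q N0 by (auto simp: min_def of_nat_diff split: if_splits) linarith+
  then have xi: "X i \<le> x" "x \<le> X (i + 1)" using eps by (auto simp: X_def field_simps)
  define a where "a = m * (i div m)"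
  have iN: "i + 1 \<le> N" using N0 by (auto simp: i_def)
  have ai: "a \<le> i" "i < a + m" using m by (auto simp: a_def div_block)
  have "a \<le> N" using ai iN by linarith
  then have "a \<in> B" by (simp add: B_eq a_def)
  moreover have "X a \<le> X i" "X (i + 1) \<le> X (hi a)" using ai iN by (auto simp: X_le hi_def)
  ultimately show thesis using that xi by fastforce
qed

lemma blocks_cover:
  assumes "s \<in> square t"
  shows "\<exists>a\<in>B. \<exists>b\<in>B. s \<in> Q a b"
proof -
  have "s $ 1 \<in> {- t..t}" "s $ 2 \<in> {- t..t}" using assms by (simp_all add: square_def)
  then obtain a b where "a \<in> B" "s $ 1 \<in> {X a..X (hi a)}" "b \<in> B" "s $ 2 \<in> {X b..X (hi b)}"
    by (meson interval_cover)
  then show ?thesis by (auto simp: Q_def)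
qed

lemma block_in_square:
  assumes "s \<in> Q a b" shows "s \<in> square t"
proof -
  have "X 0 \<le> X a" "X 0 \<le> X b" "X (hi a) \<le> X N" "X (hi b) \<le> X N" by (auto simp: X_le hi)
  then show ?thesis using assms by (auto simp: Q_def square_def forall_2 X_0 X_N)
qed

lemma multiple_eq: "a \<in> B \<Longrightarrow> m * (a div m) = a" by (simp add: B_eq)

lemma X_multiple: "a \<in> B \<Longrightarrow> X a = - t + real (a div m) * \<delta>"
proof -
  assume "a \<in> B"
  then have "real a = real m * real (a div m)" by (metis multiple_eq of_nat_mult)
  then show ?thesis by (simp add: X_def \<delta>_def)
qed

lemma card_blocks_meeting:
  assumes len: "hausdorff1 Z < \<infinity>" and comps: "finite (components Z)"
  shows "real (card {(a, b) \<in> B \<times> B. Q a b \<inter> Z \<noteq> {}}) \<le> 16 * enn2real (hausdorff1 Z) / \<delta> + 9 * real (card (components Z))"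
proof -
  define V where "V = {(a, b) \<in> B \<times> B. Q a b \<inter> Z \<noteq> {}}"
  define K where "K = (\<lambda>(a, b). (a div m, b div m)) ` V"
  define z where "z = (\<lambda>(k, l). SOME s. s \<in> Q (m * k) (m * l) \<inter> Z)"
  have finV: "finite V" using finite_B by (auto simp: V_def intro: finite_subset[of _ "B \<times> B"])
  have "inj_on (\<lambda>(a, b). (a div m, b div m)) V"
    by (auto simp: inj_on_def V_def) (metis multiple_eq)+
  then have card: "card K = card V" unfolding K_def by (rule card_image)
  have z: "z (k, l) \<in> Q (m * k) (m * l) \<inter> Z" "m * k \<in> B" "m * l \<in> B" if kl: "(k, l) \<in> K" for k l
  proof -
    obtain a b where ab: "(a, b) \<in> V" "k = a div m" "l = b div m" using kl by (auto simp: K_def)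
    then have eq: "m * k = a" "m * l = b" using multiple_eq by (auto simp: V_def)
    then show "m * k \<in> B" "m * l \<in> B" using ab by (auto simp: V_def)
    have "\<exists>s. s \<in> Q (m * k) (m * l) \<inter> Z" using ab eq by (auto simp: V_def)
    from someI_ex[OF this] show "z (k, l) \<in> Q (m * k) (m * l) \<inter> Z" by (simp add: z_def)
  qed
  have cell: "{X (m * k)..X (hi (m * k))} \<subseteq> {- t + real k * \<delta>..- t + (real k + 1) * \<delta>}" for k
    using X_hi[of "m * k"] by (auto simp: X_def \<delta>_def algebra_simps)
  have "real (card K) \<le> 16 * enn2real (hausdorff1 Z) / \<delta> + 9 * real (card (components Z))"
  proof (rule count_cells_meeting[OF _ delta_pos _ _ _ len comps, where z = z and c = "- t"])
    show "finite K" using finV by (simp add: K_def)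
    fix k l assume kl: "(k, l) \<in> K"
    show "z (k, l) \<in> Z" using z[OF kl] by blast
    have "z (k, l) $ 1 \<in> {X (m * k)..X (hi (m * k))}" "z (k, l) $ 2 \<in> {X (m * l)..X (hi (m * l))}"
      using z[OF kl] by (auto simp: Q_def)
    then show "z (k, l) $ 1 \<in> {- t + real k * \<delta>..- t + (real k + 1) * \<delta>}"
      "z (k, l) $ 2 \<in> {- t + real l * \<delta>..- t + (real l + 1) * \<delta>}" using cell by blast+
  qed
  then show ?thesis using card by (simp add: V_def)
qed

lemma card_blocks_near: "real (card {a \<in> B. \<bar>x - X a\<bar> \<le> 5 * \<delta>}) \<le> 11"
proof -
  define K where "K = (\<lambda>a. a div m) ` {a \<in> B. \<bar>x - X a\<bar> \<le> 5 * \<delta>}"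
  have "inj_on (\<lambda>a. a div m) {a \<in> B. \<bar>x - X a\<bar> \<le> 5 * \<delta>}"
    by (auto simp: inj_on_def) (metis multiple_eq)
  then have "card K = card {a \<in> B. \<bar>x - X a\<bar> \<le> 5 * \<delta>}" unfolding K_def by (rule card_image)
  moreover have "real (card K) \<le> ((x + 5 * \<delta>) - (x - 5 * \<delta>)) / \<delta> + 1"
  proof (rule card_lattice_le(2)[OF delta_pos, where org = "- t"])
    fix k assume "k \<in> K"
    then obtain a where a: "a \<in> B" "\<bar>x - X a\<bar> \<le> 5 * \<delta>" "k = a div m" by (auto simp: K_def)
    then show "- t + real k * \<delta> \<in> {x - 5 * \<delta>..x + 5 * \<delta>}" using X_multiple[OF a(1)] by auto
  qed (use delta_pos in auto)
  ultimately show ?thesis using delta_pos by simp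
qed

text \<open>
  The blocks are the fibres of \<open>i \<mapsto> m * (i div m)\<close>.
\<close>
lemma sum_over_blocks:
  fixes h :: "nat \<Rightarrow> 'b::comm_monoid_add"
  assumes "R \<le> N + 1"
  shows "(\<Sum>a\<in>B. \<Sum>i\<in>{a..<min (a + m) R}. h i) = (\<Sum>i<R. h i)"
proof -
  have "{i \<in> {..<R}. m * (i div m) = a} = {a..<min (a + m) R}" if "a \<in> B" for a
  proof (intro equalityI subsetI)
    fix i assume "i \<in> {i \<in> {..<R}. m * (i div m) = a}"
    then show "i \<in> {a..<min (a + m) R}" using m by (auto simp: div_block)
  next
    fix i assume i: "i \<in> {a..<min (a + m) R}"
    obtain k where "a = m * k" using \<open>a \<in> B\<close> by (auto simp: B_eq)
    moreover from this i have "i div m = k" by (auto intro: div_nat_eqI simp: mult.commute)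
    ultimately show "i \<in> {i \<in> {..<R}. m * (i div m) = a}" using i by auto
  qed
  then have "(\<Sum>a\<in>B. \<Sum>i\<in>{a..<min (a + m) R}. h i) = (\<Sum>a\<in>B. \<Sum>i\<in>{i \<in> {..<R}. m * (i div m) = a}. h i)"
    by (intro sum.cong) auto
  also have "\<dots> = (\<Sum>i<R. h i)"
  proof (rule sum.group)
    show "(\<lambda>i. m * (i div m)) ` {..<R} \<subseteq> B"
    proof safe
      fix i assume "i < R"
      moreover have "m * (i div m) \<le> i" by simp
      ultimately have "m * (i div m) \<le> N" using assms by linarith
      then show "m * (i div m) \<in> B" by (simp add: B_eq)
    qed
  qed (auto simp: finite_B)
  finally show ?thesis .
qed

end

lemma sign_change_zero:
  fixes h :: "real \<Rightarrow> real"
  assumes "\<And>x. isCont h x" "l \<le> r" "(0 \<le> h l) \<noteq> (0 \<le> h r)"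
  shows "\<exists>x\<in>{l..r}. h x = 0"
proof (cases "0 \<le> h l")
  case True
  then show ?thesis using IVT2[of h r 0 l] assms by auto
next
  case False
  then show ?thesis using IVT[of h l 0 r] assms by auto
qed

section \<open>The estimator for a fixed level set\<close>

locale level_grid = regular_grid +
  fixes f :: "real^2 \<Rightarrow> real" and u :: real
  assumes f: "C1_field f"
begin

definition Z :: "(real^2) set" where "Z = {s \<in> square t. f s = u}"
definition Pix :: "nat \<Rightarrow> nat \<Rightarrow> bool" where "Pix i j \<longleftrightarrow> f (pt (X i) (X j)) \<ge> u"
definition nh :: "nat \<Rightarrow> nat \<Rightarrow> real" where "nh a b = hflips Pix {a..<hi' a} {b..<hi b}"
definition nv :: "nat \<Rightarrow> nat \<Rightarrow> real" where "nv a b = vflips Pix {a..<hi a} {b..<hi' b}"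

sublocale planar_C1 "\<lambda>x y. f (pt x y) - u" "\<lambda>x y. pd 1 f (pt x y)" "\<lambda>x y. pd 2 f (pt x y)"
  by (rule C1_field_planar) (rule f)

lemma N_h_eq: "N_h t \<epsilon> m f u a b = nh a b" and N_v_eq: "N_v t \<epsilon> m f u a b = nv a b"
  unfolding N_h_def N_v_def nh_def nv_def hflips_def vflips_def hi_def hi'_def rows pixel_def Pix_def
    grid_point_def X_def by (auto intro!: sum.cong)

lemma estimator_eq: "perimeter_estimator \<epsilon> m t f u = (\<Sum>a\<in>B. \<Sum>b\<in>B. \<epsilon> * norm (nh a b, nv a b))"
  by (simp add: perimeter_estimator_def N_h_eq N_v_eq sum_distrib_left)

lemma vertical_edge_zero:
  assumes "Pix i j \<noteq> Pix i (j + 1)"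
  obtains y where "y \<in> {X j..X (j + 1)}" "f (pt (X i) y) = u"
proof -
  have "\<exists>y\<in>{X j..X (j + 1)}. f (pt (X i) y) - u = 0"
    by (rule sign_change_zero[OF DERIV_isCont[OF deriv_y]]) (use assms in \<open>auto simp: Pix_def X_le\<close>)
  then show thesis using that by auto
qed

lemma horizontal_edge_zero:
  assumes "Pix i j \<noteq> Pix (i + 1) j"
  obtains x where "x \<in> {X i..X (i + 1)}" "f (pt x (X j)) = u"
proof -
  have "\<exists>x\<in>{X i..X (i + 1)}. f (pt x (X j)) - u = 0"
    by (rule sign_change_zero[OF DERIV_isCont[OF deriv_x]]) (use assms in \<open>auto simp: Pix_def X_le\<close>)
  then show thesis using that by auto
qed

lemma no_flips_off_level:
  assumes "Q a b \<inter> Z = {}" "a \<in> B" "b \<in> B"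
  shows "nh a b = 0" "nv a b = 0"
proof -
  have no: "f s \<noteq> u" if "s \<in> Q a b" for s
    using assms(1) block_in_square[OF that] that by (auto simp: Z_def)
  have mem: "X i \<in> {X a..X (hi a)}" if "i \<in> {a..hi a}" for i a using that by (auto simp: X_le)
  have 1: "Pix i j = Pix i (j + 1)" if ij: "i \<in> {a..<hi' a}" "j \<in> {b..<hi b}" for i j
  proof (rule ccontr)
    assume "Pix i j \<noteq> Pix i (j + 1)"
    then obtain y where y: "y \<in> {X j..X (j + 1)}" "f (pt (X i) y) = u" by (rule vertical_edge_zero)
    have "i \<in> {a..hi a}" "j \<in> {b..hi b}" "j + 1 \<in> {b..hi b}" using ij hi(3)[of a] by auto
    then have "X i \<in> {X a..X (hi a)}" "X j \<in> {X b..X (hi b)}" "X (j + 1) \<in> {X b..X (hi b)}" by (intro mem; simp)+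
    then have "pt (X i) y \<in> Q a b" using y(1) by (auto simp: Q_def vector_2)
    then show False using no y by blast
  qed
  have 2: "Pix i j = Pix (i + 1) j" if ij: "i \<in> {a..<hi a}" "j \<in> {b..<hi' b}" for i j
  proof (rule ccontr)
    assume "Pix i j \<noteq> Pix (i + 1) j"
    then obtain x where x: "x \<in> {X i..X (i + 1)}" "f (pt x (X j)) = u" by (rule horizontal_edge_zero)
    have "i \<in> {a..hi a}" "j \<in> {b..hi b}" "i + 1 \<in> {a..hi a}" using ij hi(3)[of b] by auto
    then have "X i \<in> {X a..X (hi a)}" "X j \<in> {X b..X (hi b)}" "X (i + 1) \<in> {X a..X (hi a)}" by (intro mem; simp)+
    then have "pt x (X j) \<in> Q a b" using x(1) by (auto simp: Q_def vector_2)
    then show False using no x by blast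
  qed
  show "nh a b = 0" unfolding nh_def hflips_def using 1 by (intro sum.neutral ballI) auto
  show "nv a b = 0" unfolding nv_def vflips_def using 2 by (intro sum.neutral ballI) auto
qed

lemma total_flips:
  "(\<Sum>a\<in>B. \<Sum>b\<in>B. nh a b) = hflips Pix {..<N + 1} {..<N}"
  "(\<Sum>a\<in>B. \<Sum>b\<in>B. nv a b) = vflips Pix {..<N} {..<N + 1}"
proof -
  have *: "(\<Sum>a\<in>B. \<Sum>b\<in>B. \<Sum>i\<in>{a..<min (a + m) R}. \<Sum>j\<in>{b..<min (b + m) R'}. h i j) = (\<Sum>i<R. \<Sum>j<R'. h i j)"
    if "R \<le> N + 1" "R' \<le> N + 1" for R R' and h :: "nat \<Rightarrow> nat \<Rightarrow> real"
  proof -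
    have "(\<Sum>a\<in>B. \<Sum>b\<in>B. \<Sum>i\<in>{a..<min (a + m) R}. \<Sum>j\<in>{b..<min (b + m) R'}. h i j)
       = (\<Sum>a\<in>B. \<Sum>i\<in>{a..<min (a + m) R}. \<Sum>b\<in>B. \<Sum>j\<in>{b..<min (b + m) R'}. h i j)"
      by (rule sum.cong[OF refl]) (rule sum.swap)
    then show ?thesis by (simp only: sum_over_blocks[OF that(1)] sum_over_blocks[OF that(2)])
  qed
  show "(\<Sum>a\<in>B. \<Sum>b\<in>B. nh a b) = hflips Pix {..<N + 1} {..<N}"
    "(\<Sum>a\<in>B. \<Sum>b\<in>B. nv a b) = vflips Pix {..<N} {..<N + 1}"
    unfolding nh_def nv_def hflips_def vflips_def hi_def hi'_def by (rule *; simp)+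
qed

text \<open>
  The same grid with blocks of a single pixel (\<open>m = 1\<close>): each block then has at most one flip of either
  orientation, and none unless it meets \<open>Z\<close>, so the flips are bounded by the number of cells of side
  \<open>\<epsilon>\<close> that meet \<open>Z\<close>.
\<close>
lemma flips_le:
  assumes len: "hausdorff1 Z < \<infinity>" and comps: "finite (components Z)"
  shows "hflips Pix {..<N + 1} {..<N} \<le> 16 * enn2real (hausdorff1 Z) / \<epsilon> + 9 * real (card (components Z))"
    "vflips Pix {..<N} {..<N + 1} \<le> 16 * enn2real (hausdorff1 Z) / \<epsilon> + 9 * real (card (components Z))"
proof -
  interpret one: level_grid t \<epsilon> N 1 f u
    by unfold_locales (use t eps N rows f in auto)
  have delta: "one.\<delta> = \<epsilon>" unfolding one.\<delta>_def by simp
  define V where "V = {(a, b) \<in> one.B \<times> one.B. one.Q a b \<inter> Z \<noteq> {}}"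
  have finV: "finite V" using one.finite_B by (auto simp: V_def intro: finite_subset[of _ "one.B \<times> one.B"])
  have card: "real (card V) \<le> 16 * enn2real (hausdorff1 Z) / \<epsilon> + 9 * real (card (components Z))"
    by (rule one.card_blocks_meeting[OF assms, folded V_def, unfolded delta])
  have sum_le: "(\<Sum>a\<in>one.B. \<Sum>b\<in>one.B. F a b) \<le> real (card V)"
    if "\<And>a b. F a b \<le> 1" "\<And>a b. a \<in> one.B \<Longrightarrow> b \<in> one.B \<Longrightarrow> one.Q a b \<inter> Z = {} \<Longrightarrow> F a b = 0"
    for F :: "nat \<Rightarrow> nat \<Rightarrow> real"
  proof -
    have "(\<Sum>a\<in>one.B. \<Sum>b\<in>one.B. F a b) = (\<Sum>(a, b)\<in>one.B \<times> one.B. F a b)" by (rule sum.cartesian_product)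
    also have "\<dots> = (\<Sum>(a, b)\<in>V. F a b)"
      by (rule sum.mono_neutral_right) (use that(2) one.finite_B in \<open>auto simp: V_def\<close>)
    also have "\<dots> \<le> (\<Sum>x\<in>V. 1)" by (intro sum_mono) (use that(1) in auto)
    finally show ?thesis by simp
  qed
  have le1: "one.nh a b \<le> 1" "one.nv a b \<le> 1" for a b
  proof -
    have c: "card {a..<one.hi a} \<le> 1" "card {a..<one.hi' a} \<le> 1" for a
      unfolding one.hi_def one.hi'_def by simp_all
    have "card {a..<one.hi' a} * card {b..<one.hi b} \<le> 1 * 1" "card {a..<one.hi a} * card {b..<one.hi' b} \<le> 1 * 1"
      by (intro mult_mono c; simp)+
    then show "one.nh a b \<le> 1" "one.nv a b \<le> 1" unfolding one.nh_def one.nv_def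
      using flips_le_card[of one.Pix "{a..<one.hi' a}" "{b..<one.hi b}"]
        flips_le_card[of one.Pix "{a..<one.hi a}" "{b..<one.hi' b}"] by linarith+
  qed
  have zero: "one.nh a b = 0" "one.nv a b = 0" if "a \<in> one.B" "b \<in> one.B" "one.Q a b \<inter> Z = {}" for a b
    using one.no_flips_off_level[of a b] that by simp_all
  show "hflips Pix {..<N + 1} {..<N} \<le> 16 * enn2real (hausdorff1 Z) / \<epsilon> + 9 * real (card (components Z))"
    unfolding one.total_flips(1)[symmetric]
    by (rule order_trans[OF sum_le card]) (fact le1, fact zero)
  show "vflips Pix {..<N} {..<N + 1} \<le> 16 * enn2real (hausdorff1 Z) / \<epsilon> + 9 * real (card (components Z))"
    unfolding one.total_flips(2)[symmetric]
    by (rule order_trans[OF sum_le card]) (fact le1, fact zero)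
qed

text \<open>
  The Euclidean norm is at most the sum of the flips, and \<open>\<epsilon> \<le> 2 t\<close>.
\<close>
lemma estimator_dominated:
  assumes len: "hausdorff1 Z < \<infinity>" and comps: "finite (components Z)"
  shows "perimeter_estimator \<epsilon> m t f u \<le> 32 * enn2real (hausdorff1 Z) + 36 * t * real (card (components Z))"
proof -
  define P G where "P = enn2real (hausdorff1 Z)" and "G = real (card (components Z))"
  have nn: "nh a b \<ge> 0" "nv a b \<ge> 0" for a b
    by (simp_all add: nh_def nv_def hflips_nonneg vflips_nonneg)
  have N0: "N > 0" using N t by (cases N) auto
  have e: "\<epsilon> \<le> 2 * t"
  proof -
    have "1 * \<epsilon> \<le> real N * \<epsilon>" using N0 eps by (intro mult_right_mono) auto
    then show ?thesis using N by simp
  qed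
  have "perimeter_estimator \<epsilon> m t f u \<le> (\<Sum>a\<in>B. \<Sum>b\<in>B. \<epsilon> * (nh a b + nv a b))"
    unfolding estimator_eq
  proof (intro sum_mono mult_left_mono)
    fix a b show "norm (nh a b, nv a b) \<le> nh a b + nv a b"
      using norm_Pair_le[of "nh a b" "nv a b"] nn by simp
  qed (use eps in auto)
  also have "\<dots> = \<epsilon> * (hflips Pix {..<N + 1} {..<N} + vflips Pix {..<N} {..<N + 1})"
    by (simp add: sum_distrib_left[symmetric] sum.distrib total_flips)
  also have "\<dots> \<le> \<epsilon> * ((16 * P / \<epsilon> + 9 * G) + (16 * P / \<epsilon> + 9 * G))"
    using flips_le[OF assms] eps unfolding P_def G_def by (intro mult_left_mono add_mono) auto
  also have "\<dots> = 32 * P + 18 * \<epsilon> * G" using eps by (simp add: field_simps)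
  also have "\<dots> \<le> 32 * P + 18 * (2 * t) * G" using e by (intro add_left_mono mult_right_mono mult_left_mono) (auto simp: G_def)
  finally show ?thesis by (simp add: P_def G_def)
qed

end

context level_grid begin

abbreviation resolved :: "nat \<Rightarrow> nat \<Rightarrow> bool" where
  "resolved a b \<equiv> block_resolved {(x, y). f (pt x y) - u = 0} {X a..X (hi a)} {X b..X (hi b)} \<epsilon> (nh a b) (nv a b)"

lemma near_block:
  assumes p: "p \<in> Q a b" and s: "s $ 1 \<in> thick (X a) (X (hi a)) \<delta>" "s $ 2 \<in> thick (X b) (X (hi b)) \<delta>"
  shows "dist p s \<le> 8 * \<delta>"
proof -
  have "\<bar>p $ 1 - s $ 1\<bar> \<le> 4 * \<delta>" "\<bar>p $ 2 - s $ 2\<bar> \<le> 4 * \<delta>"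
    using p s X_hi[of a] X_hi[of b] unfolding Q_def mem_Collect_eq atLeastAtMost_iff by linarith+
  moreover have "dist p s \<le> \<bar>p $ 1 - s $ 1\<bar> + \<bar>p $ 2 - s $ 2\<bar>"
    using norm_le_l1_cart[of "p - s"] by (simp add: dist_norm UNIV_2)
  ultimately show ?thesis by linarith
qed

lemma near_block': "p \<in> Q a b \<Longrightarrow> s \<in> Q a b \<Longrightarrow> dist p s \<le> 8 * \<delta>"
  using delta_pos by (intro near_block) (auto simp: Q_def)

lemma block_law:
  assumes ab: "a \<in> B" "b \<in> B" and p: "p \<in> Q a b" "f p = u"
    and \<eta>: "\<eta> > 0" "3 * \<eta> \<le> max \<bar>pd 1 f p\<bar> \<bar>pd 2 f p\<bar>"
    and osc: "\<And>k s. dist p s \<le> 8 * \<delta> \<Longrightarrow> \<bar>pd k f s - pd k f p\<bar> \<le> \<eta>"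
  shows "nh a b \<le> 3 * real m \<and> nv a b \<le> 3 * real m \<and>
    ((\<forall>s k. \<bar>s $ 1 - X a\<bar> \<le> 5 * \<delta> \<longrightarrow> \<bar>s $ 2 - X b\<bar> \<le> 5 * \<delta> \<longrightarrow> f s = u \<longrightarrow> pd k f s \<noteq> 0) \<longrightarrow>
     resolved a b)"
proof -
  have *: "nh a b \<le> 3 * real m \<and> nv a b \<le> 3 * real m \<and>
    ((\<forall>x y. x \<in> thick (X a) (X (hi a)) \<delta> \<longrightarrow> y \<in> thick (X b) (X (hi b)) \<delta> \<longrightarrow> f (pt x y) - u = 0 \<longrightarrow>
        pd 1 f (pt x y) \<noteq> 0 \<and> pd 2 f (pt x y) \<noteq> 0) \<longrightarrow>
     resolved a b)"
    unfolding nh_def nv_def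
  proof (rule block_dichotomy[OF eps X_def X_def hi(1)[OF ab(1)] hi(2)[OF ab(1)] hi(3,4) hi(1)[OF ab(2)] hi(2)[OF ab(2)] hi(3,4)
        delta_pos _ _ _ _ _ \<eta>(1), where px = "p $ 1" and py = "p $ 2"])
    show "p $ 1 \<in> {X a..X (hi a)}" "p $ 2 \<in> {X b..X (hi b)}" using p by (auto simp: Q_def)
    show "X (hi a) - X a \<le> \<delta>" "X (hi b) - X b \<le> \<delta>" using X_hi[of a] X_hi[of b] by auto
    show "f (pt (p $ 1) (p $ 2)) - u = 0" using p by (simp add: pt_eta)
    show "3 * \<eta> \<le> max \<bar>pd 1 f (pt (p $ 1) (p $ 2))\<bar> \<bar>pd 2 f (pt (p $ 1) (p $ 2))\<bar>"
      using \<eta> by (simp add: pt_eta)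
    fix x y assume "x \<in> thick (X a) (X (hi a)) \<delta>" "y \<in> thick (X b) (X (hi b)) \<delta>"
    then have "dist p (pt x y) \<le> 8 * \<delta>" by (intro near_block[OF p(1)]) (simp_all add: pt_nth)
    then show "\<bar>pd 1 f (pt x y) - pd 1 f (pt (p $ 1) (p $ 2))\<bar> \<le> \<eta> \<and>
       \<bar>pd 2 f (pt x y) - pd 2 f (pt (p $ 1) (p $ 2))\<bar> \<le> \<eta>"
      using osc by (simp add: pt_eta)
  qed (auto simp: Pix_def)
  have sub: "\<bar>x - X a\<bar> \<le> 5 * \<delta>" if "x \<in> thick (X a) (X (hi a)) \<delta>" for x a
    using that X_hi[of a] delta_pos by auto
  show ?thesis
  proof (intro conjI impI)
    assume tang: "\<forall>s k. \<bar>s $ 1 - X a\<bar> \<le> 5 * \<delta> \<longrightarrow> \<bar>s $ 2 - X b\<bar> \<le> 5 * \<delta> \<longrightarrow> f s = u \<longrightarrow> pd k f s \<noteq> 0"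
    have "pd 1 f (pt x y) \<noteq> 0 \<and> pd 2 f (pt x y) \<noteq> 0"
      if "x \<in> thick (X a) (X (hi a)) \<delta>" "y \<in> thick (X b) (X (hi b)) \<delta>" "f (pt x y) - u = 0" for x y
      using tang[rule_format, of "pt x y"] sub[OF that(1)] sub[OF that(2)] that(3) by (simp add: pt_nth)
    with * show "resolved a b" by blast
  qed (use * in auto)
qed

text \<open>
  The function \<open>h\<close> below is the coordinate along the tangent at \<open>p\<close>. All chords of \<open>Z\<close> in the block
  are almost orthogonal to the gradient at \<open>p\<close>, so \<open>Z\<close> is there a Lipschitz image, with constant
  \<open>1 + \<sigma>\<close>, of a set of reals of diameter at most \<open>D\<close>.
\<close>
lemma block_length:
  assumes p: "p \<in> Q a b" and \<sigma>: "\<sigma> > 0" and c: "c > 0" "c \<le> norm (pd 1 f p, pd 2 f p)"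
    and \<eta>: "2 * \<eta> \<le> \<sigma> / (1 + \<sigma>) * c"
    and osc: "\<And>k s. dist p s \<le> 8 * \<delta> \<Longrightarrow> \<bar>pd k f s - pd k f p\<bar> \<le> \<eta>"
    and D: "D \<ge> 0" "\<And>q s. q \<in> Z \<inter> Q a b \<Longrightarrow> s \<in> Z \<inter> Q a b \<Longrightarrow> dist q s \<le> D"
  shows "hausdorff1 (Z \<inter> Q a b) \<le> ennreal ((1 + \<sigma>) * D)"
proof -
  define v1 v2 where "v1 = pd 1 f p" and "v2 = pd 2 f p"
  define w where "w = norm (v1, v2)"
  define h where "h s = (v1 * s $ 2 - v2 * s $ 1) / w" for s :: "real^2"
  have chord: "dist q s \<le> (1 + \<sigma>) * \<bar>h q - h s\<bar> \<and> \<bar>h q - h s\<bar> \<le> dist q s"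
    if qs: "q \<in> Z \<inter> Q a b" "s \<in> Z \<inter> Q a b" for q s
  proof -
    define d1 d2 where "d1 = q $ 1 - s $ 1" and "d2 = q $ 2 - s $ 2"
    have r: "dist q s = norm (d1, d2)" by (simp add: dist_norm norm_real2 d1_def d2_def)
    obtain \<xi> :: "2 \<Rightarrow> real^2" where \<xi>: "f q - f s = (\<Sum>k\<in>UNIV. pd k f (\<xi> k) * (q $ k - s $ k))"
      "\<And>k l. \<xi> k $ l \<in> closed_segment (s $ l) (q $ l)" using field_increment[OF f] by blast
    have seg: "x \<in> {l..h}" if "x \<in> closed_segment y z" "y \<in> {l..h}" "z \<in> {l..h}" for x y z l h :: real
      using that by (auto simp: closed_segment_eq_real_ivl split: if_splits)
    have "\<xi> k $ 1 \<in> {X a..X (hi a)}" "\<xi> k $ 2 \<in> {X b..X (hi b)}" for k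
      by (rule seg[OF \<xi>(2)]; use qs in \<open>simp add: Q_def\<close>)+
    then have "\<xi> k \<in> Q a b" for k by (simp add: Q_def)
    then have o: "\<bar>pd k f (\<xi> k) - pd k f p\<bar> \<le> \<eta>" for k
      by (intro osc near_block'[OF p])
    have "0 = pd 1 f (\<xi> 1) * d1 + pd 2 f (\<xi> 2) * d2"
      using \<xi>(1) qs by (simp add: Z_def UNIV_2 d1_def d2_def)
    then have "v1 * d1 + v2 * d2 = - ((pd 1 f (\<xi> 1) - v1) * d1 + (pd 2 f (\<xi> 2) - v2) * d2)"
      by (simp add: algebra_simps)
    also have "\<bar>\<dots>\<bar> \<le> \<bar>(pd 1 f (\<xi> 1) - v1) * d1\<bar> + \<bar>(pd 2 f (\<xi> 2) - v2) * d2\<bar>" by simp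
    also have "\<dots> \<le> \<eta> * norm (d1, d2) + \<eta> * norm (d1, d2)"
      unfolding abs_mult
    proof (intro add_mono mult_mono)
      show "\<bar>pd 1 f (\<xi> 1) - v1\<bar> \<le> \<eta>" "\<bar>pd 2 f (\<xi> 2) - v2\<bar> \<le> \<eta>"
        using o[of 1] o[of 2] by (simp_all add: v1_def v2_def)
      then show "0 \<le> \<eta>" "0 \<le> \<eta>" by linarith+
      show "\<bar>d1\<bar> \<le> norm (d1, d2)" "\<bar>d2\<bar> \<le> norm (d1, d2)"
        using norm_fst_le[of d1 d2] norm_snd_le[of d2 d1] by auto
    qed auto
    also have "\<dots> = 2 * \<eta> * norm (d1, d2)" by simp
    also have "\<dots> \<le> \<sigma> / (1 + \<sigma>) * c * norm (d1, d2)" using \<eta> by (intro mult_right_mono) auto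
    finally have steep: "\<bar>v1 * d1 + v2 * d2\<bar> \<le> \<sigma> / (1 + \<sigma>) * c * norm (d1, d2)" .
    have hd: "h q - h s = (v1 * d2 - v2 * d1) / w"
      by (simp add: h_def d1_def d2_def diff_divide_distrib[symmetric] algebra_simps)
    have cw: "c \<le> norm (v1, v2)" using c by (simp add: v1_def v2_def)
    show ?thesis
      unfolding r hd w_def using chord_projection[OF c(1) cw \<sigma> steep] by blast
  qed
  show ?thesis
  proof (rule hausdorff1_le_spread[where h = h])
    fix q s assume qs: "q \<in> Z \<inter> Q a b" "s \<in> Z \<inter> Q a b"
    show "dist q s \<le> (1 + \<sigma>) * \<bar>h q - h s\<bar>" using chord[OF qs] by blast
    show "\<bar>h q - h s\<bar> \<le> D" using chord[OF qs] D(2)[OF qs] by linarith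
  qed (use \<sigma> D in auto)
qed

lemma norm_pair_mono: "\<bar>x\<bar> \<le> x' \<Longrightarrow> \<bar>y\<bar> \<le> y' \<Longrightarrow> norm (x, y) \<le> norm (x', y')" for x y x' y' :: real
proof -
  assume "\<bar>x\<bar> \<le> x'" "\<bar>y\<bar> \<le> y'"
  then have "\<bar>x\<bar> \<le> \<bar>x'\<bar>" "\<bar>y\<bar> \<le> \<bar>y'\<bar>" by linarith+
  then have "x\<^sup>2 \<le> x'\<^sup>2" "y\<^sup>2 \<le> y'\<^sup>2" by (simp_all only: abs_le_square_iff)
  then show ?thesis by (simp add: norm_Pair)
qed

lemma norm_pair_shift: "0 \<le> e \<Longrightarrow> norm (x + e, y + e) \<le> norm (x, y) + 2 * e" for x y e :: real
  using norm_triangle_ineq[of "(x, y)" "(e, e)"] norm_Pair_le[of e e] by simp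

lemma resolved_diameter:
  assumes res: "resolved a b"
    and qs: "q \<in> Z \<inter> Q a b" "s \<in> Z \<inter> Q a b"
  shows "dist q s \<le> \<epsilon> * norm (nh a b, nv a b) + 2 * \<epsilon>"
proof -
  have "(q $ 1, q $ 2) \<in> {(x, y). f (pt x y) - u = 0} \<inter> {X a..X (hi a)} \<times> {X b..X (hi b)}"
    "(s $ 1, s $ 2) \<in> {(x, y). f (pt x y) - u = 0} \<inter> {X a..X (hi a)} \<times> {X b..X (hi b)}"
    using qs by (auto simp: Z_def Q_def pt_eta)
  from res[unfolded block_resolved_def, THEN conjunct1, rule_format, OF this]
  have "\<bar>q $ 1 - s $ 1\<bar> \<le> \<epsilon> * (nh a b + 1)" "\<bar>q $ 2 - s $ 2\<bar> \<le> \<epsilon> * (nv a b + 1)" by auto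
  then have "norm (q $ 1 - s $ 1, q $ 2 - s $ 2) \<le> norm (\<epsilon> * (nh a b + 1), \<epsilon> * (nv a b + 1))"
    by (rule norm_pair_mono)
  also have "\<dots> = norm (\<epsilon> *\<^sub>R (nh a b + 1, nv a b + 1))" by simp
  also have "\<dots> = \<epsilon> * norm (nh a b + 1, nv a b + 1)" unfolding norm_scaleR using eps by simp
  also have "\<dots> \<le> \<epsilon> * (norm (nh a b, nv a b) + 2)" using norm_pair_shift[of 1] eps by (intro mult_left_mono) auto
  finally show ?thesis by (simp add: dist_norm norm_real2 algebra_simps)
qed

lemma resolved_arc:
  assumes res: "resolved a b"
  shows "\<exists>C p. compact C \<and> C \<subseteq> Z \<inter> {s. s $ 1 \<in> {X a<..<X (hi a)} \<and> s $ 2 \<in> {X b<..<X (hi b)}} \<and>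
     {0..<\<epsilon> * norm (nh a b, nv a b) - 10 * \<epsilon>} \<subseteq> dist p ` C"
proof -
  have nn: "nh a b \<ge> 0" "nv a b \<ge> 0" by (simp_all add: nh_def nv_def hflips_nonneg vflips_nonneg)
  consider "nh a b \<le> 4" "nv a b \<le> 4" | C p q where
    "C \<subseteq> {(x, y). f (pt x y) - u = 0} \<inter> interior {X a..X (hi a)} \<times> interior {X b..X (hi b)}" "compact C"
    "connected C" "p \<in> C" "q \<in> C" "\<epsilon> * (nh a b - 5) \<le> \<bar>fst p - fst q\<bar>" "\<epsilon> * (nv a b - 5) \<le> \<bar>snd p - snd q\<bar>"
    using res unfolding block_resolved_def by blast
  then show ?thesis
  proof cases
    case 1
    have "norm (nh a b, nv a b) \<le> nh a b + nv a b" using norm_Pair_le[of "nh a b" "nv a b"] nn by simp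
    then have "\<epsilon> * norm (nh a b, nv a b) \<le> \<epsilon> * 10" using 1 eps by (intro mult_left_mono) auto
    then have "{0..<\<epsilon> * norm (nh a b, nv a b) - 10 * \<epsilon>} = {}" by simp
    then show ?thesis by (intro exI[of _ "{}"]) simp
  next
    case 2
    define C' where "C' = (\<lambda>z. pt (fst z) (snd z)) ` C"
    have C': "compact C'" "connected C'"
      unfolding C'_def using compact_continuous_image[OF continuous_on_pt 2(2)]
        connected_continuous_image[OF continuous_on_pt 2(3)] .
    have sub: "C' \<subseteq> Z \<inter> {s. s $ 1 \<in> {X a<..<X (hi a)} \<and> s $ 2 \<in> {X b<..<X (hi b)}}"
    proof
      fix s assume "s \<in> C'"
      then obtain z where z: "z \<in> C" "s = pt (fst z) (snd z)" by (auto simp: C'_def)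
      then have *: "f s = u" "fst z \<in> {X a<..<X (hi a)}" "snd z \<in> {X b<..<X (hi b)}"
        using 2(1) by (auto simp: interior_atLeastAtMost_real)
      have "s \<in> Q a b" using * z by (auto simp: Q_def pt_nth)
      then have "s \<in> square t" by (rule block_in_square)
      then show "s \<in> Z \<inter> {s. s $ 1 \<in> {X a<..<X (hi a)} \<and> s $ 2 \<in> {X b<..<X (hi b)}}"
        using * z by (simp add: Z_def pt_nth)
    qed
    define p' q' where "p' = pt (fst p) (snd p)" and "q' = pt (fst q) (snd q)"
    have mem: "p' \<in> C'" "q' \<in> C'" using 2 by (auto simp: C'_def p'_def q'_def)
    have "\<epsilon> * norm (nh a b, nv a b) - 10 * \<epsilon> \<le> dist p' q'"
    proof -
      have "\<epsilon> * norm (nh a b, nv a b) = norm (\<epsilon> *\<^sub>R (nh a b, nv a b))" unfolding norm_scaleR using eps by simp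
      also have "\<dots> = norm (\<epsilon> * nh a b, \<epsilon> * nv a b)" by simp
      also have "\<dots> \<le> norm (\<bar>fst p - fst q\<bar> + 5 * \<epsilon>, \<bar>snd p - snd q\<bar> + 5 * \<epsilon>)"
        using 2(6,7) eps nn by (intro norm_pair_mono) (auto simp: algebra_simps abs_mult)
      also have "\<dots> \<le> norm (\<bar>fst p - fst q\<bar>, \<bar>snd p - snd q\<bar>) + 2 * (5 * \<epsilon>)"
        using eps by (intro norm_pair_shift) auto
      also have "norm (\<bar>fst p - fst q\<bar>, \<bar>snd p - snd q\<bar>) = dist p' q'"
        by (simp add: p'_def q'_def dist_pt norm_Pair)
      finally show ?thesis by simp
    qed
    then have "{0..<\<epsilon> * norm (nh a b, nv a b) - 10 * \<epsilon>} \<subseteq> dist p' ` C'"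
      using connected_radial_image[OF C'(2) mem] by blast
    then show ?thesis using C'(1) sub by blast
  qed
qed

lemma open_blocks_disjoint:
  assumes "a \<in> B" "a' \<in> B" "a \<noteq> a'" "x \<in> {X a<..<X (hi a)}"
  shows "x \<notin> {X a'<..<X (hi a')}"
proof -
  have *: "X (hi a) \<le> X a'" if lt: "a < a'" "a \<in> B" "a' \<in> B" for a a'
  proof -
    have "m dvd a' - a" using that by (auto simp: B_eq)
    then have "m \<le> a' - a" using lt by (intro dvd_imp_le) auto
    then show ?thesis using lt by (auto simp: X_le hi_def)
  qed
  consider "a < a'" | "a' < a" using assms by linarith
  then show ?thesis using *[of a a'] *[of a' a] assms by cases auto
qed

text \<open>
  \<open>E\<close> contains the axis-parallel tangencies. A block is exceptional (\<open>Bad\<close>) if it is close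
  to one of them; each point of \<open>E\<close> is close to at most \<open>11\<^sup>2 = 121\<close> blocks. The other blocks that meet \<open>Z\<close>
  contribute an error of at most \<open>10 \<epsilon>\<close>, an exceptional one at most \<open>8 \<delta>\<close>, whence the
  constants in \<open>K\<close>, with \<open>968 = 8 \<cdot> 121\<close>. Since \<open>K\<close> is independent of \<open>\<epsilon>\<close> and \<open>m\<close>, this is the limit in
  quantitative form.
\<close>
lemma estimator_bounds:
  assumes \<sigma>: "\<sigma> > 0" and c: "c > 0" and \<eta>: "\<eta> > 0" "3 * \<eta> \<le> c" "2 * \<eta> \<le> \<sigma> / (1 + \<sigma>) * c"
    and steep: "\<And>p. p \<in> Z \<Longrightarrow> c \<le> max \<bar>pd 1 f p\<bar> \<bar>pd 2 f p\<bar>"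
    and osc: "\<And>p k s. p \<in> Z \<Longrightarrow> dist p s \<le> 8 * \<delta> \<Longrightarrow> \<bar>pd k f s - pd k f p\<bar> \<le> \<eta>"
    and E: "finite E" "\<And>s k. s \<in> square (t + 5 * \<delta>) \<Longrightarrow> f s = u \<Longrightarrow> pd k f s = 0 \<Longrightarrow> s \<in> E"
    and len: "hausdorff1 Z < \<infinity>" and comps: "finite (components Z)"
  defines "P \<equiv> enn2real (hausdorff1 Z)"
  defines "K \<equiv> 10 * (16 * P + 9 * real (card (components Z))) + 968 * real (card E)"
  shows "P \<le> (1 + \<sigma>) * (perimeter_estimator \<epsilon> m t f u + K * (1 / real m + \<delta>))"
    "perimeter_estimator \<epsilon> m t f u \<le> P + K * (1 / real m + \<delta>)"
proof -
  define G where "G = real (card (components Z))"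
  have P: "hausdorff1 Z = ennreal P" "P \<ge> 0" using len by (auto simp: P_def less_top)
  define est where "est = perimeter_estimator \<epsilon> m t f u"
  define n where "n x = \<epsilon> * norm (nh (fst x) (snd x), nv (fst x) (snd x))" for x
  have n0: "n x \<ge> 0" for x using eps by (simp add: n_def)
  define V where "V = {(a, b) \<in> B \<times> B. Q a b \<inter> Z \<noteq> {}}"
  define near where "near e = {a \<in> B. \<bar>e $ 1 - X a\<bar> \<le> 5 * \<delta>} \<times> {b \<in> B. \<bar>e $ 2 - X b\<bar> \<le> 5 * \<delta>}" for e :: "real^2"
  define Bad where "Bad = V \<inter> (\<Union>e\<in>E. near e)"
  define Good where "Good = V - Bad"
  have fin: "finite V" "finite Bad" "finite Good"
    using finite_B by (auto simp: V_def Bad_def Good_def intro: finite_subset[of _ "B \<times> B"])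
  have VB: "fst x \<in> B" "snd x \<in> B" if "x \<in> V" for x using that by (auto simp: V_def)
  have pt_of: "\<exists>p. p \<in> Q (fst x) (snd x) \<and> p \<in> Z" if "x \<in> V" for x using that by (auto simp: V_def)
  have law: "nh (fst x) (snd x) \<le> 3 * real m \<and> nv (fst x) (snd x) \<le> 3 * real m \<and>
    ((\<forall>s k. \<bar>s $ 1 - X (fst x)\<bar> \<le> 5 * \<delta> \<longrightarrow> \<bar>s $ 2 - X (snd x)\<bar> \<le> 5 * \<delta> \<longrightarrow> f s = u \<longrightarrow> pd k f s \<noteq> 0) \<longrightarrow>
     resolved (fst x) (snd x))"
    if x: "x \<in> V" for x
  proof -
    obtain p where p: "p \<in> Q (fst x) (snd x)" "p \<in> Z" using pt_of[OF x] by blast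
    have "f p = u" using p by (simp add: Z_def)
    moreover have "3 * \<eta> \<le> max \<bar>pd 1 f p\<bar> \<bar>pd 2 f p\<bar>" using steep[OF p(2)] \<eta> by linarith
    ultimately show ?thesis using VB[OF x] p osc[OF p(2)] \<eta>(1) by (intro block_law) auto
  qed
  have res: "resolved (fst x) (snd x)"
    if x: "x \<in> Good" for x
  proof -
    have xV: "x \<in> V" using x by (simp add: Good_def)
    have "pd k f s \<noteq> 0"
      if s: "\<bar>s $ 1 - X (fst x)\<bar> \<le> 5 * \<delta>" "\<bar>s $ 2 - X (snd x)\<bar> \<le> 5 * \<delta>" "f s = u" for s k
    proof
      assume "pd k f s = 0"
      have b: "- t \<le> X a" "X a \<le> t" if "a \<in> B" for a
        using that X_le[of 0 a] X_le[of a N] by (auto simp: B_eq X_0 X_N)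
      have "s \<in> square (t + 5 * \<delta>)"
        using s(1,2) b[OF VB(1)[OF xV]] b[OF VB(2)[OF xV]] unfolding square_def forall_2 by auto
      then have "s \<in> E" using E(2) s(3) \<open>pd k f s = 0\<close> by blast
      moreover have "x \<in> near s" using s VB[OF xV] by (cases x) (auto simp: near_def)
      ultimately show False using x xV by (auto simp: Good_def Bad_def)
    qed
    then show ?thesis using law[OF xV] by blast
  qed
  have cardV: "\<epsilon> * real (card V) \<le> (16 * P + 9 * G) * (1 / real m + \<delta>)"
  proof -
    have "\<epsilon> * real (card V) \<le> \<epsilon> * (16 * P / \<delta> + 9 * G)"
      using card_blocks_meeting[OF len comps] eps unfolding V_def P_def G_def by (intro mult_left_mono) auto
    also have "\<dots> = 16 * P * (1 / real m) + 9 * G * \<epsilon>" using eps m by (simp add: \<delta>_def field_simps)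
    also have "\<dots> \<le> (16 * P + 9 * G) * (1 / real m) + (16 * P + 9 * G) * \<delta>"
      using P eps_le_delta eps by (intro add_mono mult_mono) (auto simp: G_def)
    finally show ?thesis by (simp add: algebra_simps)
  qed
  have cardBad: "real (card Bad) \<le> 121 * real (card E)"
  proof -
    have "card Bad \<le> card (\<Union>e\<in>E. near e)"
      using finite_B E(1) by (intro card_mono) (auto simp: Bad_def near_def)
    also have "\<dots> \<le> (\<Sum>e\<in>E. card (near e))" by (rule card_UN_le[OF E(1)])
    also have "\<dots> \<le> (\<Sum>e\<in>E. 11 * 11)"
    proof (rule sum_mono)
      fix e :: "real^2"
      have "card {a \<in> B. \<bar>e $ 1 - X a\<bar> \<le> 5 * \<delta>} \<le> 11" "card {b \<in> B. \<bar>e $ 2 - X b\<bar> \<le> 5 * \<delta>} \<le> 11"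
        using card_blocks_near[of "e $ 1"] card_blocks_near[of "e $ 2"] by linarith+
      then show "card (near e) \<le> 11 * 11" unfolding near_def card_cartesian_product by (intro mult_mono) auto
    qed
    finally have "card Bad \<le> 121 * card E" by simp
    then show ?thesis by linarith
  qed
  have est: "est = (\<Sum>x\<in>V. n x)"
  proof -
    have "est = (\<Sum>x\<in>B \<times> B. n x)"
      unfolding est_def estimator_eq n_def by (simp add: sum.cartesian_product case_prod_unfold)
    also have "\<dots> = (\<Sum>x\<in>V. n x)"
    proof (rule sum.mono_neutral_right)
      show "\<forall>x\<in>B \<times> B - V. n x = 0"
      proof
        fix x assume "x \<in> B \<times> B - V"
        then have "Q (fst x) (snd x) \<inter> Z = {}" "fst x \<in> B" "snd x \<in> B" by (auto simp: V_def)
        from no_flips_off_level[OF this] show "n x = 0" by (simp add: n_def)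
      qed
    qed (use finite_B in \<open>auto simp: V_def\<close>)
    finally show ?thesis .
  qed
  have split: "(\<Sum>x\<in>V. h x) = (\<Sum>x\<in>Good. h x) + (\<Sum>x\<in>Bad. h x)" for h :: "nat \<times> nat \<Rightarrow> real"
    unfolding Good_def using fin by (intro sum.subset_diff) (auto simp: Bad_def)
  have E0: "968 * real (card E) * \<delta> \<le> 968 * real (card E) * (1 / real m + \<delta>)" by (intro mult_left_mono) auto
  have V0: "10 * (\<epsilon> * real (card V)) \<le> 10 * ((16 * P + 9 * G) * (1 / real m + \<delta>))" using cardV by simp
  have K: "10 * (\<epsilon> * real (card V)) + 968 * real (card E) * \<delta> \<le> K * (1 / real m + \<delta>)"
    using add_mono[OF V0 E0] unfolding K_def G_def by (simp only: distrib_right mult.assoc)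
  have cardG: "card Good \<le> card V" using fin by (intro card_mono) (auto simp: Good_def)

  \<comment> \<open>Upper bound: cover \<open>Z\<close> by the closed blocks, with \<open>D x\<close> a bound of the diameter of \<open>Z\<close> in block \<open>x\<close>.\<close>
  define D where "D x = (if x \<in> Good then n x + 2 * \<epsilon> else 8 * \<delta>)" for x
  have D0: "D x \<ge> 0" for x using n0 eps delta_pos by (simp add: D_def)
  have "hausdorff1 Z \<le> hausdorff1 (\<Union>x\<in>V. Z \<inter> Q (fst x) (snd x))"
  proof (rule hausdorff1_mono, rule subsetI)
    fix s assume s: "s \<in> Z"
    then have "s \<in> square t" by (simp add: Z_def)
    then obtain a b where "a \<in> B" "b \<in> B" "s \<in> Q a b" using blocks_cover by blast
    then show "s \<in> (\<Union>x\<in>V. Z \<inter> Q (fst x) (snd x))" using s by (intro UN_I[of "(a, b)"]) (auto simp: V_def)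
  qed
  also have "\<dots> \<le> (\<Sum>x\<in>V. hausdorff1 (Z \<inter> Q (fst x) (snd x)))" by (rule hausdorff1_UN[OF fin(1)])
  also have "\<dots> \<le> (\<Sum>x\<in>V. ennreal ((1 + \<sigma>) * D x))"
  proof (rule sum_mono)
    fix x assume x: "x \<in> V"
    obtain p where p: "p \<in> Q (fst x) (snd x)" "p \<in> Z" using pt_of[OF x] by blast
    show "hausdorff1 (Z \<inter> Q (fst x) (snd x)) \<le> ennreal ((1 + \<sigma>) * D x)"
    proof (rule block_length[OF p(1) \<sigma> c _ \<eta>(3) osc[OF p(2)] D0])
      show "c \<le> norm (pd 1 f p, pd 2 f p)"
        using steep[OF p(2)] norm_fst_le[of "pd 1 f p" "pd 2 f p"]
          norm_snd_le[of "pd 2 f p" "pd 1 f p"] by simp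
      fix q s assume qs: "q \<in> Z \<inter> Q (fst x) (snd x)" "s \<in> Z \<inter> Q (fst x) (snd x)"
      show "dist q s \<le> D x"
      proof (cases "x \<in> Good")
        case True
        then show ?thesis using resolved_diameter[OF res[OF True] qs] by (simp add: D_def n_def)
      next
        case False
        then show ?thesis using near_block'[of q "fst x" "snd x" s] qs by (simp add: D_def)
      qed
    qed
  qed
  also have "\<dots> = ennreal (\<Sum>x\<in>V. (1 + \<sigma>) * D x)" using D0 \<sigma> by (intro sum_ennreal) simp
  finally have "P \<le> (\<Sum>x\<in>V. (1 + \<sigma>) * D x)"
    using P D0 \<sigma> by (simp add: sum_nonneg ennreal_le_iff)
  also have "\<dots> = (1 + \<sigma>) * (\<Sum>x\<in>V. D x)" by (simp add: sum_distrib_left)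
  also have "(\<Sum>x\<in>V. D x) \<le> est + K * (1 / real m + \<delta>)"
  proof -
    have "(\<Sum>x\<in>V. D x) = (\<Sum>x\<in>Good. n x + 2 * \<epsilon>) + (\<Sum>x\<in>Bad. 8 * \<delta>)"
      unfolding split by (intro arg_cong2[of _ _ _ _ "(+)"] sum.cong) (auto simp: D_def Good_def)
    also have "\<dots> = (\<Sum>x\<in>Good. n x) + 2 * \<epsilon> * real (card Good) + 8 * \<delta> * real (card Bad)"
      by (simp add: sum.distrib)
    also have "\<dots> \<le> est + 2 * \<epsilon> * real (card V) + 8 * \<delta> * (121 * real (card E)) "
      using cardG cardBad eps delta_pos n0
      by (intro add_mono mult_left_mono) (auto simp: est split sum_nonneg)
    moreover have "0 \<le> \<epsilon> * real (card V)" using eps by simp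
    ultimately show ?thesis using K by (simp add: algebra_simps)
  qed
  finally show "P \<le> (1 + \<sigma>) * (perimeter_estimator \<epsilon> m t f u + K * (1 / real m + \<delta>))"
    using \<sigma> by (simp add: est_def)

  \<comment> \<open>Lower bound: the arcs inside the open blocks are compact and pairwise disjoint, hence separated.\<close>
  define inner :: "nat \<times> nat \<Rightarrow> (real^2) set" where "inner x = {s. s $ 1 \<in> {X (fst x)<..<X (hi (fst x))} \<and> s $ 2 \<in> {X (snd x)<..<X (hi (snd x))}}" for x
  have "\<forall>x\<in>Good. \<exists>C p. compact C \<and> C \<subseteq> Z \<inter> inner x \<and> {0..<n x - 10 * \<epsilon>} \<subseteq> dist p ` C"
    using resolved_arc[OF res] unfolding n_def inner_def by blast
  from bchoice[OF this] obtain C where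
    "\<forall>x\<in>Good. \<exists>p. compact (C x) \<and> C x \<subseteq> Z \<inter> inner x \<and> {0..<n x - 10 * \<epsilon>} \<subseteq> dist p ` C x" by blast
  from bchoice[OF this] obtain p where
    "\<forall>x\<in>Good. compact (C x) \<and> C x \<subseteq> Z \<inter> inner x \<and> {0..<n x - 10 * \<epsilon>} \<subseteq> dist (p x) ` C x" by blast
  then have C: "\<And>x. x \<in> Good \<Longrightarrow> compact (C x)" "\<And>x. x \<in> Good \<Longrightarrow> C x \<subseteq> Z \<inter> inner x"
    "\<And>x. x \<in> Good \<Longrightarrow> {0..<n x - 10 * \<epsilon>} \<subseteq> dist (p x) ` C x"
    by blast+
  have disj: "C x \<inter> C y = {}" if "x \<in> Good" "y \<in> Good" "x \<noteq> y" for x y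
  proof (rule ccontr)
    assume "C x \<inter> C y \<noteq> {}"
    then obtain s where s: "s \<in> C x" "s \<in> C y" by blast
    have xy: "fst x \<in> B" "snd x \<in> B" "fst y \<in> B" "snd y \<in> B" using that VB by (auto simp: Good_def)
    have "fst x \<noteq> fst y \<or> snd x \<noteq> snd y" using that by (simp add: prod_eq_iff)
    then show False
      using open_blocks_disjoint[OF xy(1,3)] open_blocks_disjoint[OF xy(2,4)] s C(2)[OF that(1)] C(2)[OF that(2)]
      unfolding inner_def by blast
  qed
  have "\<exists>g>0. \<forall>x\<in>Good. \<forall>y\<in>Good. x \<noteq> y \<longrightarrow> (\<forall>v\<in>C x. \<forall>w\<in>C y. g \<le> dist v w)"
    by (rule compact_family_gap[OF fin(3)]) (fact C(1), fact disj)
  then obtain g where g: "g > 0" "\<forall>x\<in>Good. \<forall>y\<in>Good. x \<noteq> y \<longrightarrow> (\<forall>v\<in>C x. \<forall>w\<in>C y. g \<le> dist v w)"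
    by blast
  have "(\<Sum>x\<in>Good. ennreal (n x - 10 * \<epsilon>)) \<le> hausdorff1 Z"
  proof (rule hausdorff1_ge_separated[OF fin(3) g(1)])
    fix x assume x: "x \<in> Good"
    show "C x \<subseteq> Z" using C(2)[OF x] by blast
    show "{0..<n x - 10 * \<epsilon>} \<subseteq> dist (p x) ` C x" by (rule C(3)[OF x])
  next
    fix x y v w assume "x \<in> Good" "y \<in> Good" "x \<noteq> y" "v \<in> C x" "w \<in> C y"
    then show "g \<le> dist v w" using g(2) by blast
  qed
  moreover have "ennreal (\<Sum>x\<in>Good. n x - 10 * \<epsilon>) \<le> (\<Sum>x\<in>Good. ennreal (n x - 10 * \<epsilon>))"
  proof -
    have "ennreal (\<Sum>x\<in>Good. n x - 10 * \<epsilon>) \<le> ennreal (\<Sum>x\<in>Good. max 0 (n x - 10 * \<epsilon>))"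
      by (intro ennreal_leI sum_mono) simp
    also have "\<dots> = (\<Sum>x\<in>Good. ennreal (max 0 (n x - 10 * \<epsilon>)))" by (rule sum_ennreal[symmetric]) simp
    also have "\<dots> = (\<Sum>x\<in>Good. ennreal (n x - 10 * \<epsilon>))" by (intro sum.cong) (auto simp: max_def ennreal_neg)
    finally show ?thesis .
  qed
  ultimately have "ennreal (\<Sum>x\<in>Good. n x - 10 * \<epsilon>) \<le> ennreal P"
    unfolding P(1)[symmetric] by (rule order_trans[rotated])
  then have "(\<Sum>x\<in>Good. n x - 10 * \<epsilon>) \<le> P" using P(2) by (simp add: ennreal_le_iff)
  then have "(\<Sum>x\<in>Good. n x) \<le> P + 10 * \<epsilon> * real (card Good)" by (simp add: sum_subtractf algebra_simps)
  also have "\<dots> \<le> P + 10 * (\<epsilon> * real (card V))" using cardG eps by simp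
  finally have good: "(\<Sum>x\<in>Good. n x) \<le> P + 10 * (\<epsilon> * real (card V))" .
  have "(\<Sum>x\<in>Bad. n x) \<le> (\<Sum>x\<in>Bad. 6 * \<delta>)"
  proof (rule sum_mono)
    fix x assume "x \<in> Bad"
    then have "nh (fst x) (snd x) \<le> 3 * real m" "nv (fst x) (snd x) \<le> 3 * real m" using law by (auto simp: Bad_def)
    moreover have "nh (fst x) (snd x) \<ge> 0" "nv (fst x) (snd x) \<ge> 0"
      by (simp_all add: nh_def nv_def hflips_nonneg vflips_nonneg)
    ultimately have "norm (nh (fst x) (snd x), nv (fst x) (snd x)) \<le> 6 * real m"
      using norm_Pair_le[of "nh (fst x) (snd x)" "nv (fst x) (snd x)"] by simp
    then have "n x \<le> \<epsilon> * (6 * real m)" unfolding n_def using eps by (intro mult_left_mono) auto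
    then show "n x \<le> 6 * \<delta>" by (simp add: \<delta>_def algebra_simps)
  qed
  also have "\<dots> = 6 * \<delta> * real (card Bad)" by simp
  also have "\<dots> \<le> 6 * \<delta> * (121 * real (card E))" using cardBad delta_pos by (intro mult_left_mono) auto
  also have "\<dots> \<le> 968 * real (card E) * \<delta>" using delta_pos by simp
  finally have bad: "(\<Sum>x\<in>Bad. n x) \<le> 968 * real (card E) * \<delta>" .
  show "perimeter_estimator \<epsilon> m t f u \<le> P + K * (1 / real m + \<delta>)"
    using good bad K unfolding est_def[symmetric] est split by linarith
qed

end

section \<open>Convergence for one realisation\<close>

lemma level_set_steep:
  assumes f: "C1_field f" and reg: "regular_at_level t f u"
  obtains c where "c > 0" "\<And>p. p \<in> square t \<Longrightarrow> f p = u \<Longrightarrow> c \<le> max \<bar>pd 1 f p\<bar> \<bar>pd 2 f p\<bar>"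
proof -
  define Z where "Z = square t \<inter> {s. f s = u}"
  define h where "h p = max \<bar>pd 1 f p\<bar> \<bar>pd 2 f p\<bar>" for p
  have "continuous_on UNIV (pd k f)" for k using f by (simp add: C1_field_def)
  then have h: "continuous_on Z h"
    unfolding h_def by (intro continuous_intros) (auto intro: continuous_on_subset)
  have "closed {s. f s = u}"
    using C1_field_continuous[OF f] by (intro closed_Collect_eq continuous_intros) auto
  then have Z: "compact Z" unfolding Z_def by (intro compact_Int_closed compact_square)
  show thesis
  proof (cases "Z = {}")
    case True
    then show ?thesis using that[of 1] by (auto simp: Z_def)
  next
    case False
    obtain p where p: "p \<in> Z" "\<And>q. q \<in> Z \<Longrightarrow> h p \<le> h q"
      using continuous_attains_inf[OF Z False h] by blast
    have "\<not> critical_point f p" using reg p(1) by (auto simp: Z_def regular_at_level_def)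
    then have "h p > 0" by (auto simp: critical_point_def forall_2 h_def)
    with p that[of "h p"] show ?thesis by (auto simp: Z_def h_def)
  qed
qed

lemma gradient_uniformly_continuous:
  assumes f: "C1_field f" and \<eta>: "\<eta> > 0"
  obtains d where "d > 0" "\<And>p s k. p \<in> square t \<Longrightarrow> dist p s \<le> d \<Longrightarrow> \<bar>pd k f s - pd k f p\<bar> \<le> \<eta>"
proof -
  have "\<exists>d>0. \<forall>p\<in>square t. \<forall>s. dist p s \<le> d \<longrightarrow> \<bar>pd k f s - pd k f p\<bar> \<le> \<eta>" for k
  proof -
    have "continuous_on (square (t + 1)) (pd k f)"
      using f by (auto simp: C1_field_def intro: continuous_on_subset)
    then have "uniformly_continuous_on (square (t + 1)) (pd k f)"
      by (rule compact_uniformly_continuous[OF _ compact_square])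
    then obtain e where e: "e > 0" "\<And>p s. p \<in> square (t + 1) \<Longrightarrow> s \<in> square (t + 1) \<Longrightarrow> dist s p < e \<Longrightarrow>
        dist (pd k f s) (pd k f p) < \<eta>"
      using \<eta> unfolding uniformly_continuous_on_def by metis
    show ?thesis
    proof (intro exI[of _ "min 1 (e / 2)"] conjI ballI allI impI)
      fix p s :: "real^2" assume p: "p \<in> square t" and d: "dist p s \<le> min 1 (e / 2)"
      have "s $ i \<in> {- (t + 1)..t + 1}" for i
        using p d abs_diff_component_le_dist[of p i s] by (auto simp: square_def dest!: spec[of _ i])
      then have "s \<in> square (t + 1)" by (simp add: square_def)
      have "p $ i \<in> {- (t + 1)..t + 1}" for i
        using p by (auto simp: square_def dest!: spec[of _ i])
      then have "p \<in> square (t + 1)" by (simp add: square_def)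
      moreover have "dist s p < e" using d e(1) by (simp add: dist_commute)
      ultimately show "\<bar>pd k f s - pd k f p\<bar> \<le> \<eta>"
        using e(2)[of p s] \<open>s \<in> square (t + 1)\<close> by (simp add: dist_real_def)
    qed (use e in auto)
  qed
  then obtain d where d: "\<And>k. d k > 0" "\<And>k p s. p \<in> square t \<Longrightarrow> dist p s \<le> d k \<Longrightarrow> \<bar>pd k f s - pd k f p\<bar> \<le> \<eta>"
    by metis
  show thesis
  proof (rule that[of "min (d 1) (d 2)"])
    fix p s :: "real^2" and k :: 2 assume "p \<in> square t" "dist p s \<le> min (d 1) (d 2)"
    then show "\<bar>pd k f s - pd k f p\<bar> \<le> \<eta>"
      using d(2)[of p s k] exhaust_2[of k] by auto
  qed (use d in simp)
qed

lemma finite_components_iff: "num_boundary_components T f u < \<infinity> \<longleftrightarrow> finite (components (excursion_boundary T f u))"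
  by (auto simp: num_boundary_components_def emeasure_count_space ennreal_of_nat_eq_real_of_nat)

lemma enn2real_num_boundary_components:
  "finite (components (excursion_boundary T f u)) \<Longrightarrow>
    enn2real (num_boundary_components T f u) = real (card (components (excursion_boundary T f u)))"
  by (simp add: num_boundary_components_def emeasure_count_space)

context
  fixes f :: "real^2 \<Rightarrow> real" and t u :: real
  assumes t: "t > 0" and f: "C2_field f" and reg: "regular_at_level t f u"
    and len: "perimeter (square t) f u < \<infinity>" and comps: "num_boundary_components (square t) f u < \<infinity>"
begin

lemma level_gridI:
  assumes "\<epsilon> > 0" "m \<ge> 1" "square_vertices t \<subseteq> grid t \<epsilon>"
  obtains N where "level_grid t \<epsilon> N m f"
proof -
  obtain N where "real N * \<epsilon> = 2 * t" "grid_rows t \<epsilon> = N + 1" using grid_rows_eq[OF assms(1) t assms(3)] .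
  then have "level_grid t \<epsilon> N m f" using t assms f by unfold_locales (auto simp: C2_field_def)
  then show thesis by (rule that)
qed

lemma boundary_eq: "excursion_boundary (square t) f u = {s \<in> square t. f s = u}"
  using regular_excursion_boundary f reg by (auto simp: C2_field_def)

lemma estimator_le:
  assumes "\<epsilon> > 0" "m \<ge> 1" "square_vertices t \<subseteq> grid t \<epsilon>"
  shows "perimeter_estimator \<epsilon> m t f u \<le>
    32 * enn2real (perimeter (square t) f u) + 36 * t * enn2real (num_boundary_components (square t) f u)"
proof -
  obtain N where "level_grid t \<epsilon> N m f" using level_gridI[OF assms] .
  then interpret level_grid t \<epsilon> N m f u .
  have Z: "excursion_boundary (square t) f u = Z" by (simp add: boundary_eq Z_def)
  have fin: "finite (components Z)" using comps by (simp only: finite_components_iff Z)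
  then have "enn2real (num_boundary_components (square t) f u) = real (card (components Z))"
    using enn2real_num_boundary_components[of "square t" f u] by (simp only: Z)
  moreover have "perimeter (square t) f u = hausdorff1 Z" by (simp add: perimeter_def Z)
  ultimately show ?thesis using estimator_dominated[OF _ fin] len by simp
qed

text \<open>
  The bounds hold with a factor \<open>1 + \<sigma>\<close> for any \<open>\<sigma> > 0\<close> once the blocks are small; \<open>\<sigma>\<close> is chosen
  so that \<open>\<sigma> P \<le> e / 2\<close>.
\<close>
lemma estimator_tendsto:
  fixes m :: "nat \<Rightarrow> nat" and \<epsilon> :: "nat \<Rightarrow> real"
  assumes m1: "\<And>n. n \<ge> 1 \<Longrightarrow> m n \<ge> 1" and m: "filterlim m at_top sequentially"
    and eps: "\<And>n. n \<ge> 1 \<Longrightarrow> \<epsilon> n > 0" and delta: "(\<lambda>n. real (m n) * \<epsilon> n) \<longlonglongrightarrow> 0"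
    and vert: "\<And>n. n \<ge> 1 \<Longrightarrow> square_vertices t \<subseteq> grid t (\<epsilon> n)"
  shows "(\<lambda>n. perimeter_estimator (\<epsilon> n) (m n) t f u) \<longlonglongrightarrow> enn2real (perimeter (square t) f u)"
proof (rule tendstoI)
  fix e :: real assume e: "e > 0"
  have f1: "C1_field f" using f by (simp add: C2_field_def)
  define Z where "Z = {s \<in> square t. f s = u}"
  have Zeq: "excursion_boundary (square t) f u = Z" by (simp add: boundary_eq Z_def)
  have fin: "finite (components Z)" using comps by (simp only: finite_components_iff Zeq)
  have lenZ: "hausdorff1 Z < \<infinity>" using len by (simp add: perimeter_def Zeq)
  define P where "P = enn2real (hausdorff1 Z)"
  have P: "P \<ge> 0" "enn2real (perimeter (square t) f u) = P" by (simp_all add: P_def perimeter_def Zeq)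
  obtain c where c: "c > 0" "\<And>p. p \<in> square t \<Longrightarrow> f p = u \<Longrightarrow> c \<le> max \<bar>pd 1 f p\<bar> \<bar>pd 2 f p\<bar>"
    using level_set_steep[OF f1 reg] by blast
  define \<sigma> where "\<sigma> = e / (2 * (P + 1))"
  have \<sigma>: "\<sigma> > 0" "\<sigma> * P \<le> e / 2" using e P(1) by (auto simp: \<sigma>_def field_simps)
  define \<eta> where "\<eta> = min (c / 3) (\<sigma> / (1 + \<sigma>) * c / 2)"
  have \<eta>: "\<eta> > 0" "3 * \<eta> \<le> c" "2 * \<eta> \<le> \<sigma> / (1 + \<sigma>) * c"
  proof -
    define y where "y = \<sigma> / (1 + \<sigma>) * c"
    have "y > 0" "\<eta> = min (c / 3) (y / 2)" using c(1) \<sigma>(1) by (simp_all add: y_def \<eta>_def)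
    then show "\<eta> > 0" "3 * \<eta> \<le> c" "2 * \<eta> \<le> \<sigma> / (1 + \<sigma>) * c"
      using c(1) unfolding y_def[symmetric] by auto
  qed
  obtain d where d: "d > 0" "\<And>p s k. p \<in> square t \<Longrightarrow> dist p s \<le> d \<Longrightarrow> \<bar>pd k f s - pd k f p\<bar> \<le> \<eta>"
    using gradient_uniformly_continuous[OF f1 \<eta>(1)] by metis
  obtain r where r: "r > 0" "finite {s \<in> square (t + r). f s = u \<and> (\<exists>k. pd k f s = 0)}"
    using tangencies_finite[OF f reg t] .
  define E where "E = {s \<in> square (t + r). f s = u \<and> (\<exists>k. pd k f s = 0)}"
  define K where "K = 10 * (16 * P + 9 * real (card (components Z))) + 968 * real (card E)"
  define w where "w n = 1 / real (m n) + real (m n) * \<epsilon> n" for n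
  have bounds: "P \<le> (1 + \<sigma>) * (perimeter_estimator (\<epsilon> n) (m n) t f u + K * w n) \<and>
      perimeter_estimator (\<epsilon> n) (m n) t f u \<le> P + K * w n"
    if n: "n \<ge> 1" and small: "8 * (real (m n) * \<epsilon> n) \<le> d" "5 * (real (m n) * \<epsilon> n) \<le> r" for n
  proof -
    obtain N where "level_grid t (\<epsilon> n) N (m n) f" using level_gridI[OF eps[OF n] m1[OF n] vert[OF n]] .
    then interpret G: level_grid t "\<epsilon> n" N "m n" f u .
    have GZ: "G.Z = Z" by (simp add: G.Z_def Z_def)
    have sub: "square (t + 5 * G.\<delta>) \<subseteq> square (t + r)"
    proof
      fix s assume s: "s \<in> square (t + 5 * G.\<delta>)"
      have "s $ k \<in> {- (t + r)..t + r}" for k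
        using s small(2) by (auto simp: square_def G.\<delta>_def dest!: spec[of _ k])
      then show "s \<in> square (t + r)" by (simp add: square_def)
    qed
    have c': "c \<le> max \<bar>pd 1 f p\<bar> \<bar>pd 2 f p\<bar>" if "p \<in> G.Z" for p
      using c(2) that by (simp add: G.Z_def)
    have osc: "\<bar>pd k f s - pd k f p\<bar> \<le> \<eta>" if "p \<in> G.Z" "dist p s \<le> 8 * G.\<delta>" for p k s
      using d(2)[of p s k] that small(1) by (simp add: G.Z_def G.\<delta>_def)
    have inE: "s \<in> E" if "s \<in> square (t + 5 * G.\<delta>)" "f s = u" "pd k f s = 0" for s k
      using that sub by (auto simp: E_def)
    have finE: "finite E" using r(2) by (simp add: E_def)
    note b = G.estimator_bounds[OF \<sigma>(1) c(1) \<eta> _ _ finE, unfolded GZ, OF _ _ _ lenZ fin,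
      folded P_def, folded K_def, unfolded G.\<delta>_def, folded w_def]
    show ?thesis
      by (intro conjI b) (use c' osc inE in \<open>auto simp: GZ G.\<delta>_def\<close>)
  qed
  have w0: "w \<longlonglongrightarrow> 0"
  proof -
    have "(\<lambda>n. 1 / real (m n)) \<longlonglongrightarrow> 0"
      using filterlim_compose[OF lim_1_over_n m] .
    from tendsto_add[OF this delta] show ?thesis unfolding w_def by simp
  qed
  have "(\<lambda>n. K * w n) \<longlonglongrightarrow> 0" using tendsto_mult_left[OF w0, of K] by simp
  then have "\<forall>\<^sub>F n in sequentially. K * w n < e / 2" using e by (intro order_tendstoD) auto
  moreover have "\<forall>\<^sub>F n in sequentially. real (m n) * \<epsilon> n < min (d / 8) (r / 5)"
    using d(1) r(1) by (intro order_tendstoD(2)[OF delta]) auto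
  moreover have "\<forall>\<^sub>F n in sequentially. n \<ge> 1" by (rule eventually_ge_at_top)
  ultimately show "\<forall>\<^sub>F n in sequentially. dist (perimeter_estimator (\<epsilon> n) (m n) t f u) (enn2real (perimeter (square t) f u)) < e"
  proof eventually_elim
    case (elim n)
    define est where "est = perimeter_estimator (\<epsilon> n) (m n) t f u"
    have b: "P \<le> (1 + \<sigma>) * (est + K * w n)" "est \<le> P + K * w n"
      using bounds[of n] elim by (auto simp: est_def)
    have "P / (1 + \<sigma>) \<le> est + K * w n" using b(1) \<sigma>(1) by (simp add: field_simps)
    moreover have "P - \<sigma> * P \<le> P / (1 + \<sigma>)"
    proof -
      have "(P - \<sigma> * P) * (1 + \<sigma>) = P - \<sigma> * \<sigma> * P" by (simp add: algebra_simps)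
      also have "\<dots> \<le> P" using P by simp
      finally show ?thesis using \<sigma>(1) by (simp add: pos_le_divide_eq)
    qed
    ultimately have "P - est \<le> \<sigma> * P + K * w n" by linarith
    then have "\<bar>est - P\<bar> < e" using b(2) elim(1) \<sigma>(2) e by linarith
    then show ?case by (simp add: dist_real_def est_def P)
  qed
qed

end

section \<open>Convergence in mean\<close>

lemma estimator_measurable:
  assumes "\<And>s. X s \<in> borel_measurable M"
  shows "(\<lambda>\<omega>. perimeter_estimator \<epsilon> m t (\<lambda>s. X s \<omega>) u) \<in> borel_measurable M"
proof -
  have [measurable]: "(\<lambda>\<omega>. pixel t \<epsilon> (\<lambda>s. X s \<omega>) u i j) \<in> borel_measurable M" for i j
    unfolding pixel_def using assms[measurable] by measurable
  have [measurable]: "(\<lambda>\<omega>. N_h t \<epsilon> m (\<lambda>s. X s \<omega>) u a b) \<in> borel_measurable M"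
    "(\<lambda>\<omega>. N_v t \<epsilon> m (\<lambda>s. X s \<omega>) u a b) \<in> borel_measurable M" for a b
    unfolding N_h_def N_v_def by measurable
  show ?thesis unfolding perimeter_estimator_def norm_Pair by measurable
qed

lemma in_L1_enn2real:
  assumes "in_L1 M Y"
  shows "integrable M (\<lambda>\<omega>. enn2real (Y \<omega>))" "AE \<omega> in M. Y \<omega> < \<infinity>"
proof -
  have Y[measurable]: "Y \<in> borel_measurable M" and fin: "(\<integral>\<^sup>+\<omega>. Y \<omega> \<partial>M) < \<infinity>" using assms by (auto simp: in_L1_def)
  have "AE \<omega> in M. Y \<omega> \<noteq> \<infinity>" using nn_integral_noteq_infinite[OF Y] fin by simp
  then show "AE \<omega> in M. Y \<omega> < \<infinity>" by (simp add: less_top)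
  have "(\<integral>\<^sup>+\<omega>. ennreal (enn2real (Y \<omega>)) \<partial>M) \<le> (\<integral>\<^sup>+\<omega>. Y \<omega> \<partial>M)"
    by (intro nn_integral_mono) (simp add: ennreal_enn2real_if)
  then show "integrable M (\<lambda>\<omega>. enn2real (Y \<omega>))"
    using fin by (intro integrableI_nonneg) auto
qed

theorem proposition1:
  fixes M :: "'w measure" and X :: "real^2 \<Rightarrow> 'w \<Rightarrow> real" and t u :: real
    and m :: "nat \<Rightarrow> nat" and \<epsilon> :: "nat \<Rightarrow> real"
  assumes "t > 0"
    and "smooth_random_field M X" and "almost_surely_regular M X t" and "integrable_boundary M X t"
    and "\<And>n. n \<ge> 1 \<Longrightarrow> m n \<ge> 1" and "mono_on {1..} m" and "filterlim m at_top sequentially"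
    and "\<And>n. n \<ge> 1 \<Longrightarrow> \<epsilon> n > 0" and "(\<lambda>n. real (m n) * \<epsilon> n) \<longlonglongrightarrow> 0"
    and "\<And>n. n \<ge> 1 \<Longrightarrow> square_vertices t \<subseteq> grid t (\<epsilon> n)"
  defines "err \<equiv> \<lambda>n \<omega>. \<bar>perimeter_estimator (\<epsilon> n) (m n) t (\<lambda>s. X s \<omega>) u
                          - enn2real (perimeter (square t) (\<lambda>s. X s \<omega>) u)\<bar>"
  shows "(\<forall>n\<ge>1. integrable M (err n)) \<and> (\<lambda>n. LINT \<omega>|M. err n \<omega>) \<longlonglongrightarrow> 0"
proof -
  define P where "P \<omega> = enn2real (perimeter (square t) (\<lambda>s. X s \<omega>) u)" for \<omega>
  define G where "G \<omega> = enn2real (num_boundary_components (square t) (\<lambda>s. X s \<omega>) u)" for \<omega>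
  define est where "est n \<omega> = perimeter_estimator (\<epsilon> n) (m n) t (\<lambda>s. X s \<omega>) u" for n \<omega>
  have err: "err n \<omega> = \<bar>est n \<omega> - P \<omega>\<bar>" for n \<omega> by (simp add: err_def est_def P_def)
  have L1: "in_L1 M (\<lambda>\<omega>. perimeter (square t) (\<lambda>s. X s \<omega>) u)"
    "in_L1 M (\<lambda>\<omega>. num_boundary_components (square t) (\<lambda>s. X s \<omega>) u)"
    using assms(4) by (auto simp: integrable_boundary_def)
  note P = in_L1_enn2real[OF L1(1), folded P_def] and G = in_L1_enn2real[OF L1(2), folded G_def]
  have good: "AE \<omega> in M. C2_field (\<lambda>s. X s \<omega>) \<and> regular_at_level t (\<lambda>s. X s \<omega>) u \<and>
      perimeter (square t) (\<lambda>s. X s \<omega>) u < \<infinity> \<and> num_boundary_components (square t) (\<lambda>s. X s \<omega>) u < \<infinity>"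
  proof -
    have "AE \<omega> in M. C2_field (\<lambda>s. X s \<omega>)" using assms(2) by (intro AE_I2) (auto simp: smooth_random_field_def)
    moreover have "AE \<omega> in M. regular_at_level t (\<lambda>s. X s \<omega>) u" using assms(3) by (simp add: almost_surely_regular_def)
    ultimately show ?thesis using P(2) G(2) by eventually_elim blast
  qed
  have [measurable]: "est n \<in> borel_measurable M" for n
    unfolding est_def by (rule estimator_measurable) (use assms(2) in \<open>simp add: smooth_random_field_def\<close>)
  have [measurable]: "P \<in> borel_measurable M" using P(1) by simp
  have est0: "est n \<omega> \<ge> 0" if "n \<ge> 1" for n \<omega>
    unfolding est_def perimeter_estimator_def using assms(8)[OF that] by (intro mult_nonneg_nonneg sum_nonneg) auto
  define W where "W \<omega> = 33 * P \<omega> + 36 * t * G \<omega>" for \<omega>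
  have dom: "AE \<omega> in M. norm (err (Suc n) \<omega>) \<le> W \<omega>" for n
    using good
  proof eventually_elim
    case (elim \<omega>)
    have "est (Suc n) \<omega> \<le> 32 * P \<omega> + 36 * t * G \<omega>"
      unfolding est_def P_def G_def using elim assms(1,5,8,10) by (intro estimator_le) auto
    moreover have "P \<omega> \<ge> 0" by (simp add: P_def)
    ultimately show ?case using est0[of "Suc n" \<omega>] unfolding err W_def by simp
  qed
  have lim: "AE \<omega> in M. (\<lambda>n. err (Suc n) \<omega>) \<longlonglongrightarrow> 0"
    using good
  proof eventually_elim
    case (elim \<omega>)
    have "(\<lambda>n. est n \<omega>) \<longlonglongrightarrow> P \<omega>"
      unfolding est_def P_def using elim assms by (intro estimator_tendsto) auto
    then have "(\<lambda>n. err n \<omega>) \<longlonglongrightarrow> 0"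
      unfolding err using tendsto_rabs_zero LIM_zero by blast
    then show ?case by (rule LIMSEQ_Suc)
  qed
  have W: "integrable M W" unfolding W_def using P(1) G(1) by auto
  have meas: "err n \<in> borel_measurable M" for n unfolding err by measurable
  have "integrable M (err (Suc n))" for n
    by (rule integrable_dominated_convergence2[OF _ meas W lim dom]) auto
  then have "\<forall>n\<ge>1. integrable M (err n)" by (metis Suc_le_D One_nat_def)
  moreover have "(\<lambda>n. LINT \<omega>|M. err (Suc n) \<omega>) \<longlonglongrightarrow> (LINT \<omega>|M. 0)"
    by (rule integral_dominated_convergence[OF _ meas W lim dom]) auto
  then have "(\<lambda>n. LINT \<omega>|M. err n \<omega>) \<longlonglongrightarrow> 0"
    using filterlim_sequentially_Suc[of "\<lambda>n. LINT \<omega>|M. err n \<omega>"] by simp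
  ultimately show ?thesis by blast
qed

end
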